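(* Let $M$ be a Kähler manifold, let $f : M\to\mathbb{R}^n$ be an isometric immersion with parallel pluri-mean curvature and Gauss map $\tau : M \to Gr$, and let $(f_\vartheta)_{\vartheta\in\mathbb{R}}$ be the associated family of $f$. Let $\tau_\vartheta : M\to Gr$ be the Gauss map of $f_\vartheta$. Then $(\tau_\vartheta)_{\vartheta\in\mathbb{R}}$ is the associated family of $\tau$.
   Context: A Kähler manifold $M$ is a Riemannian manifold of real dimension $2m$ with a parallel orthogonal almost complex structure $J$. For $\vartheta\in\mathbb{R}$ put $\mathcal{R}_\vartheta = \cos(\vartheta) I+\sin(\vartheta)J$ on $TM$. For an isometric immersion $f : M\to\mathbb{R}^n$ let $N_f = df(TM)^\perp$ be the normal bundle with its normal connection and $\alpha_f(X,Y) = (\partial_X\partial_Yf)^{N_f}$ its second fundamental form; write $\alpha = \alpha_f$. The immersion has parallel pluri-mean curvature if $\alpha^{(1,1)}(x,y)=\frac12(\alpha(x,y)+\alpha(Jx,Jy))$ is parallel with respect to the tangent and normal connections. Associated family of an immersion: a one-parameter family of isometric immersions $f_\vartheta : M\to\mathbb{R}^n$ with $f_0=f$ such that for each $\vartheta$ there is a parallel (fibrewise isometric) bundle isomorphism $\psi_\vartheta : N_{f_\vartheta}\to N_f$ with $\psi_\vartheta(\alpha_{f_\vartheta}(x,y)) = \alpha(\mathcal{R}_\vartheta x,\mathcal{R}_\vartheta y)$ for all $x,y$. $Gr$ is the Grassmannian of $2m$-dimensional linear subspaces of $\mathbb{R}^n$, a Riemannian symmetric space (with metric induced by identifying a subspace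 with its orthogonal projection in the space of symmetric $n\times n$ matrices); $T_EGr = \mathrm{Hom}(E,E^\perp)$. The Gauss map of an immersion $f$ is $\tau(p) = df_p(T_pM)$. Associated family of a map into a symmetric space: for a smooth map $\tau : M\to S$ into a symmetric space $S$ with curvature tensor $R^S$, a family of smooth maps $\tau_\vartheta : M\to S$ with $\tau_0=\tau$ is associated to $\tau$ if for each $\vartheta$ there is a parallel bundle isomorphism $\phi_\vartheta : \tau_\vartheta^*TS\to\tau^*TS$ preserving $R^S$ such that $\phi_\vartheta\circ d\tau_\vartheta = d\tau\circ\mathcal{R}_\vartheta$ (pull-back bundles carry the connection induced by the Levi-Civita connection of $S$). *)

theory Defs
  imports "HOL-Analysis.Analysis"
begin

primrec Ck_on :: "nat \<Rightarrow> 'a::euclidean_space set \<Rightarrow> ('a \<Rightarrow> 'b::real_normed_vector) \<Rightarrow> bool" where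
  "Ck_on 0 S f \<longleftrightarrow> continuous_on S f"
| "Ck_on (Suc k) S f \<longleftrightarrow>
     (\<forall>x\<in>S. f differentiable (at x)) \<and> (\<forall>v. Ck_on k S (\<lambda>x. frechet_derivative f (at x) v))"

text \<open>Only used for open \<open>S\<close>.\<close>

definition smooth_on :: "'a::euclidean_space set \<Rightarrow> ('a \<Rightarrow> 'b::real_normed_vector) \<Rightarrow> bool" where
  "smooth_on S f \<longleftrightarrow> (\<forall>k. Ck_on k S f)"

text \<open>A chart is a domain \<open>U\<close> together with a coordinate map, relevant on \<open>U\<close> only. A tangent
  vector at \<open>p\<close> is described, in each chart \<open>c\<close> around \<open>p\<close>, by its vector of coordinates in the
  model space \<open>'v\<close>; passing from \<open>c\<close> to \<open>d\<close> changes coordinates by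
  \<open>coord_deriv c (chart_map d) p\<close>. Accordingly a tensor is a function of a chart, a point and
  coordinate vectors, with the corresponding transformation law.\<close>

type_synonym ('p, 'v) chart = "'p set \<times> ('p \<Rightarrow> 'v)"

abbreviation chart_dom :: "('p, 'v) chart \<Rightarrow> 'p set" where
  "chart_dom \<equiv> fst"

abbreviation chart_map :: "('p, 'v) chart \<Rightarrow> 'p \<Rightarrow> 'v" where
  "chart_map \<equiv> snd"

definition chart_inv :: "('p, 'v) chart \<Rightarrow> 'v \<Rightarrow> 'p" where
  "chart_inv c = inv_into (chart_dom c) (chart_map c)"

locale smooth_manifold =
  fixes M :: "'p topology" and A :: "('p, 'v::euclidean_space) chart set"
  assumes Hausdorff: "Hausdorff_space M"
    and second_countable: "second_countable M"
    and cover: "(\<Union>c\<in>A. chart_dom c) = topspace M"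
    and chart_open: "c \<in> A \<Longrightarrow> openin M (chart_dom c)"
    and chart_image_open: "c \<in> A \<Longrightarrow> open (chart_map c ` chart_dom c)"
    and chart_homeo: "c \<in> A \<Longrightarrow>
      homeomorphic_map (subtopology M (chart_dom c)) (top_of_set (chart_map c ` chart_dom c)) (chart_map c)"
    and transition_smooth: "c \<in> A \<Longrightarrow> d \<in> A \<Longrightarrow>
      smooth_on (chart_map c ` (chart_dom c \<inter> chart_dom d)) (chart_map d \<circ> chart_inv c)"

text \<open>Only used for \<open>U\<close> open in the manifold.\<close>

definition smooth_map_on ::
  "('p, 'v::euclidean_space) chart set \<Rightarrow> 'p set \<Rightarrow> ('p \<Rightarrow> 'b::real_normed_vector) \<Rightarrow> bool" where
  "smooth_map_on A U h \<longleftrightarrow>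
     (\<forall>c\<in>A. smooth_on (chart_map c ` (chart_dom c \<inter> U)) (h \<circ> chart_inv c))"

text \<open>The derivative \<open>\<partial>\<^sub>v h = dh\<^sub>p(v)\<close>, for the tangent vector at \<open>p\<close> with coordinates \<open>v\<close> in \<open>c\<close>.\<close>

definition coord_deriv ::
  "('p, 'v::euclidean_space) chart \<Rightarrow> ('p \<Rightarrow> 'b::real_normed_vector) \<Rightarrow> 'p \<Rightarrow> 'v \<Rightarrow> 'b" where
  "coord_deriv c h p v = frechet_derivative (h \<circ> chart_inv c) (at (chart_map c p)) v"

locale riemannian_manifold = smooth_manifold M A
  for M :: "'p topology" and A :: "('p, 'v::euclidean_space) chart set" +
  fixes g :: "('p, 'v) chart \<Rightarrow> 'p \<Rightarrow> 'v \<Rightarrow> 'v \<Rightarrow> real"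
  assumes metric_bilinear: "c \<in> A \<Longrightarrow> p \<in> chart_dom c \<Longrightarrow> bilinear (g c p)"
    and metric_sym: "c \<in> A \<Longrightarrow> p \<in> chart_dom c \<Longrightarrow> g c p v w = g c p w v"
    and metric_pos: "c \<in> A \<Longrightarrow> p \<in> chart_dom c \<Longrightarrow> v \<noteq> 0 \<Longrightarrow> g c p v v > 0"
    and metric_smooth: "c \<in> A \<Longrightarrow>
      smooth_on (chart_map c ` chart_dom c) ((\<lambda>p. g c p v w) \<circ> chart_inv c)"
    and metric_change: "c \<in> A \<Longrightarrow> d \<in> A \<Longrightarrow> p \<in> chart_dom c \<inter> chart_dom d \<Longrightarrow>
      g d p (coord_deriv c (chart_map d) p v) (coord_deriv c (chart_map d) p w) = g c p v w"

text \<open>The Levi-Civita derivative \<open>\<nabla>\<^sub>v w\<close> of the vector field with constant coordinates \<open>w\<close>, given by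
  the Koszul formula (constant coordinate fields commute). For a field with coordinates \<open>W\<close> one has
  \<open>\<nabla>\<^sub>v W = \<partial>\<^sub>v W + christoffel g c p v (W p)\<close>.\<close>

definition christoffel ::
  "(('p, 'v::euclidean_space) chart \<Rightarrow> 'p \<Rightarrow> 'v \<Rightarrow> 'v \<Rightarrow> real) \<Rightarrow> ('p, 'v) chart \<Rightarrow> 'p \<Rightarrow> 'v \<Rightarrow> 'v \<Rightarrow> 'v" where
  "christoffel g c p v w = (THE u. \<forall>z. 2 * g c p u z =
     coord_deriv c (\<lambda>q. g c q w z) p v + coord_deriv c (\<lambda>q. g c q v z) p w
     - coord_deriv c (\<lambda>q. g c q v w) p z)"

definition levi_civita ::
  "(('p, 'v::euclidean_space) chart \<Rightarrow> 'p \<Rightarrow> 'v \<Rightarrow> 'v \<Rightarrow> real) \<Rightarrow> ('p, 'v) chart \<Rightarrow> ('p \<Rightarrow> 'v) \<Rightarrow> 'p \<Rightarrow> 'v \<Rightarrow> 'v" where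
  "levi_civita g c W p v = coord_deriv c W p v + christoffel g c p v (W p)"

text \<open>In \<open>complex_parallel\<close>, \<open>(\<nabla>\<^sub>v J) w = \<nabla>\<^sub>v (J w) - J (\<nabla>\<^sub>v w)\<close> with \<open>w\<close> extended by constant
  coordinates.\<close>

locale kaehler_manifold = riemannian_manifold M A g
  for M :: "'p topology" and A :: "('p, 'v::euclidean_space) chart set" and g +
  fixes J :: "('p, 'v) chart \<Rightarrow> 'p \<Rightarrow> 'v \<Rightarrow> 'v"
  assumes complex_linear: "c \<in> A \<Longrightarrow> p \<in> chart_dom c \<Longrightarrow> linear (J c p)"
    and complex_smooth: "c \<in> A \<Longrightarrow>
      smooth_on (chart_map c ` chart_dom c) ((\<lambda>p. J c p v) \<circ> chart_inv c)"
    and complex_change: "c \<in> A \<Longrightarrow> d \<in> A \<Longrightarrow> p \<in> chart_dom c \<inter> chart_dom d \<Longrightarrow>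
      J d p (coord_deriv c (chart_map d) p v) = coord_deriv c (chart_map d) p (J c p v)"
    and complex_square: "c \<in> A \<Longrightarrow> p \<in> chart_dom c \<Longrightarrow> J c p (J c p v) = - v"
    and complex_orthogonal: "c \<in> A \<Longrightarrow> p \<in> chart_dom c \<Longrightarrow> g c p (J c p v) (J c p w) = g c p v w"
    and complex_parallel: "c \<in> A \<Longrightarrow> p \<in> chart_dom c \<Longrightarrow>
      levi_civita g c (\<lambda>q. J c q w) p v - J c p (levi_civita g c (\<lambda>q. w) p v) = 0"

definition rotation ::
  "(('p, 'v::real_vector) chart \<Rightarrow> 'p \<Rightarrow> 'v \<Rightarrow> 'v) \<Rightarrow> real \<Rightarrow> ('p, 'v) chart \<Rightarrow> 'p \<Rightarrow> 'v \<Rightarrow> 'v" where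
  "rotation J \<theta> c p v = cos \<theta> *\<^sub>R v + sin \<theta> *\<^sub>R J c p v"

definition orth_proj :: "'e::euclidean_space set \<Rightarrow> 'e \<Rightarrow> 'e" where
  "orth_proj V x = (THE y. y \<in> V \<and> (\<forall>z\<in>V. (x - y) \<bullet> z = 0))"

text \<open>A family \<open>V\<close> of subspaces of \<open>'e\<close> indexed by points of the manifold is regarded as a vector
  bundle, with the connection \<open>\<nabla>\<^sub>v \<xi> = (\<partial>\<^sub>v \<xi>)\<^sup>V\<close>. This covers both
  the normal bundle of an immersion with its normal connection, and the pull-back of the tangent
  bundle of a submanifold \<open>S\<close> of Euclidean space with the connection induced by the Levi-Civita
  connection of the induced metric on \<open>S\<close>.\<close>

definition bundle_deriv ::
  "('p \<Rightarrow> 'e::euclidean_space set) \<Rightarrow> ('p, 'v::euclidean_space) chart \<Rightarrow> ('p \<Rightarrow> 'e) \<Rightarrow> 'p \<Rightarrow> 'v \<Rightarrow> 'e" where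
  "bundle_deriv V c \<xi> p v = orth_proj (V p) (coord_deriv c \<xi> p v)"

definition smooth_section ::
  "('p, 'v::euclidean_space) chart set \<Rightarrow> ('p \<Rightarrow> 'e::euclidean_space set) \<Rightarrow> 'p set \<Rightarrow> ('p \<Rightarrow> 'e) \<Rightarrow> bool" where
  "smooth_section A V U \<xi> \<longleftrightarrow> smooth_map_on A U \<xi> \<and> (\<forall>p\<in>U. \<xi> p \<in> V p)"

definition parallel_bundle_iso ::
  "'p topology \<Rightarrow> ('p, 'v::euclidean_space) chart set \<Rightarrow>
   ('p \<Rightarrow> 'e::euclidean_space set) \<Rightarrow> ('p \<Rightarrow> 'f::euclidean_space set) \<Rightarrow> ('p \<Rightarrow> 'e \<Rightarrow> 'f) \<Rightarrow> bool" where
  "parallel_bundle_iso M A V W \<Phi> \<longleftrightarrow>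
     (\<forall>p\<in>topspace M. bij_betw (\<Phi> p) (V p) (W p) \<and>
        (\<forall>x\<in>V p. \<forall>y\<in>V p. \<Phi> p (x + y) = \<Phi> p x + \<Phi> p y) \<and>
        (\<forall>r. \<forall>x\<in>V p. \<Phi> p (r *\<^sub>R x) = r *\<^sub>R \<Phi> p x)) \<and>
     (\<forall>U \<xi>. openin M U \<and> smooth_section A V U \<xi> \<longrightarrow>
        smooth_section A W U (\<lambda>p. \<Phi> p (\<xi> p)) \<and>
        (\<forall>c\<in>A. \<forall>p \<in> chart_dom c \<inter> U. \<forall>v.
           bundle_deriv W c (\<lambda>q. \<Phi> q (\<xi> q)) p v = \<Phi> p (bundle_deriv V c \<xi> p v)))"

definition isometric_immersion ::
  "'p topology \<Rightarrow> ('p, 'v::euclidean_space) chart set \<Rightarrow>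
   (('p, 'v) chart \<Rightarrow> 'p \<Rightarrow> 'v \<Rightarrow> 'v \<Rightarrow> real) \<Rightarrow> ('p \<Rightarrow> 'e::euclidean_space) \<Rightarrow> bool" where
  "isometric_immersion M A g f \<longleftrightarrow> smooth_map_on A (topspace M) f \<and>
     (\<forall>c\<in>A. \<forall>p\<in>chart_dom c. \<forall>v w. coord_deriv c f p v \<bullet> coord_deriv c f p w = g c p v w)"

text \<open>The subspace \<open>df\<^sub>p(T\<^sub>pM)\<close>; all charts around \<open>p\<close> contribute the same vectors.\<close>

definition tangent_image ::
  "('p, 'v::euclidean_space) chart set \<Rightarrow> ('p \<Rightarrow> 'e::euclidean_space) \<Rightarrow> 'p \<Rightarrow> 'e set" where
  "tangent_image A f p = {coord_deriv c f p v | c v. c \<in> A \<and> p \<in> chart_dom c}"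

definition normal_space ::
  "('p, 'v::euclidean_space) chart set \<Rightarrow> ('p \<Rightarrow> 'e::euclidean_space) \<Rightarrow> 'p \<Rightarrow> 'e set" where
  "normal_space A f p = orthogonal_comp (tangent_image A f p)"

text \<open>\<open>\<alpha>(v,w) = (\<partial>\<^sub>v \<partial>\<^sub>w f)\<^sup>N\<close>, with \<open>w\<close> extended by constant coordinates.\<close>

definition second_fund ::
  "('p, 'v::euclidean_space) chart set \<Rightarrow> ('p \<Rightarrow> 'e::euclidean_space) \<Rightarrow>
   ('p, 'v) chart \<Rightarrow> 'p \<Rightarrow> 'v \<Rightarrow> 'v \<Rightarrow> 'e" where
  "second_fund A f c p v w =
     orth_proj (normal_space A f p) (coord_deriv c (\<lambda>q. coord_deriv c f q w) p v)"

definition pluri_mean_curv ::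
  "('p, 'v::euclidean_space) chart set \<Rightarrow> (('p, 'v) chart \<Rightarrow> 'p \<Rightarrow> 'v \<Rightarrow> 'v) \<Rightarrow> ('p \<Rightarrow> 'e::euclidean_space) \<Rightarrow>
   ('p, 'v) chart \<Rightarrow> 'p \<Rightarrow> 'v \<Rightarrow> 'v \<Rightarrow> 'e" where
  "pluri_mean_curv A J f c p v w =
     (1/2) *\<^sub>R (second_fund A f c p v w + second_fund A f c p (J c p v) (J c p w))"

text \<open>\<open>(\<nabla>\<^sub>u \<alpha>)(v,w) = \<nabla>\<^sub>u (\<alpha>(v,w)) - \<alpha>(\<nabla>\<^sub>u v, w) - \<alpha>(v, \<nabla>\<^sub>u w)\<close> for the (1,1)-part, with \<open>v\<close> and \<open>w\<close>
  extended by constant coordinates.\<close>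

definition parallel_pluri_mean_curv ::
  "('p, 'v::euclidean_space) chart set \<Rightarrow> (('p, 'v) chart \<Rightarrow> 'p \<Rightarrow> 'v \<Rightarrow> 'v \<Rightarrow> real) \<Rightarrow>
   (('p, 'v) chart \<Rightarrow> 'p \<Rightarrow> 'v \<Rightarrow> 'v) \<Rightarrow> ('p \<Rightarrow> 'e::euclidean_space) \<Rightarrow> bool" where
  "parallel_pluri_mean_curv A g J f \<longleftrightarrow>
     (\<forall>c\<in>A. \<forall>p\<in>chart_dom c. \<forall>u v w.
        bundle_deriv (normal_space A f) c (\<lambda>q. pluri_mean_curv A J f c q v w) p u
        - pluri_mean_curv A J f c p (levi_civita g c (\<lambda>q. v) p u) w
        - pluri_mean_curv A J f c p v (levi_civita g c (\<lambda>q. w) p u) = 0)"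

definition associated_immersions ::
  "'p topology \<Rightarrow> ('p, 'v::euclidean_space) chart set \<Rightarrow> (('p, 'v) chart \<Rightarrow> 'p \<Rightarrow> 'v \<Rightarrow> 'v \<Rightarrow> real) \<Rightarrow>
   (('p, 'v) chart \<Rightarrow> 'p \<Rightarrow> 'v \<Rightarrow> 'v) \<Rightarrow> ('p \<Rightarrow> 'e::euclidean_space) \<Rightarrow> (real \<Rightarrow> 'p \<Rightarrow> 'e) \<Rightarrow> bool" where
  "associated_immersions M A g J f F \<longleftrightarrow>
     (\<forall>\<theta>. isometric_immersion M A g (F \<theta>)) \<and>
     (\<forall>p\<in>topspace M. F 0 p = f p) \<and>
     (\<forall>\<theta>. \<exists>\<psi>. parallel_bundle_iso M A (normal_space A (F \<theta>)) (normal_space A f) \<psi> \<and>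
        (\<forall>p\<in>topspace M. \<forall>x\<in>normal_space A (F \<theta>) p. norm (\<psi> p x) = norm x) \<and>
        (\<forall>c\<in>A. \<forall>p\<in>chart_dom c. \<forall>v w.
           \<psi> p (second_fund A (F \<theta>) c p v w)
           = second_fund A f c p (rotation J \<theta> c p v) (rotation J \<theta> c p w)))"

text \<open>From here on, \<open>S\<close> is (the underlying set of) an embedded submanifold of Euclidean space
  with the induced metric, and vector fields and smooth maps into \<open>S\<close> are viewed as maps into
  the ambient space.\<close>

definition tangent_space :: "'e::euclidean_space set \<Rightarrow> 'e \<Rightarrow> 'e set" where
  "tangent_space S P = {x. \<exists>\<gamma>::real \<Rightarrow> 'e. (\<forall>t. \<gamma> t \<in> S) \<and> \<gamma> 0 = P \<and> (\<gamma> has_vector_derivative x) (at 0)}"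

text \<open>A derivative within \<open>S\<close> is not unique as a linear map on the ambient space, but its values on
  tangent vectors of \<open>S\<close>, the only ones used, are.\<close>

definition cov_deriv :: "'e::euclidean_space set \<Rightarrow> ('e \<Rightarrow> 'e) \<Rightarrow> ('e \<Rightarrow> 'e) \<Rightarrow> 'e \<Rightarrow> 'e" where
  "cov_deriv S X Y P = orth_proj (tangent_space S P) (frechet_derivative Y (at P within S) (X P))"

definition lie_bracket :: "'e::euclidean_space set \<Rightarrow> ('e \<Rightarrow> 'e) \<Rightarrow> ('e \<Rightarrow> 'e) \<Rightarrow> 'e \<Rightarrow> 'e" where
  "lie_bracket S X Y P =
     frechet_derivative Y (at P within S) (X P) - frechet_derivative X (at P within S) (Y P)"

text \<open>The curvature tensor \<open>R(x,y)z = \<nabla>\<^sub>x\<nabla>\<^sub>yz - \<nabla>\<^sub>y\<nabla>\<^sub>xz - \<nabla>\<^bsub>[x,y]\<^esub>z\<close> at \<open>P\<close>. By tensoriality the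
  tangent vectors \<open>x\<close>, \<open>y\<close>, \<open>z\<close> may be extended to any tangent vector fields; we take the
  tangential parts of the constant fields.\<close>

definition curvature :: "'e::euclidean_space set \<Rightarrow> 'e \<Rightarrow> 'e \<Rightarrow> 'e \<Rightarrow> 'e \<Rightarrow> 'e" where
  "curvature S P x y z =
     (let X = (\<lambda>Q. orth_proj (tangent_space S Q) x);
          Y = (\<lambda>Q. orth_proj (tangent_space S Q) y);
          Z = (\<lambda>Q. orth_proj (tangent_space S Q) z)
      in cov_deriv S X (cov_deriv S Y Z) P - cov_deriv S Y (cov_deriv S X Z) P
         - cov_deriv S (lie_bracket S X Y) Z P)"

definition associated_maps ::
  "'p topology \<Rightarrow> ('p, 'v::euclidean_space) chart set \<Rightarrow> (('p, 'v) chart \<Rightarrow> 'p \<Rightarrow> 'v \<Rightarrow> 'v) \<Rightarrow>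
   'e::euclidean_space set \<Rightarrow> ('p \<Rightarrow> 'e) \<Rightarrow> (real \<Rightarrow> 'p \<Rightarrow> 'e) \<Rightarrow> bool" where
  "associated_maps M A J S \<tau> \<tau>' \<longleftrightarrow>
     (\<forall>\<theta>. smooth_map_on A (topspace M) (\<tau>' \<theta>) \<and> (\<forall>p\<in>topspace M. \<tau>' \<theta> p \<in> S)) \<and>
     (\<forall>p\<in>topspace M. \<tau>' 0 p = \<tau> p) \<and>
     (\<forall>\<theta>. \<exists>\<phi>. parallel_bundle_iso M A
                 (\<lambda>p. tangent_space S (\<tau>' \<theta> p)) (\<lambda>p. tangent_space S (\<tau> p)) \<phi> \<and>
        (\<forall>p\<in>topspace M. \<forall>x\<in>tangent_space S (\<tau>' \<theta> p).
           \<forall>y\<in>tangent_space S (\<tau>' \<theta> p). \<forall>z\<in>tangent_space S (\<tau>' \<theta> p).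
             \<phi> p (curvature S (\<tau>' \<theta> p) x y z) = curvature S (\<tau> p) (\<phi> p x) (\<phi> p y) (\<phi> p z)) \<and>
        (\<forall>c\<in>A. \<forall>p\<in>chart_dom c. \<forall>v.
           \<phi> p (coord_deriv c (\<tau>' \<theta>) p v) = coord_deriv c \<tau> p (rotation J \<theta> c p v)))"

text \<open>A subspace is identified with the matrix of its orthogonal projection; the inner product of
  \<open>real ^ 'n ^ 'n\<close> is the trace form. Under this identification \<open>h \<in> Hom(E, E\<^sup>\<bottom>)\<close> (extended by \<open>0\<close> on
  \<open>E\<^sup>\<bottom>\<close>) is the tangent vector \<open>h + h\<^sup>T\<close>, i.e. the tangent vectors at \<open>P\<close> are the symmetric \<open>X\<close>
  with \<open>P X + X P = X\<close>.\<close>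

definition proj_matrix :: "(real ^ 'n) set \<Rightarrow> real ^ 'n ^ 'n" where
  "proj_matrix E = matrix (orth_proj E)"

definition grassmannian :: "nat \<Rightarrow> (real ^ 'n ^ 'n) set" where
  "grassmannian k = {proj_matrix E | E. subspace E \<and> dim E = k}"

definition gauss_map ::
  "('p, 'v::euclidean_space) chart set \<Rightarrow> ('p \<Rightarrow> real ^ 'n) \<Rightarrow> 'p \<Rightarrow> real ^ 'n ^ 'n" where
  "gauss_map A f p = proj_matrix (tangent_image A f p)"

end

theory Submission
  imports Defs
begin

text \<open>Fix \<open>\<theta>\<close>, let \<open>h\<close> be the member of the family \<open>F\<close> at the angle \<open>\<theta>\<close>, and
  write \<open>P\<close>, \<open>P'\<close> for the projections onto the tangent images \<open>E\<close>, \<open>E'\<close> of \<open>f\<close>, \<open>h\<close>, that is,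
  for the two Gauss maps. There are two bundle isometries: \<open>dh(v) \<mapsto> df(R v)\<close> from \<open>E'\<close> to \<open>E\<close>, where
  \<open>R\<close> is the rotation by \<open>\<theta>\<close>, and the given \<open>\<psi>\<close> between the normal bundles. The second is parallel by
  assumption. The first is parallel because \<open>J\<close> is, and because the differential of an isometric
  immersion turns the Levi-Civita derivative into the tangential part of the ambient derivative
  (\<open>christoffel_eq\<close>). Together they form orthogonal matrices \<open>Q\<close>, depending smoothly on the point,
  with \<open>P = Q P' Q\<^sup>T\<close>. The required bundle isomorphism is \<open>X \<mapsto> Q X Q\<^sup>T\<close>.

  It preserves curvature: conjugation by an orthogonal matrix is a linear isometry of the
  space of matrices which maps the Grassmannian to itself, and the curvature tensor is built from
  derivatives and orthogonal projections only (\<open>curvature_equivariant\<close>).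

  It intertwines the differentials (\<open>gauss_map_deriv_rotated\<close>): the derivative of the Gauss map of
  \<open>f\<close> along \<open>v\<close>, viewed as a homomorphism from \<open>E\<close> to the normal space, sends \<open>df(w)\<close> to \<open>\<alpha>(v,w)\<close>.
  After conjugation with \<open>Q\<close>, the derivative of \<open>P'\<close> along \<open>v\<close> sends \<open>df(R w) = Q dh(w)\<close> to
  \<open>\<psi>(\<alpha>\<^sub>h(v,w)) = \<alpha>(R v, R w)\<close>, which is what the derivative of \<open>P\<close> along \<open>R v\<close> does.

  It is parallel (\<open>conj_Q_deriv\<close>): parallelism of the two parts of \<open>Q\<close> says that the derivative of
  \<open>Q\<close> has no block from \<open>E'\<close> to \<open>E\<close> and none between the normal spaces. A tangent vector of the
  Grassmannian also has only the two mixed blocks, hence the terms in the derivative of \<open>Q \<xi> Q\<^sup>T\<close> in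
  which \<open>Q\<close> is differentiated have only the unmixed blocks, and such matrices are orthogonal to the
  Grassmannian.

  For all this the tangent spaces of the Grassmannian, defined by curves, are identified with the
  symmetric matrices with vanishing unmixed blocks (\<open>tangent_space_grassmannian\<close>).\<close>

section \<open>Smooth maps between Euclidean spaces\<close>

lemma Ck_on_cong:
  assumes "open S" "Ck_on k S f" "\<And>x. x \<in> S \<Longrightarrow> f x = h x"
  shows "Ck_on k S h"
  using assms(2,3)
proof (induction k arbitrary: f h)
  case 0
  then show ?case using continuous_on_cong[of S S f h] by simp
next
  case (Suc k)
  have diff: "h differentiable (at x)" if "x \<in> S" for x
    using Suc.prems that has_derivative_transform_within_open[OF _ assms(1) that]
    unfolding differentiable_def Ck_on.simps by metis
  have "Ck_on k S (\<lambda>x. frechet_derivative h (at x) v)" for v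
  proof (rule Suc.IH)
    show "Ck_on k S (\<lambda>x. frechet_derivative f (at x) v)"
      using Suc.prems by simp
    show "frechet_derivative f (at x) v = frechet_derivative h (at x) v" if "x \<in> S" for x
      using frechet_derivative_transform_within_open[OF _ assms(1) that, of f h] Suc.prems that
      by (metis Ck_on.simps(2))
  qed
  with diff show ?case by simp
qed

lemma Ck_on_subset: "Ck_on k T f \<Longrightarrow> S \<subseteq> T \<Longrightarrow> Ck_on k S f"
  by (induction k arbitrary: f) (auto intro: continuous_on_subset)

lemma Ck_on_pred: "Ck_on (Suc k) S f \<Longrightarrow> Ck_on k S f"
proof (induction k arbitrary: f)
  case 0
  then show ?case
    by (auto intro!: continuous_at_imp_continuous_on differentiable_imp_continuous_within)
next
  case (Suc k)
  then show ?case by simp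
qed

lemma smooth_on_cong:
  "open S \<Longrightarrow> smooth_on S f \<Longrightarrow> (\<And>x. x \<in> S \<Longrightarrow> f x = h x) \<Longrightarrow> smooth_on S h"
  unfolding smooth_on_def using Ck_on_cong by blast

lemma smooth_on_subset: "smooth_on T f \<Longrightarrow> S \<subseteq> T \<Longrightarrow> smooth_on S f"
  unfolding smooth_on_def using Ck_on_subset by blast

lemma smooth_on_differentiable: "smooth_on S f \<Longrightarrow> x \<in> S \<Longrightarrow> f differentiable (at x)"
  unfolding smooth_on_def by (metis Ck_on.simps(2))

lemma smooth_on_has_derivative:
  "smooth_on S f \<Longrightarrow> x \<in> S \<Longrightarrow> (f has_derivative frechet_derivative f (at x)) (at x)"
  using smooth_on_differentiable frechet_derivative_works by blast

lemma smooth_on_continuous: "smooth_on S f \<Longrightarrow> continuous_on S f"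
  unfolding smooth_on_def by (metis Ck_on.simps(1))

lemma smooth_on_derivative: "smooth_on S f \<Longrightarrow> smooth_on S (\<lambda>x. frechet_derivative f (at x) v)"
  unfolding smooth_on_def by (metis Ck_on.simps(2))

lemma Ck_on_const: "Ck_on k S (\<lambda>x. c)"
  by (induction k arbitrary: c) auto

lemma smooth_on_const: "smooth_on S (\<lambda>x. c)"
  unfolding smooth_on_def using Ck_on_const by blast

lemma Ck_on_ident: "Ck_on k S (\<lambda>x. x)"
  by (cases k) (auto simp: Ck_on_const)

lemma smooth_on_ident: "smooth_on S (\<lambda>x. x)"
  unfolding smooth_on_def using Ck_on_ident by blast

lemma Ck_on_add:
  assumes "open S" "Ck_on k S f" "Ck_on k S h"
  shows "Ck_on k S (\<lambda>x. f x + h x)"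
  using assms(2,3)
proof (induction k arbitrary: f h)
  case 0
  then show ?case by (auto intro: continuous_on_add)
next
  case (Suc k)
  have "Ck_on k S (\<lambda>x. frechet_derivative (\<lambda>x. f x + h x) (at x) v)" for v
  proof (rule Ck_on_cong[OF assms(1) Suc.IH])
    show "Ck_on k S (\<lambda>x. frechet_derivative f (at x) v)" "Ck_on k S (\<lambda>x. frechet_derivative h (at x) v)"
      using Suc.prems by auto
    fix x assume "x \<in> S"
    then have "((\<lambda>x. f x + h x) has_derivative
        (\<lambda>v. frechet_derivative f (at x) v + frechet_derivative h (at x) v)) (at x)"
      using Suc.prems by (intro has_derivative_add) (auto simp: frechet_derivative_works[symmetric])
    from frechet_derivative_at[OF this]
    show "frechet_derivative f (at x) v + frechet_derivative h (at x) v
        = frechet_derivative (\<lambda>x. f x + h x) (at x) v" by metis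
  qed
  then show ?case using Suc.prems by auto
qed

lemma smooth_on_add:
  "open S \<Longrightarrow> smooth_on S f \<Longrightarrow> smooth_on S h \<Longrightarrow> smooth_on S (\<lambda>x. f x + h x)"
  unfolding smooth_on_def using Ck_on_add by blast

lemma (in bounded_bilinear) Ck_on:
  assumes "open S" "Ck_on k S f" "Ck_on k S h"
  shows "Ck_on k S (\<lambda>x. prod (f x) (h x))"
  using assms(2,3)
proof (induction k arbitrary: f h)
  case 0
  then show ?case by (auto intro: continuous_on)
next
  case (Suc k)
  have "Ck_on k S (\<lambda>x. frechet_derivative (\<lambda>x. prod (f x) (h x)) (at x) v)" for v
  proof (rule Ck_on_cong[OF assms(1)])
    show "Ck_on k S (\<lambda>x. prod (f x) (frechet_derivative h (at x) v)
        + prod (frechet_derivative f (at x) v) (h x))"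
      using Suc.prems by (intro Ck_on_add Suc.IH assms(1) Suc.prems[THEN Ck_on_pred]) simp_all
    fix x assume "x \<in> S"
    then have "((\<lambda>x. prod (f x) (h x)) has_derivative
        (\<lambda>v. prod (f x) (frechet_derivative h (at x) v) + prod (frechet_derivative f (at x) v) (h x))) (at x)"
      using Suc.prems by (intro FDERIV) (auto simp: frechet_derivative_works[symmetric])
    from frechet_derivative_at[OF this]
    show "prod (f x) (frechet_derivative h (at x) v) + prod (frechet_derivative f (at x) v) (h x)
        = frechet_derivative (\<lambda>x. prod (f x) (h x)) (at x) v" by metis
  qed
  moreover have "(\<lambda>x. prod (f x) (h x)) differentiable (at x)" if "x \<in> S" for x
    using Suc.prems that FDERIV unfolding Ck_on.simps differentiable_def by metis
  ultimately show ?case by simp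
qed

lemma (in bounded_bilinear) smooth_on:
  "open S \<Longrightarrow> smooth_on S f \<Longrightarrow> smooth_on S h \<Longrightarrow> smooth_on S (\<lambda>x. prod (f x) (h x))"
  unfolding smooth_on_def using Ck_on by blast

lemmas smooth_on_scaleR = bounded_bilinear.smooth_on[OF bounded_bilinear_scaleR]
lemmas smooth_on_inner = bounded_bilinear.smooth_on[OF bounded_bilinear_inner]
lemmas smooth_on_mult = bounded_bilinear.smooth_on[OF bounded_bilinear_mult]

lemma smooth_on_uminus: "open S \<Longrightarrow> smooth_on S f \<Longrightarrow> smooth_on S (\<lambda>x. - f x)"
  using smooth_on_scaleR[OF _ smooth_on_const[of S "-1"], of f] by simp

lemma smooth_on_diff:
  "open S \<Longrightarrow> smooth_on S f \<Longrightarrow> smooth_on S h \<Longrightarrow> smooth_on S (\<lambda>x. f x - h x)"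
  using smooth_on_add[OF _ _ smooth_on_uminus, of S f h] by simp

lemma smooth_on_sum:
  "open S \<Longrightarrow> (\<And>i. i \<in> I \<Longrightarrow> smooth_on S (f i)) \<Longrightarrow> smooth_on S (\<lambda>x. \<Sum>i\<in>I. f i x)"
  by (induction I rule: infinite_finite_induct) (auto intro!: smooth_on_const smooth_on_add)

lemma Ck_on_inverse:
  fixes f :: "'a::euclidean_space \<Rightarrow> real"
  assumes "open S" "Ck_on k S f" "\<And>x. x \<in> S \<Longrightarrow> f x \<noteq> 0"
  shows "Ck_on k S (\<lambda>x. inverse (f x))"
  using assms(2)
proof (induction k)
  case 0
  then show ?case using assms(3) by (auto intro: continuous_on_inverse)
next
  case (Suc k)
  note mult = bounded_bilinear.Ck_on[OF bounded_bilinear_mult assms(1)]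
  have "Ck_on k S (\<lambda>x. frechet_derivative (\<lambda>x. inverse (f x)) (at x) v)" for v
  proof (rule Ck_on_cong[OF assms(1)])
    show "Ck_on k S (\<lambda>x. -1 * (inverse (f x) * frechet_derivative f (at x) v * inverse (f x)))"
      using Suc.prems Suc.IH[OF Ck_on_pred[OF Suc.prems]] by (intro mult Ck_on_const) simp_all
    fix x assume "x \<in> S"
    then have "((\<lambda>x. inverse (f x)) has_derivative
        (\<lambda>v. - (inverse (f x) * frechet_derivative f (at x) v * inverse (f x)))) (at x)"
      using Suc.prems assms(3)
      by (intro Deriv.has_derivative_inverse) (auto simp: frechet_derivative_works[symmetric])
    from frechet_derivative_at[OF this]
    show "-1 * (inverse (f x) * frechet_derivative f (at x) v * inverse (f x))
       = frechet_derivative (\<lambda>x. inverse (f x)) (at x) v"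
      by (metis mult_minus1)
  qed
  moreover have "(\<lambda>x. inverse (f x)) differentiable (at x)" if "x \<in> S" for x
    using Suc.prems assms(3) that by (intro differentiable_inverse) auto
  ultimately show ?case by simp
qed

lemma smooth_on_inverse:
  fixes f :: "'a::euclidean_space \<Rightarrow> real"
  shows "open S \<Longrightarrow> smooth_on S f \<Longrightarrow> (\<And>x. x \<in> S \<Longrightarrow> f x \<noteq> 0) \<Longrightarrow> smooth_on S (\<lambda>x. inverse (f x))"
  unfolding smooth_on_def using Ck_on_inverse by blast

lemma smooth_on_divide:
  fixes f h :: "'a::euclidean_space \<Rightarrow> real"
  shows "open S \<Longrightarrow> smooth_on S f \<Longrightarrow> smooth_on S h \<Longrightarrow> (\<And>x. x \<in> S \<Longrightarrow> h x \<noteq> 0)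
    \<Longrightarrow> smooth_on S (\<lambda>x. f x / h x)"
  unfolding divide_inverse by (intro smooth_on_mult smooth_on_inverse)

lemma smooth_on_componentwise:
  fixes f :: "'a::euclidean_space \<Rightarrow> 'b::euclidean_space"
  assumes "open S" "\<And>b. b \<in> Basis \<Longrightarrow> smooth_on S (\<lambda>x. f x \<bullet> b)"
  shows "smooth_on S f"
proof (rule smooth_on_cong[OF assms(1)])
  show "smooth_on S (\<lambda>x. \<Sum>b\<in>Basis. (f x \<bullet> b) *\<^sub>R b)"
    using assms by (intro smooth_on_sum smooth_on_scaleR smooth_on_const)
qed (simp add: euclidean_representation)

lemma linear_family_expand:
  fixes L :: "'v::euclidean_space \<Rightarrow> 'b::real_vector"
  assumes "linear L"
  shows "L w = (\<Sum>b\<in>Basis. (w \<bullet> b) *\<^sub>R L b)"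
proof -
  have "L w = L (\<Sum>b\<in>Basis. (w \<bullet> b) *\<^sub>R b)" by (simp add: euclidean_representation)
  also have "\<dots> = (\<Sum>b\<in>Basis. (w \<bullet> b) *\<^sub>R L b)"
    by (simp add: linear_sum[OF assms] linear_cmul[OF assms])
  finally show ?thesis .
qed

text \<open>Smoothness in the parameter may be tested on fixed vectors, since \<open>L x\<close> is determined
  linearly by its values on the standard basis.\<close>

lemma smooth_on_linear_family:
  fixes L :: "'a::euclidean_space \<Rightarrow> 'v::euclidean_space \<Rightarrow> 'b::real_normed_vector"
  assumes "open S" "\<And>x. x \<in> S \<Longrightarrow> linear (L x)"
    and "\<And>w. smooth_on S (\<lambda>x. L x w)" "smooth_on S W"
  shows "smooth_on S (\<lambda>x. L x (W x))"
proof (rule smooth_on_cong[OF assms(1)])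
  show "smooth_on S (\<lambda>x. \<Sum>b\<in>Basis. (W x \<bullet> b) *\<^sub>R L x b)"
    using assms by (intro smooth_on_sum smooth_on_scaleR smooth_on_inner smooth_on_const)
qed (simp add: linear_family_expand[OF assms(2), symmetric])

section \<open>Smooth orthogonal frames\<close>

text \<open>Gram-Schmidt orthogonalization with respect to an inner product \<open>G x\<close> that varies with
  \<open>x\<close>. The vectors are not normalized, so that the only operation beyond sums and products is
  division by the positive functions \<open>G x (c b x) (c b x)\<close>. Such frames give explicit formulas for
  orthogonal projections onto varying subspaces, hence their smoothness.\<close>

lemma smooth_orthogonal_frame:
  fixes G :: "'a::euclidean_space \<Rightarrow> 'v::euclidean_space \<Rightarrow> 'v \<Rightarrow> real" and B :: "'v set"
  assumes "open S" and bil: "\<And>x. x \<in> S \<Longrightarrow> bilinear (G x)"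
    and sym: "\<And>x v w. x \<in> S \<Longrightarrow> G x v w = G x w v"
    and pos: "\<And>x v. x \<in> S \<Longrightarrow> v \<noteq> 0 \<Longrightarrow> G x v v > 0"
    and smooth: "\<And>v w. smooth_on S (\<lambda>x. G x v w)"
    and "finite B" "independent B"
  shows "\<exists>c. (\<forall>b\<in>B. smooth_on S (c b)) \<and>
    (\<forall>x\<in>S. (\<forall>b\<in>B. c b x \<noteq> 0) \<and> (\<forall>b\<in>B. \<forall>b'\<in>B. b \<noteq> b' \<longrightarrow> G x (c b x) (c b' x) = 0) \<and>
       span ((\<lambda>b. c b x) ` B) = span B)"
  using assms(6,7)
proof (induction B)
  case empty
  show ?case by simp
next
  case (insert e B)
  then have ind: "independent B" "e \<notin> span B"
    by (auto simp: independent_insert)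
  obtain c where c: "\<And>b. b \<in> B \<Longrightarrow> smooth_on S (c b)" "\<And>b x. x \<in> S \<Longrightarrow> b \<in> B \<Longrightarrow> c b x \<noteq> 0"
      "\<And>b b' x. x \<in> S \<Longrightarrow> b \<in> B \<Longrightarrow> b' \<in> B \<Longrightarrow> b \<noteq> b' \<Longrightarrow> G x (c b x) (c b' x) = 0"
      "\<And>x. x \<in> S \<Longrightarrow> span ((\<lambda>b. c b x) ` B) = span B"
    using insert.IH[OF ind(1)] by blast
  \<comment> \<open>\<open>s\<close> is the \<open>G x\<close>-orthogonal projection of the new vector onto the span of the old ones.\<close>
  define s where "s x = (\<Sum>b\<in>B. (G x e (c b x) / G x (c b x) (c b x)) *\<^sub>R c b x)" for x
  define d where "d = c(e := \<lambda>x. e - s x)"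
  have G_smooth: "smooth_on S (\<lambda>x. G x (V x) (W x))" if "smooth_on S V" "smooth_on S W" for V W
  proof (rule smooth_on_linear_family[OF assms(1) _ _ that(2)])
    show "linear (G x (V x))" if "x \<in> S" for x using bil[OF that] by (simp add: bilinear_def)
    show "smooth_on S (\<lambda>x. G x (V x) w)" for w
      using bil by (intro smooth_on_linear_family[OF assms(1) _ _ that(1), of "\<lambda>x v. G x v w"] smooth)
        (simp add: bilinear_def)
  qed
  have s_span: "s x \<in> span B" if "x \<in> S" for x
    unfolding s_def by (subst c(4)[OF that, symmetric]) (intro span_sum span_scale span_base imageI)
  have s_smooth: "smooth_on S s"
    unfolding s_def using c(1,2) pos
    by (intro smooth_on_sum smooth_on_scaleR smooth_on_divide G_smooth smooth_on_const assms(1) c(1))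
       (auto simp: less_le)
  have d_B: "d b = c b" if "b \<in> B" for b
    using that insert.hyps(2) by (auto simp: d_def)
  have d_orth: "G x (d e x) (c b x) = 0" if "x \<in> S" "b \<in> B" for x b
  proof -
    interpret l: linear "\<lambda>v. G x v (c b x)" using bil[OF that(1)] by (simp add: bilinear_def)
    have "G x (s x) (c b x) = (\<Sum>b'\<in>B. (G x e (c b' x) / G x (c b' x) (c b' x)) * G x (c b' x) (c b x))"
      by (simp add: s_def l.sum l.scale)
    also have "\<dots> = (\<Sum>b'\<in>B. if b' = b then G x e (c b x) else 0)"
    proof (rule sum.cong)
      fix b' assume "b' \<in> B"
      then show "(G x e (c b' x) / G x (c b' x) (c b' x)) * G x (c b' x) (c b x)
        = (if b' = b then G x e (c b x) else 0)"
        using c(3)[OF that(1), of b' b] pos[OF that(1) c(2)[OF that]] that(2) by auto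
    qed simp
    also have "\<dots> = G x e (c b x)" using insert.hyps(1) that(2) by simp
    finally show ?thesis by (simp add: d_def l.diff)
  qed
  have "smooth_on S (d b)" if "b \<in> insert e B" for b
    using that s_smooth c(1) d_B by (auto simp: d_def intro!: smooth_on_diff smooth_on_const assms(1))
  moreover have "d b x \<noteq> 0" if "x \<in> S" "b \<in> insert e B" for x b
    using that(2) c(2)[OF that(1)] d_B s_span[OF that(1)] ind(2) by (auto simp: d_def)
  moreover have "G x (d b x) (d b' x) = 0"
    if "x \<in> S" "b \<in> insert e B" "b' \<in> insert e B" "b \<noteq> b'" for x b b'
    using that d_B d_orth[OF that(1)] c(3)[OF that(1)] sym[OF that(1)] by (metis insertE)
  moreover have "span ((\<lambda>b. d b x) ` insert e B) = span (insert e B)" if "x \<in> S" for x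
  proof -
    have "(\<lambda>b. d b x) ` B = (\<lambda>b. c b x) ` B" using d_B by auto
    then have "span ((\<lambda>b. d b x) ` insert e B) = span (insert (e - s x) ((\<lambda>b. c b x) ` B))"
      by (simp add: d_def)
    also have "\<dots> = span (insert (e - s x) B)"
      using c(4)[OF that] by (simp add: span_insert)
    also have "\<dots> = span (insert e B)"
    proof -
      have "e - s x \<in> span (insert e B)"
        using s_span[OF that] by (meson span_base span_diff span_mono insertI1 subset_insertI subsetD)
      moreover have "(e - s x) + s x \<in> span (insert (e - s x) B)"
        using s_span[OF that] by (meson span_base span_add span_mono insertI1 subset_insertI subsetD)
      ultimately show ?thesis
        by (intro subset_antisym span_minimal subspace_span) (auto intro: span_base)
    qed
    finally show ?thesis .
  qed
  ultimately show ?case by (intro exI[of _ d]) blast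
qed

section \<open>Symmetry of second derivatives\<close>

lemma DERIV_along_line:
  fixes h :: "'a::euclidean_space \<Rightarrow> real"
  assumes "h differentiable (at (b + s *\<^sub>R v))"
  shows "((\<lambda>s. h (b + s *\<^sub>R v)) has_real_derivative frechet_derivative h (at (b + s *\<^sub>R v)) v) (at s)"
proof -
  interpret D: linear "frechet_derivative h (at (b + s *\<^sub>R v))"
    using assms by (rule linear_frechet_derivative)
  have "((\<lambda>s. b + s *\<^sub>R v) has_derivative (\<lambda>s. s *\<^sub>R v)) (at s)"
    by (auto intro!: derivative_eq_intros)
  from diff_chain_at[OF this] assms
  have "(h \<circ> (\<lambda>s. b + s *\<^sub>R v) has_derivative
      frechet_derivative h (at (b + s *\<^sub>R v)) \<circ> (\<lambda>s. s *\<^sub>R v)) (at s)"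
    unfolding frechet_derivative_works by blast
  then show ?thesis
    by (simp add: has_field_derivative_def o_def D.scale mult.commute[of _ "frechet_derivative h _ _"])
qed

text \<open>The mean value theorem, used once in direction \<open>v\<close> and once in direction \<open>w\<close>. The left
  side is symmetric in \<open>v\<close> and \<open>w\<close> although the right side is not visibly so; this is what makes
  mixed second derivatives agree.\<close>

lemma second_difference_mean_value:
  fixes h :: "'a::euclidean_space \<Rightarrow> real"
  assumes "smooth_on S h" "0 < r"
    and in_S: "\<And>s t. 0 \<le> s \<Longrightarrow> s \<le> r \<Longrightarrow> 0 \<le> t \<Longrightarrow> t \<le> r \<Longrightarrow> a + s *\<^sub>R v + t *\<^sub>R w \<in> S"
  obtains s t where "0 \<le> s" "s \<le> r" "0 \<le> t" "t \<le> r"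
    "h (a + r *\<^sub>R v + r *\<^sub>R w) - h (a + r *\<^sub>R v) - h (a + r *\<^sub>R w) + h a
     = r * (r * frechet_derivative (\<lambda>x. frechet_derivative h (at x) v) (at (a + s *\<^sub>R v + t *\<^sub>R w)) w)"
proof -
  define D where "D x = frechet_derivative h (at x) v" for x
  have D_smooth: "smooth_on S D" unfolding D_def using assms(1) by (rule smooth_on_derivative)
  have "\<exists>s>0. s < r \<and> (h (a + r *\<^sub>R w + r *\<^sub>R v) - h (a + r *\<^sub>R v))
      - (h (a + r *\<^sub>R w + 0 *\<^sub>R v) - h (a + 0 *\<^sub>R v))
      = (r - 0) * (D (a + r *\<^sub>R w + s *\<^sub>R v) - D (a + s *\<^sub>R v))"
  proof (rule MVT2[OF assms(2)])
    fix s assume s: "0 \<le> s" "s \<le> r"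
    have "a + r *\<^sub>R w + s *\<^sub>R v \<in> S" "a + s *\<^sub>R v \<in> S"
      using in_S[of s r] in_S[of s 0] s assms(2) by (simp_all add: add_ac)
    then show "((\<lambda>s. h (a + r *\<^sub>R w + s *\<^sub>R v) - h (a + s *\<^sub>R v)) has_real_derivative
        D (a + r *\<^sub>R w + s *\<^sub>R v) - D (a + s *\<^sub>R v)) (at s)"
      unfolding D_def by (intro DERIV_diff DERIV_along_line smooth_on_differentiable[OF assms(1)])
  qed
  then obtain s where s: "0 < s" "s < r"
    "h (a + r *\<^sub>R v + r *\<^sub>R w) - h (a + r *\<^sub>R v) - h (a + r *\<^sub>R w) + h a
     = r * (D (a + s *\<^sub>R v + r *\<^sub>R w) - D (a + s *\<^sub>R v + 0 *\<^sub>R w))"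
    by (auto simp: add_ac algebra_simps)
  have "\<exists>t>0. t < r \<and> D (a + s *\<^sub>R v + r *\<^sub>R w) - D (a + s *\<^sub>R v + 0 *\<^sub>R w)
      = (r - 0) * frechet_derivative D (at (a + s *\<^sub>R v + t *\<^sub>R w)) w"
    using s in_S by (intro MVT2[OF assms(2)] DERIV_along_line smooth_on_differentiable[OF D_smooth]) auto
  then obtain t where "0 < t" "t < r" "D (a + s *\<^sub>R v + r *\<^sub>R w) - D (a + s *\<^sub>R v + 0 *\<^sub>R w)
      = r * frechet_derivative D (at (a + s *\<^sub>R v + t *\<^sub>R w)) w" by auto
  with s show ?thesis using that[of s t] unfolding D_def by simp
qed

text \<open>If the two mixed derivatives differed at \<open>a\<close>, continuity would separate all their
  values near \<open>a\<close>; but a small second difference is a multiple of a value of each of them.\<close>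

lemma symmetric_second_derivative_real:
  fixes h :: "'a::euclidean_space \<Rightarrow> real"
  assumes "open S" "smooth_on S h" "a \<in> S"
  shows "frechet_derivative (\<lambda>x. frechet_derivative h (at x) w) (at a) v
       = frechet_derivative (\<lambda>x. frechet_derivative h (at x) v) (at a) w"
    (is "?\<beta> a = ?\<alpha> a")
proof (rule ccontr)
  assume neq: "?\<beta> a \<noteq> ?\<alpha> a"
  define \<epsilon> where "\<epsilon> = dist (?\<alpha> a) (?\<beta> a) / 2"
  have "\<epsilon> > 0" using neq by (simp add: \<epsilon>_def)
  have "continuous_on S ?\<alpha>" "continuous_on S ?\<beta>"
    by (intro smooth_on_continuous smooth_on_derivative assms(2))+
  then have "isCont ?\<alpha> a" "isCont ?\<beta> a"
    using assms(1,3) continuous_on_eq_continuous_at by blast+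
  then have "\<exists>d>0. \<forall>x. dist x a < d \<longrightarrow> dist (?\<alpha> x) (?\<alpha> a) < \<epsilon>"
      "\<exists>d>0. \<forall>x. dist x a < d \<longrightarrow> dist (?\<beta> x) (?\<beta> a) < \<epsilon>"
    using \<open>\<epsilon> > 0\<close> unfolding continuous_at_eps_delta by blast+
  then obtain d1 d2 where d: "d1 > 0" "d2 > 0" "\<And>x. dist x a < d1 \<Longrightarrow> dist (?\<alpha> x) (?\<alpha> a) < \<epsilon>"
      "\<And>x. dist x a < d2 \<Longrightarrow> dist (?\<beta> x) (?\<beta> a) < \<epsilon>"
    by blast
  obtain d3 where d3: "d3 > 0" "\<And>x. dist x a < d3 \<Longrightarrow> x \<in> S"
    using assms(1,3) unfolding open_dist by blast
  define d where "d = min d1 (min d2 d3)"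
  define K where "K = norm v + norm w + 1"
  define r where "r = d / (2 * K)"
  have "d > 0" "K > 0" using d(1,2) d3(1) by (simp_all add: d_def K_def add_nonneg_pos)
  then have r: "r > 0" "r * K < d" by (auto simp: r_def field_simps)
  have near: "dist (a + s *\<^sub>R v + t *\<^sub>R w) a < d" if "0 \<le> s" "s \<le> r" "0 \<le> t" "t \<le> r" for s t
  proof -
    have "dist (a + s *\<^sub>R v + t *\<^sub>R w) a \<le> s * norm v + t * norm w"
      using norm_triangle_ineq[of "s *\<^sub>R v" "t *\<^sub>R w"] that by (simp add: dist_norm add.assoc)
    also have "\<dots> \<le> r * norm v + r * norm w"
      using that by (intro add_mono mult_right_mono) auto
    also have "\<dots> \<le> r * K" using r by (simp add: K_def algebra_simps)
    finally show ?thesis using r by simp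
  qed
  have in_S: "a + s *\<^sub>R v + t *\<^sub>R w \<in> S" "a + t *\<^sub>R w + s *\<^sub>R v \<in> S"
    if "0 \<le> s" "s \<le> r" "0 \<le> t" "t \<le> r" for s t
    using near[OF that] d3 by (auto simp: d_def add_ac)
  obtain s t where st: "0 \<le> s" "s \<le> r" "0 \<le> t" "t \<le> r"
    "h (a + r *\<^sub>R v + r *\<^sub>R w) - h (a + r *\<^sub>R v) - h (a + r *\<^sub>R w) + h a = r * (r * ?\<alpha> (a + s *\<^sub>R v + t *\<^sub>R w))"
    by (rule second_difference_mean_value[of S h r a v w, OF assms(2) r(1) in_S(1)])
  obtain t' s' where st': "0 \<le> t'" "t' \<le> r" "0 \<le> s'" "s' \<le> r"
    "h (a + r *\<^sub>R w + r *\<^sub>R v) - h (a + r *\<^sub>R w) - h (a + r *\<^sub>R v) + h a = r * (r * ?\<beta> (a + t' *\<^sub>R w + s' *\<^sub>R v))"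
    by (rule second_difference_mean_value[of S h r a w v, OF assms(2) r(1) in_S(2)])
  have "r * (r * ?\<alpha> (a + s *\<^sub>R v + t *\<^sub>R w)) = r * (r * ?\<beta> (a + t' *\<^sub>R w + s' *\<^sub>R v))"
    unfolding st(5)[symmetric] st'(5)[symmetric] by (simp add: add_ac)
  then have "?\<alpha> (a + s *\<^sub>R v + t *\<^sub>R w) = ?\<beta> (a + t' *\<^sub>R w + s' *\<^sub>R v)" using r by simp
  moreover have "dist (?\<alpha> (a + s *\<^sub>R v + t *\<^sub>R w)) (?\<alpha> a) < \<epsilon>"
    using near[OF st(1-4)] by (intro d(3)) (simp add: d_def)
  moreover have "dist (?\<beta> (a + t' *\<^sub>R w + s' *\<^sub>R v)) (?\<beta> a) < \<epsilon>"
    using near[OF st'(3,4,1,2)] by (intro d(4)) (simp add: d_def add_ac)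
  ultimately show False
    unfolding \<epsilon>_def by (metis dist_triangle_half_r less_irrefl)
qed

lemma symmetric_second_derivative:
  fixes h :: "'a::euclidean_space \<Rightarrow> 'b::euclidean_space"
  assumes "open S" "smooth_on S h" "a \<in> S"
  shows "frechet_derivative (\<lambda>x. frechet_derivative h (at x) w) (at a) v
       = frechet_derivative (\<lambda>x. frechet_derivative h (at x) v) (at a) w"
proof (rule euclidean_eqI)
  fix b :: 'b assume "b \<in> Basis"
  have inner: "frechet_derivative (\<lambda>x. F x \<bullet> b) (at x) u = frechet_derivative F (at x) u \<bullet> b"
    if "smooth_on S F" "x \<in> S" for F :: "'a \<Rightarrow> 'b" and x u
    using frechet_derivative_at[OF has_derivative_inner_left[OF smooth_on_has_derivative[OF that]]]
    by metis
  have second: "frechet_derivative (\<lambda>x. frechet_derivative (\<lambda>x. h x \<bullet> b) (at x) u) (at a) u'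
     = frechet_derivative (\<lambda>x. frechet_derivative h (at x) u) (at a) u' \<bullet> b" for u u'
  proof -
    have "frechet_derivative (\<lambda>x. frechet_derivative h (at x) u \<bullet> b) (at a)
      = frechet_derivative (\<lambda>x. frechet_derivative (\<lambda>x. h x \<bullet> b) (at x) u) (at a)"
      using smooth_on_inner[OF assms(1) smooth_on_derivative[OF assms(2)] smooth_on_const, of u b]
      by (intro frechet_derivative_transform_within_open[OF _ assms(1,3)])
        (auto simp: inner[OF assms(2)] intro: smooth_on_differentiable assms(3))
    then show ?thesis using inner[OF smooth_on_derivative[OF assms(2)] assms(3)] by metis
  qed
  show "frechet_derivative (\<lambda>x. frechet_derivative h (at x) w) (at a) v \<bullet> b
      = frechet_derivative (\<lambda>x. frechet_derivative h (at x) v) (at a) w \<bullet> b"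
    unfolding second[symmetric]
    by (intro symmetric_second_derivative_real[OF assms(1) _ assms(3)]
        smooth_on_inner assms smooth_on_const)
qed

section \<open>Orthogonal projections\<close>

lemma orth_proj_unique:
  assumes "subspace V" "y \<in> V" "\<And>z. z \<in> V \<Longrightarrow> (x - y) \<bullet> z = 0"
  shows "orth_proj V x = y"
  unfolding orth_proj_def
proof (rule the_equality)
  show "y \<in> V \<and> (\<forall>z\<in>V. (x - y) \<bullet> z = 0)" using assms by blast
  fix y' assume y': "y' \<in> V \<and> (\<forall>z\<in>V. (x - y') \<bullet> z = 0)"
  then have "y' - y \<in> V" using assms by (simp add: subspace_diff)
  then have "(x - y) \<bullet> (y' - y) - (x - y') \<bullet> (y' - y) = 0" using assms y' by simp
  then have "(y' - y) \<bullet> (y' - y) = 0" by (simp add: inner_diff_left)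
  then show "y' = y" by simp
qed

lemma orth_proj_in: "subspace V \<Longrightarrow> orth_proj V x \<in> V"
  and orth_proj_residual: "subspace V \<Longrightarrow> z \<in> V \<Longrightarrow> (x - orth_proj V x) \<bullet> z = 0"
proof -
  have *: "orth_proj V x \<in> V \<and> (\<forall>z\<in>V. (x - orth_proj V x) \<bullet> z = 0)" if V: "subspace V"
  proof -
    obtain y z where "y \<in> span V" "\<And>w. w \<in> span V \<Longrightarrow> orthogonal z w" "x = y + z"
      by (rule orthogonal_subspace_decomp_exists[of V x]) blast
    moreover have "span V = V" using V by (simp add: span_eq_iff)
    ultimately have "y \<in> V" "\<And>w. w \<in> V \<Longrightarrow> (x - y) \<bullet> w = 0"
      by (auto simp: orthogonal_def)
    moreover from this have "orth_proj V x = y" by (rule orth_proj_unique[OF V])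
    ultimately show ?thesis by simp
  qed
  show "subspace V \<Longrightarrow> orth_proj V x \<in> V"
    and "subspace V \<Longrightarrow> z \<in> V \<Longrightarrow> (x - orth_proj V x) \<bullet> z = 0"
    using * by blast+
qed

lemma orth_proj_eq_self: "subspace V \<Longrightarrow> x \<in> V \<Longrightarrow> orth_proj V x = x"
  by (rule orth_proj_unique) auto

lemma linear_orth_proj: assumes "subspace V" shows "linear (orth_proj V)"
proof (rule linearI)
  note res = orth_proj_residual[OF assms] and mem = orth_proj_in[OF assms]
  show "orth_proj V (x + y) = orth_proj V x + orth_proj V y" for x y
  proof (rule orth_proj_unique[OF assms subspace_add[OF assms mem mem]])
    show "(x + y - (orth_proj V x + orth_proj V y)) \<bullet> z = 0" if "z \<in> V" for z
      using res[OF that, of x] res[OF that, of y] by (simp add: inner_diff_left inner_add_left)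
  qed
  show "orth_proj V (r *\<^sub>R x) = r *\<^sub>R orth_proj V x" for r x
  proof (rule orth_proj_unique[OF assms subspace_scale[OF assms mem]])
    show "(r *\<^sub>R x - r *\<^sub>R orth_proj V x) \<bullet> z = 0" if "z \<in> V" for z
      using res[OF that, of x] by (simp add: inner_diff_left)
  qed
qed

lemma orth_proj_self_adjoint:
  assumes "subspace V" shows "orth_proj V x \<bullet> y = x \<bullet> orth_proj V y"
proof -
  have "(x - orth_proj V x) \<bullet> orth_proj V y = 0" "orth_proj V x \<bullet> (y - orth_proj V y) = 0"
    using orth_proj_residual[OF assms orth_proj_in[OF assms]] by (simp_all add: inner_commute)
  then show ?thesis by (simp add: inner_diff_left inner_diff_right)
qed

lemma orth_proj_orthogonal_comp:
  assumes "subspace V" shows "orth_proj (orthogonal_comp V) x = x - orth_proj V x"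
proof (rule orth_proj_unique[OF subspace_orthogonal_comp])
  show "x - orth_proj V x \<in> orthogonal_comp V"
    using orth_proj_residual[OF assms] by (simp add: orthogonal_comp_def orthogonal_def inner_commute)
  show "(x - (x - orth_proj V x)) \<bullet> z = 0" if "z \<in> orthogonal_comp V" for z
    using that orth_proj_in[OF assms] by (simp add: orthogonal_comp_def orthogonal_def)
qed

lemma orth_proj_span_orthogonal:
  assumes "finite B" and orth: "\<And>b b'. b \<in> B \<Longrightarrow> b' \<in> B \<Longrightarrow> b \<noteq> b' \<Longrightarrow> u b \<bullet> u b' = 0"
  shows "orth_proj (span (u ` B)) e = (\<Sum>b\<in>B. ((u b \<bullet> e) / (u b \<bullet> u b)) *\<^sub>R u b)" (is "_ = ?s")
proof (rule orth_proj_unique[OF subspace_span])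
  show "?s \<in> span (u ` B)" by (intro span_sum span_scale span_base imageI)
  have "(e - ?s) \<bullet> u b = 0" if b: "b \<in> B" for b
  proof -
    have "?s \<bullet> u b = (\<Sum>b'\<in>B. if b' = b then u b \<bullet> e else 0)"
      unfolding inner_sum_left
    proof (rule sum.cong)
      fix b' assume "b' \<in> B"
      then show "((u b' \<bullet> e) / (u b' \<bullet> u b')) *\<^sub>R u b' \<bullet> u b = (if b' = b then u b \<bullet> e else 0)"
        using orth[of b' b] b by auto
    qed simp
    also have "\<dots> = u b \<bullet> e" using assms(1) b by simp
    finally show ?thesis by (simp only: inner_diff_left inner_commute[of e] diff_self)
  qed
  then have "span (u ` B) \<subseteq> {z. (e - ?s) \<bullet> z = 0}"
    by (intro span_minimal subspace_hyperplane) auto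
  then show "(e - ?s) \<bullet> z = 0" if "z \<in> span (u ` B)" for z using that by blast
qed

section \<open>Matrices and orthogonal conjugation\<close>

lemma bounded_bilinear_matrix_mult:
  "bounded_bilinear ((**) :: real^'n^'m \<Rightarrow> real^'p^'n \<Rightarrow> real^'p^'m)"
  unfolding bilinear_conv_bounded_bilinear[symmetric] bilinear_def
  by (auto intro!: linearI simp: matrix_matrix_mult_def vec_eq_iff sum.distrib sum_distrib_left algebra_simps)

lemmas matrix_mult_distribs =
  bounded_bilinear.add_left[OF bounded_bilinear_matrix_mult]
  bounded_bilinear.add_right[OF bounded_bilinear_matrix_mult]
  bounded_bilinear.diff_left[OF bounded_bilinear_matrix_mult]
  bounded_bilinear.diff_right[OF bounded_bilinear_matrix_mult]
  bounded_bilinear.scaleR_left[OF bounded_bilinear_matrix_mult]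
  bounded_bilinear.scaleR_right[OF bounded_bilinear_matrix_mult]

lemma bounded_bilinear_matrix_vector_mult:
  "bounded_bilinear ((*v) :: real^'n^'m \<Rightarrow> real^'n \<Rightarrow> real^'m)"
  unfolding bilinear_conv_bounded_bilinear[symmetric] bilinear_def
  by (auto intro!: linearI simp: matrix_vector_mult_def vec_eq_iff sum.distrib sum_distrib_left algebra_simps)

lemma bounded_linear_transpose: "bounded_linear (transpose :: real^'n^'m \<Rightarrow> real^'m^'n)"
  unfolding linear_conv_bounded_linear[symmetric]
  by (auto intro!: linearI simp: transpose_def vec_eq_iff)

lemmas transpose_add = linear_add[OF bounded_linear.linear[OF bounded_linear_transpose]]
lemmas transpose_diff = linear_diff[OF bounded_linear.linear[OF bounded_linear_transpose]]

lemma inner_matrix_mult_left: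
  fixes A :: "real^'n^'m" shows "(A ** B) \<bullet> C = B \<bullet> (transpose A ** C)"
proof -
  have "(A ** B) \<bullet> C = (\<Sum>i\<in>UNIV. \<Sum>j\<in>UNIV. \<Sum>k\<in>UNIV. A$i$k * B$k$j * C$i$j)"
    by (simp add: inner_vec_def matrix_matrix_mult_def sum_distrib_right)
  also have "\<dots> = (\<Sum>i\<in>UNIV. \<Sum>k\<in>UNIV. \<Sum>j\<in>UNIV. A$i$k * B$k$j * C$i$j)"
    by (intro sum.cong sum.swap refl)
  also have "\<dots> = (\<Sum>k\<in>UNIV. \<Sum>i\<in>UNIV. \<Sum>j\<in>UNIV. A$i$k * B$k$j * C$i$j)"
    by (rule sum.swap)
  also have "\<dots> = (\<Sum>k\<in>UNIV. \<Sum>j\<in>UNIV. \<Sum>i\<in>UNIV. A$i$k * B$k$j * C$i$j)"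
    by (intro sum.cong sum.swap refl)
  also have "\<dots> = B \<bullet> (transpose A ** C)"
    by (simp add: inner_vec_def matrix_matrix_mult_def transpose_def sum_distrib_left mult_ac)
  finally show ?thesis .
qed

lemma inner_transpose: "transpose A \<bullet> transpose B = A \<bullet> (B :: real^'n^'m)"
  unfolding inner_vec_def transpose_def by simp (rule sum.swap)

lemma inner_matrix_mult_right:
  fixes A :: "real^'n^'m" shows "(A ** B) \<bullet> C = A \<bullet> (C ** transpose B)"
proof -
  have "(A ** B) \<bullet> C = (transpose B ** transpose A) \<bullet> transpose C"
    by (simp only: inner_transpose[of "A ** B", symmetric] matrix_transpose_mul)
  also have "\<dots> = transpose A \<bullet> transpose (C ** transpose B)"
    by (simp only: inner_matrix_mult_left matrix_transpose_mul transpose_transpose)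
  finally show ?thesis by (simp only: inner_transpose)
qed

lemma matrix_eqI_vector: "(\<And>x. A *v x = B *v x) \<Longrightarrow> A = (B :: real^'n^'m)"
  by (simp add: matrix_eq)

lemma proj_matrix_mult: "subspace E \<Longrightarrow> proj_matrix E *v x = orth_proj E x"
  unfolding proj_matrix_def by (rule matrix_works) (simp add: linear_orth_proj linear_def[symmetric] scalar_mult_eq_scaleR)

lemma proj_matrix_idem: "subspace E \<Longrightarrow> proj_matrix E ** proj_matrix E = proj_matrix E"
  by (rule matrix_eqI_vector)
    (simp add: matrix_vector_mul_assoc[symmetric] proj_matrix_mult orth_proj_eq_self orth_proj_in)

lemma symmetric_matrixI:
  assumes "\<And>x y. (A *v x) \<bullet> y = x \<bullet> (A *v y)" shows "transpose A = (A :: real^'n^'n)"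
proof (rule matrix_eqI_vector)
  fix x
  have "(transpose A *v x) \<bullet> y = (A *v x) \<bullet> y" for y
    using assms[of x y] by (simp add: dot_lmul_matrix)
  then show "transpose A *v x = A *v x" by (metis vector_eq_rdot)
qed

lemma symmetric_matrixD: "transpose A = A \<Longrightarrow> (A *v x) \<bullet> y = x \<bullet> (A *v y)" for A :: "real^'n^'n"
  by (metis dot_lmul_matrix transpose_matrix_vector)

lemma proj_matrix_transpose: "subspace E \<Longrightarrow> transpose (proj_matrix E) = proj_matrix E"
  by (rule symmetric_matrixI) (simp add: proj_matrix_mult orth_proj_self_adjoint)

lemma grassmannian_transpose: "P \<in> grassmannian k \<Longrightarrow> transpose P = P"
  and grassmannian_idem: "P \<in> grassmannian k \<Longrightarrow> P ** P = P"
  by (auto simp: grassmannian_def proj_matrix_transpose proj_matrix_idem)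

definition conj_mat :: "real^'n^'n \<Rightarrow> real^'n^'n \<Rightarrow> real^'n^'n" where
  "conj_mat U X = U ** X ** transpose U"

lemma bounded_linear_conj_mat: "bounded_linear (conj_mat U)"
  unfolding conj_mat_def[abs_def]
  by (intro bounded_linear_compose[OF bounded_bilinear.bounded_linear_left[OF bounded_bilinear_matrix_mult]]
      bounded_bilinear.bounded_linear_right[OF bounded_bilinear_matrix_mult])

lemma conj_mat_transpose: "transpose (conj_mat U X) = conj_mat U (transpose X)"
  by (simp add: conj_mat_def matrix_transpose_mul matrix_mul_assoc)

lemma conj_mat_mult:
  assumes "transpose U ** U = mat 1"
  shows "conj_mat U X ** conj_mat U Y = conj_mat U (X ** Y)"
proof -
  have "conj_mat U X ** conj_mat U Y = U ** X ** (transpose U ** U) ** Y ** transpose U"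
    by (simp only: conj_mat_def matrix_mul_assoc)
  then show ?thesis by (simp add: assms conj_mat_def matrix_mul_assoc)
qed

lemma conj_mat_inverse:
  assumes "transpose U ** U = mat 1" shows "conj_mat (transpose U) (conj_mat U X) = X"
proof -
  have "conj_mat (transpose U) (conj_mat U X) = (transpose U ** U) ** X ** (transpose U ** U)"
    by (simp only: conj_mat_def matrix_mul_assoc transpose_transpose)
  then show ?thesis by (simp add: assms)
qed

lemma conj_mat_inner:
  assumes "transpose U ** U = mat 1" shows "conj_mat U X \<bullet> conj_mat U Y = X \<bullet> Y"
proof -
  have "conj_mat U X \<bullet> conj_mat U Y = X \<bullet> conj_mat (transpose U) (conj_mat U Y)"
    unfolding conj_mat_def inner_matrix_mult_right[of "U ** X"] inner_matrix_mult_left[of U]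
    by (simp only: transpose_transpose matrix_mul_assoc)
  then show ?thesis by (simp add: conj_mat_inverse assms)
qed

text \<open>Conjugating the projection onto \<open>E\<close> by an orthogonal matrix \<open>U\<close> gives the projection
  onto \<open>U E\<close>.\<close>

lemma grassmannian_conj_mat:
  assumes U: "transpose U ** U = mat 1" and "P \<in> grassmannian k"
  shows "conj_mat U P \<in> grassmannian k"
proof -
  obtain E where E: "subspace E" "dim E = k" "P = proj_matrix E"
    using assms(2) by (auto simp: grassmannian_def)
  have UU: "transpose U *v (U *v x) = x" for x
    by (simp only: matrix_vector_mul_assoc U matrix_vector_mul_lid)
  have UE: "subspace ((*v) U ` E)" by (simp add: linear_subspace_image E(1))
  have "inj_on ((*v) U) (span E)" by (rule inj_on_inverseI[of _ "(*v) (transpose U)"]) (rule UU)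
  then have "dim ((*v) U ` E) = k" using E(2) by (simp add: dim_image_eq del: transpose_matrix_vector)
  moreover have "proj_matrix ((*v) U ` E) = conj_mat U P"
  proof (rule matrix_eqI_vector)
    fix y
    have "orth_proj ((*v) U ` E) y = U *v orth_proj E (transpose U *v y)"
    proof (rule orth_proj_unique[OF UE])
      show "U *v orth_proj E (transpose U *v y) \<in> (*v) U ` E" using orth_proj_in[OF E(1)] by blast
      fix z assume "z \<in> (*v) U ` E"
      then obtain e where e: "e \<in> E" "z = U *v e" by blast
      have "(y - U *v w) \<bullet> (U *v e) = (transpose U *v y - w) \<bullet> e" for w
        by (metis UU dot_lmul_matrix matrix_vector_mult_diff_distrib transpose_matrix_vector)
      then show "(y - U *v orth_proj E (transpose U *v y)) \<bullet> z = 0"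
        using orth_proj_residual[OF E(1) e(1)] e(2) by metis
    qed
    then show "proj_matrix ((*v) U ` E) *v y = conj_mat U P *v y"
      unfolding conj_mat_def E(3) by (simp only: matrix_vector_mul_assoc[symmetric] proj_matrix_mult[OF UE] proj_matrix_mult[OF E(1)])
  qed
  ultimately show ?thesis using UE unfolding grassmannian_def by (metis (mono_tags, lifting) mem_Collect_eq)
qed

lemma smooth_on_matrix:
  fixes F :: "'a::euclidean_space \<Rightarrow> real^'n^'m"
  assumes "open S" "\<And>e. smooth_on S (\<lambda>x. F x *v e)"
  shows "smooth_on S F"
proof (rule smooth_on_componentwise[OF assms(1)])
  fix b :: "real^'n^'m" assume "b \<in> Basis"
  then obtain i j where b: "b = axis i (axis j 1)" by (auto simp: Basis_vec_def)
  have "F x \<bullet> b = (F x *v axis j 1) \<bullet> axis i 1" for x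
    by (simp add: b inner_axis matrix_vector_mul_component)
  then show "smooth_on S (\<lambda>x. F x \<bullet> b)"
    using smooth_on_inner[OF assms(1) assms(2) smooth_on_const] by simp
qed

lemma smooth_on_transpose:
  fixes F :: "'a::euclidean_space \<Rightarrow> real^'n^'m"
  assumes "open S" "smooth_on S F" shows "smooth_on S (\<lambda>x. transpose (F x))"
proof (rule smooth_on_componentwise[OF assms(1)])
  fix b :: "real^'m^'n"
  have "transpose (F x) \<bullet> b = F x \<bullet> transpose b" for x
    using inner_transpose[of "F x" "transpose b"] by simp
  then show "smooth_on S (\<lambda>x. transpose (F x) \<bullet> b)"
    using smooth_on_inner[OF assms smooth_on_const] by simp
qed

section \<open>Tangent spaces of the Grassmannian\<close>

text \<open>In blocks with respect to the image and the kernel of a projection \<open>P\<close>, the equation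
  \<open>P X + X P = X\<close> says that both unmixed blocks of \<open>X\<close> vanish.\<close>

definition grassmannian_tangent :: "real^'n^'n \<Rightarrow> (real^'n^'n) set" where
  "grassmannian_tangent P = {X. transpose X = X \<and> P ** X + X ** P = X}"

text \<open>Differentiate the equations for a symmetric projection along a curve.\<close>

lemma tangent_space_grassmannian_subset:
  assumes "X \<in> tangent_space (grassmannian k) P" shows "X \<in> grassmannian_tangent P"
proof -
  obtain \<gamma> where \<gamma>: "\<And>t::real. \<gamma> t \<in> grassmannian k" "\<gamma> 0 = P" "(\<gamma> has_vector_derivative X) (at 0)"
    using assms unfolding tangent_space_def by blast
  have "((\<lambda>t. transpose (\<gamma> t)) has_vector_derivative transpose X) (at 0)"
    by (rule bounded_linear.has_vector_derivative[OF bounded_linear_transpose \<gamma>(3)])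
  then have "(\<gamma> has_vector_derivative transpose X) (at 0)"
    by (simp add: grassmannian_transpose[OF \<gamma>(1)])
  then have "transpose X = X" using \<gamma>(3) vector_derivative_unique_at by blast
  moreover
  have "((\<lambda>t. \<gamma> t ** \<gamma> t) has_vector_derivative (\<gamma> 0 ** X + X ** \<gamma> 0)) (at 0)"
    by (rule bounded_bilinear.has_vector_derivative[OF bounded_bilinear_matrix_mult \<gamma>(3) \<gamma>(3)])
  then have "(\<gamma> has_vector_derivative (P ** X + X ** P)) (at 0)"
    by (simp add: grassmannian_idem[OF \<gamma>(1)] \<gamma>(2))
  then have "P ** X + X ** P = X" using \<gamma>(3) vector_derivative_unique_at by blast
  ultimately show ?thesis by (simp add: grassmannian_tangent_def)
qed

lemma grassmannian_tangent_offdiag: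
  assumes "X \<in> grassmannian_tangent P" "P ** P = P"
  shows "P ** X ** P = 0"
proof -
  have "P ** (P ** X + X ** P) ** P = P ** X ** P"
    using assms by (simp add: grassmannian_tangent_def)
  moreover have "P ** (P ** X + X ** P) ** P = (P ** P) ** X ** P + P ** X ** (P ** P)"
    by (simp only: matrix_mult_distribs matrix_mul_assoc)
  ultimately show ?thesis using assms(2) by simp
qed

text \<open>Since \<open>P X\<close> is the transpose of \<open>X P\<close>, a tangent vector is determined by its
  restriction to the image of \<open>P\<close>, which is how it becomes an element of \<open>Hom(E, E\<^sup>\<bottom>)\<close>.\<close>

lemma grassmannian_tangent_eqI:
  assumes "X \<in> grassmannian_tangent P" "Y \<in> grassmannian_tangent P" "transpose P = P" "X ** P = Y ** P"
  shows "X = Y"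
proof -
  have "P ** Z = transpose (Z ** P)" if "Z \<in> grassmannian_tangent P" for Z
    using that assms(3) by (simp add: matrix_transpose_mul grassmannian_tangent_def)
  then have "P ** X + X ** P = P ** Y + Y ** P" using assms by simp
  then show ?thesis using assms(1,2) by (simp add: grassmannian_tangent_def)
qed

text \<open>A curve with velocity \<open>X\<close> through the projection onto \<open>E\<close>: let \<open>\<gamma> t\<close> be the projection
  onto the graph \<open>E\<^sub>t = {v + t X v | v \<in> E}\<close>. It is smooth by the formula for a projection in terms of
  a smooth orthogonal frame. Its velocity is not computed from that formula: differentiating
  \<open>\<gamma> t (v + t X v) = v + t X v\<close> shows that it agrees with \<open>X\<close> on \<open>E\<close>, which suffices.\<close>

lemma tangent_space_grassmannian_superset:
  fixes P X :: "real^'n^'n"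
  assumes P: "P \<in> grassmannian k" and X: "X \<in> grassmannian_tangent P"
  shows "X \<in> tangent_space (grassmannian k) P"
proof -
  obtain E where E: "subspace E" "dim E = k" "P = proj_matrix E"
    using P by (auto simp: grassmannian_def)
  have P_E: "P *v v = v" if "v \<in> E" for v
    using that by (simp add: E proj_matrix_mult orth_proj_eq_self)
  have PXv: "P *v (X *v v) = 0" if "v \<in> E" for v
  proof -
    have "P *v (X *v v) = (P ** X ** P) *v v" by (simp add: matrix_vector_mul_assoc[symmetric] P_E that)
    then show ?thesis using grassmannian_tangent_offdiag[OF X] grassmannian_idem[OF P] by simp
  qed
  have orth_X: "v \<bullet> (X *v w) = 0" if "v \<in> E" "w \<in> E" for v w
    by (metis P_E PXv that symmetric_matrixD[OF grassmannian_transpose[OF P]] inner_zero_right)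
  obtain B where B: "independent B" "span B = E" "finite B"
    using basis_exists[of E] E(1) by (metis independent_imp_finite span_minimal span_mono span_eq_iff subset_antisym)
  \<comment> \<open>The inner product that \<open>v \<mapsto> v + t X v\<close> induces on \<open>E\<close>. The mixed terms vanish there, as \<open>X\<close> maps \<open>E\<close> to its complement, and dropping them makes \<open>G t\<close> positive definite on the whole space.\<close>
  define G :: "real \<Rightarrow> real^'n \<Rightarrow> real^'n \<Rightarrow> real"
    where "G t v w = v \<bullet> w + t\<^sup>2 * ((X *v v) \<bullet> (X *v w))" for t v w
  define s where "s t v = v + t *\<^sub>R (X *v v)" for t v
  have lin_s: "linear (s t)" for t
    unfolding s_def by (auto intro!: linearI simp: algebra_simps)
  have G_s: "s t v \<bullet> s t w = G t v w" if "v \<in> E" "w \<in> E" for t v w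
    using orth_X[OF that] orth_X[OF that(2,1)]
    by (simp add: s_def G_def inner_add_left inner_add_right power2_eq_square inner_commute)
  have "\<exists>c. (\<forall>b\<in>B. smooth_on UNIV (c b)) \<and>
    (\<forall>t\<in>UNIV. (\<forall>b\<in>B. c b t \<noteq> 0) \<and> (\<forall>b\<in>B. \<forall>b'\<in>B. b \<noteq> b' \<longrightarrow> G t (c b t) (c b' t) = 0) \<and>
       span ((\<lambda>b. c b t) ` B) = span B)"
  proof (rule smooth_orthogonal_frame[OF open_UNIV _ _ _ _ B(3,1)])
    show "bilinear (G t)" for t
      unfolding G_def bilinear_def
      by (auto intro!: linearI simp: inner_add_left inner_add_right algebra_simps)
    show "G t v w = G t w v" for t v w by (simp add: G_def inner_commute)
    show "G t v v > 0" if "v \<noteq> 0" for t v using that by (simp add: G_def add_pos_nonneg)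
    show "smooth_on UNIV (\<lambda>t. G t v w)" for v w
      unfolding G_def power2_eq_square
      by (intro smooth_on_add smooth_on_mult smooth_on_const smooth_on_ident open_UNIV)
  qed
  then obtain c where frame: "\<forall>b\<in>B. smooth_on UNIV (c b)"
      "\<forall>t. (\<forall>b\<in>B. c b t \<noteq> 0) \<and> (\<forall>b\<in>B. \<forall>b'\<in>B. b \<noteq> b' \<longrightarrow> G t (c b t) (c b' t) = 0) \<and>
       span ((\<lambda>b. c b t) ` B) = E"
    unfolding B(2) by blast
  have c: "\<And>b. b \<in> B \<Longrightarrow> smooth_on UNIV (c b)" "\<And>b t. b \<in> B \<Longrightarrow> c b t \<noteq> 0"
      "\<And>b b' t. b \<in> B \<Longrightarrow> b' \<in> B \<Longrightarrow> b \<noteq> b' \<Longrightarrow> G t (c b t) (c b' t) = 0"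
      "\<And>t. span ((\<lambda>b. c b t) ` B) = E"
    using frame by blast+
  have c_E: "c b t \<in> E" if "b \<in> B" for b t using c(4)[of t] that by (blast intro: span_base)
  define u where "u b t = s t (c b t)" for b t
  have u_smooth: "smooth_on UNIV (u b)" if "b \<in> B" for b
    unfolding u_def s_def
    by (intro smooth_on_add smooth_on_scaleR smooth_on_ident c(1) that open_UNIV
        bounded_bilinear.smooth_on[OF bounded_bilinear_matrix_vector_mult] smooth_on_const)
  have u_nonzero: "u b t \<bullet> u b t \<noteq> 0" if "b \<in> B" for b t
    using c(2)[OF that, of t] unfolding u_def G_s[OF c_E[OF that] c_E[OF that]] G_def
    by (metis add_pos_nonneg inner_gt_zero_iff inner_ge_zero less_irrefl mult_nonneg_nonneg zero_le_power2)
  have u_orth: "u b t \<bullet> u b' t = 0" if "b \<in> B" "b' \<in> B" "b \<noteq> b'" for b b' t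
    using c(3)[OF that, of t] c_E that unfolding u_def by (simp add: G_s)
  have span_u: "span ((\<lambda>b. u b t) ` B) = s t ` E" for t
    unfolding c(4)[of t, symmetric] u_def linear_span_image[OF lin_s, symmetric] by (simp add: image_image)
  define \<gamma> where "\<gamma> t = proj_matrix (s t ` E)" for t
  have sub: "subspace (s t ` E)" for t using E(1) lin_s by (simp add: linear_subspace_image)
  have \<gamma>_s: "\<gamma> t *v s t v = s t v" if "v \<in> E" for t v
    using that sub by (simp add: \<gamma>_def proj_matrix_mult orth_proj_eq_self)
  have "inj_on (s t) (span E)" for t
  proof (rule inj_onI)
    fix v w assume vw: "v \<in> span E" "w \<in> span E" "s t v = s t w"
    have "span E = E" using E(1) by (simp add: span_eq_iff)
    moreover have "P *v s t v = v" if "v \<in> E" for v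
      by (simp add: s_def matrix_vector_right_distrib matrix_vector_mult_scaleR P_E PXv that)
    ultimately show "v = w" using vw by metis
  qed
  then have "\<gamma> t \<in> grassmannian k" for t
    unfolding grassmannian_def \<gamma>_def using dim_image_eq[OF lin_s] sub E(2) by blast
  moreover have \<gamma>0: "\<gamma> 0 = P" by (simp add: \<gamma>_def s_def E(3))
  moreover
  have "smooth_on UNIV \<gamma>"
  proof (rule smooth_on_matrix[OF open_UNIV])
    fix e
    have "\<gamma> t *v e = (\<Sum>b\<in>B. ((u b t \<bullet> e) / (u b t \<bullet> u b t)) *\<^sub>R u b t)" for t
    proof -
      have "orth_proj (span ((\<lambda>b. u b t) ` B)) e = (\<Sum>b\<in>B. ((u b t \<bullet> e) / (u b t \<bullet> u b t)) *\<^sub>R u b t)"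
        using B(3) u_orth by (rule orth_proj_span_orthogonal)
      then show ?thesis by (simp only: \<gamma>_def proj_matrix_mult[OF sub] span_u)
    qed
    then show "smooth_on UNIV (\<lambda>t. \<gamma> t *v e)"
      using u_smooth u_nonzero
      by (simp del: inner_eq_zero_iff)
        (intro smooth_on_sum smooth_on_scaleR smooth_on_divide smooth_on_inner smooth_on_const open_UNIV; blast)
  qed
  then have "\<gamma> differentiable (at 0)" by (rule smooth_on_differentiable) simp
  then obtain X' where X': "(\<gamma> has_vector_derivative X') (at 0)"
    using vector_derivative_works by blast
  ultimately have "X' \<in> tangent_space (grassmannian k) P" unfolding tangent_space_def by blast
  moreover have "X' = X"
  proof -
    have X'_tan: "X' \<in> grassmannian_tangent P"
      by (rule tangent_space_grassmannian_subset) fact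
    have "X' *v v = X *v v" if v: "v \<in> E" for v
    proof -
      have s': "((\<lambda>t. s t v) has_vector_derivative X *v v) (at 0)"
        unfolding s_def by (auto intro!: derivative_eq_intros)
      have "((\<lambda>t. \<gamma> t *v s t v) has_vector_derivative (\<gamma> 0 *v (X *v v) + X' *v s 0 v)) (at 0)"
        by (rule bounded_bilinear.has_vector_derivative[OF bounded_bilinear_matrix_vector_mult X' s'])
      then have "((\<lambda>t. s t v) has_vector_derivative X' *v v) (at 0)"
        unfolding \<gamma>_s[OF v] \<gamma>0 PXv[OF v] by (simp add: s_def)
      then show ?thesis using s' vector_derivative_unique_at by blast
    qed
    then have eq: "X' ** P = X ** P"
      using orth_proj_in[OF E(1)]
      by (intro matrix_eqI_vector) (simp add: matrix_vector_mul_assoc[symmetric] E(3) proj_matrix_mult[OF E(1)])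
    show ?thesis by (rule grassmannian_tangent_eqI[OF X'_tan X grassmannian_transpose[OF P] eq])
  qed
  ultimately show ?thesis by simp
qed

lemma tangent_space_grassmannian:
  "P \<in> grassmannian k \<Longrightarrow> tangent_space (grassmannian k) P = grassmannian_tangent P"
  using tangent_space_grassmannian_subset tangent_space_grassmannian_superset by blast

lemma subspace_grassmannian_tangent: "subspace (grassmannian_tangent (P :: real^'n^'n))"
proof (rule subspaceI)
  show "0 \<in> grassmannian_tangent P"
    by (simp add: grassmannian_tangent_def transpose_def vec_eq_iff)
  show "X + Y \<in> grassmannian_tangent P" if "X \<in> grassmannian_tangent P" "Y \<in> grassmannian_tangent P" for X Y
  proof -
    have "P ** (X + Y) + (X + Y) ** P = (P ** X + X ** P) + (P ** Y + Y ** P)"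
      by (simp add: matrix_mult_distribs)
    then show ?thesis using that by (simp add: grassmannian_tangent_def transpose_add)
  qed
  show "r *\<^sub>R X \<in> grassmannian_tangent P" if "X \<in> grassmannian_tangent P" for r X
  proof -
    have "P ** (r *\<^sub>R X) + (r *\<^sub>R X) ** P = r *\<^sub>R (P ** X + X ** P)"
      by (simp add: matrix_mult_distribs scaleR_add_right)
    then show ?thesis using that by (simp add: grassmannian_tangent_def transpose_scalar)
  qed
qed

definition sym_part :: "real^'n^'n \<Rightarrow> real^'n^'n" where
  "sym_part Z = (1/2) *\<^sub>R (Z + transpose Z)"

text \<open>The two mixed blocks \<open>P Z (1 - P) + (1 - P) Z P\<close> of \<open>Z\<close>, multiplied out so that the
  expression is visibly polynomial in \<open>P\<close>.\<close>

definition offdiag_part :: "real^'n^'n \<Rightarrow> real^'n^'n \<Rightarrow> real^'n^'n" where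
  "offdiag_part P Z = P ** Z + Z ** P - 2 *\<^sub>R (P ** Z ** P)"

lemma offdiag_part_eq_blocks:
  "offdiag_part P Z = P ** Z ** (mat 1 - P) + (mat 1 - P) ** Z ** P"
  by (simp add: offdiag_part_def matrix_mult_distribs matrix_mul_assoc scaleR_2)

text \<open>Under transposition the two mixed blocks are exchanged, so the hypotheses kill the mixed
  blocks of \<open>Y\<close> and of its transpose.\<close>

lemma offdiag_part_symmetrized_eq_0:
  assumes "transpose P = P" "P ** Y ** (mat 1 - P) = 0" "(mat 1 - P) ** Y ** P = 0"
  shows "offdiag_part P (Y + transpose Y) = 0"
proof -
  have zero: "transpose 0 = (0 :: real^'n^'n)" by (simp add: transpose_def vec_eq_iff)
  have "P ** transpose Y ** (mat 1 - P) = transpose ((mat 1 - P) ** Y ** P)"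
    "(mat 1 - P) ** transpose Y ** P = transpose (P ** Y ** (mat 1 - P))"
    by (simp_all add: matrix_transpose_mul transpose_diff assms(1) matrix_mul_assoc)
  then show ?thesis
    using assms(2,3) unfolding offdiag_part_eq_blocks by (simp add: matrix_mult_distribs(1,2) zero)
qed

lemma transpose_sym_part: "transpose (sym_part Z) = sym_part Z"
  by (simp add: sym_part_def transpose_scalar transpose_add add.commute)

lemma sym_part_symmetric: "transpose Z = Z \<Longrightarrow> sym_part Z = Z"
  by (simp add: sym_part_def flip: scaleR_2)

lemma inner_sym_part: "transpose X = X \<Longrightarrow> sym_part Z \<bullet> X = Z \<bullet> X"
  using inner_transpose[of Z X] by (simp add: sym_part_def inner_add_left)

lemma offdiag_part_tangent:
  assumes "P ** P = P" "transpose P = P" "transpose Z = Z"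
  shows "offdiag_part P Z \<in> grassmannian_tangent P"
proof -
  have PP: "P ** (P ** Y) = P ** Y" for Y by (simp add: matrix_mul_assoc assms(1))
  have "transpose (offdiag_part P Z) = offdiag_part P Z"
    by (simp add: offdiag_part_def transpose_diff transpose_add transpose_scalar matrix_transpose_mul
        assms(2,3) add.commute matrix_mul_assoc)
  moreover have "P ** offdiag_part P Z = P ** Z - P ** Z ** P" "offdiag_part P Z ** P = Z ** P - P ** Z ** P"
    unfolding offdiag_part_def scaleR_2 matrix_mult_distribs matrix_mul_assoc[symmetric] PP assms(1)
    by simp_all
  then have "P ** offdiag_part P Z + offdiag_part P Z ** P = offdiag_part P Z"
    by (simp add: offdiag_part_def scaleR_2)
  ultimately show ?thesis by (simp add: grassmannian_tangent_def)
qed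

text \<open>Antisymmetric matrices and matrices with unmixed blocks only are orthogonal to the tangent
  space, and removing them leaves a tangent vector.\<close>

lemma orth_proj_grassmannian_tangent:
  assumes P: "P ** P = P" "transpose P = P"
  shows "orth_proj (grassmannian_tangent P) Z = offdiag_part P (sym_part Z)"
proof (rule orth_proj_unique[OF subspace_grassmannian_tangent])
  show "offdiag_part P (sym_part Z) \<in> grassmannian_tangent P"
    by (intro offdiag_part_tangent P transpose_sym_part)
  fix X assume X: "X \<in> grassmannian_tangent P"
  have "offdiag_part P (sym_part Z) \<bullet> X
      = sym_part Z \<bullet> (P ** X + X ** P) - 2 * (sym_part Z \<bullet> (P ** X ** P))"
    unfolding offdiag_part_def inner_diff_left inner_add_left inner_add_right inner_scaleR_left
      inner_matrix_mult_right[of "P ** sym_part Z"] inner_matrix_mult_left[of P]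
      inner_matrix_mult_right[of "sym_part Z"] P(2) matrix_mul_assoc ..
  also have "\<dots> = Z \<bullet> X"
    using X grassmannian_tangent_offdiag[OF X P(1)] by (simp add: grassmannian_tangent_def inner_sym_part)
  finally show "(Z - offdiag_part P (sym_part Z)) \<bullet> X = 0" by (simp add: inner_diff_left)
qed

lemma conj_mat_tangent_iff:
  assumes U: "transpose U ** U = mat 1"
  shows "conj_mat U X \<in> grassmannian_tangent (conj_mat U P) \<longleftrightarrow> X \<in> grassmannian_tangent P"
proof -
  have "inj (conj_mat U)" by (rule inj_on_inverseI) (rule conj_mat_inverse[OF U])
  moreover have "conj_mat U P ** conj_mat U X + conj_mat U X ** conj_mat U P = conj_mat U (P ** X + X ** P)"
    by (simp add: conj_mat_mult[OF U] linear_add[OF bounded_linear.linear[OF bounded_linear_conj_mat]])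
  ultimately show ?thesis
    by (simp add: grassmannian_tangent_def conj_mat_transpose inj_eq)
qed

section \<open>Equivariance of curvature under linear isometries\<close>

text \<open>A derivative within \<open>S\<close> is determined on tangent vectors only, because these are the
  velocities of curves in \<open>S\<close>. Every use of \<open>frechet_derivative\<close> within \<open>S\<close>, an arbitrary choice among
  the possible derivatives, is controlled by this uniqueness.\<close>

lemma derivative_within_tangent_unique:
  assumes "(Y has_derivative D) (at P within S)" "(Y has_derivative D') (at P within S)"
    and "v \<in> tangent_space S P"
  shows "D v = D' v"
proof -
  obtain \<gamma> where \<gamma>: "\<And>t::real. \<gamma> t \<in> S" "\<gamma> 0 = P" "(\<gamma> has_vector_derivative v) (at 0)"
    using assms(3) unfolding tangent_space_def by blast
  have *: "((\<lambda>t. Y (\<gamma> t)) has_vector_derivative D v) (at 0)"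
    if D: "(Y has_derivative D) (at P within S)" for D
  proof -
    have "(Y has_derivative D) (at (\<gamma> 0) within range \<gamma>)"
      using has_derivative_subset[OF D, of "range \<gamma>"] \<gamma>(1,2) by auto
    from has_derivative_in_compose[OF \<gamma>(3)[unfolded has_vector_derivative_def] this]
    show ?thesis
      using linear_scale[OF has_derivative_linear[OF D]] by (simp add: has_vector_derivative_def)
  qed
  show ?thesis using *[OF assms(1)] *[OF assms(2)] vector_derivative_unique_at by blast
qed

lemma tangent_space_linear_image:
  assumes "bounded_linear L" "L ` S \<subseteq> S" "v \<in> tangent_space S P"
  shows "L v \<in> tangent_space S (L P)"
proof -
  obtain \<gamma> where \<gamma>: "\<And>t::real. \<gamma> t \<in> S" "\<gamma> 0 = P" "(\<gamma> has_vector_derivative v) (at 0)"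
    using assms(3) unfolding tangent_space_def by blast
  have "((\<lambda>t. L (\<gamma> t)) has_vector_derivative L v) (at 0)"
    by (rule bounded_linear.has_vector_derivative[OF assms(1) \<gamma>(3)])
  then show ?thesis
    unfolding tangent_space_def using \<gamma>(1,2) assms(2) by (intro CollectI exI[of _ "\<lambda>t. L (\<gamma> t)"]) auto
qed

text \<open>Isometries of \<open>S\<close> that extend to linear isometries of the ambient space.\<close>

locale linear_symmetry =
  fixes S :: "'e::euclidean_space set" and L L' :: "'e \<Rightarrow> 'e"
  assumes bounded_linear: "bounded_linear L" "bounded_linear L'"
    and inverse: "\<And>x. L' (L x) = x" "\<And>x. L (L' x) = x"
    and preserves: "L ` S \<subseteq> S" "L' ` S \<subseteq> S"
    and isometric: "\<And>x y. L x \<bullet> L y = x \<bullet> y"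
    and subspace_tangent: "\<And>P. P \<in> S \<Longrightarrow> subspace (tangent_space S P)"
begin

lemma maps_to: "P \<in> S \<Longrightarrow> L P \<in> S"
  using preserves by blast

lemma tangent_maps_to: "v \<in> tangent_space S P \<Longrightarrow> L v \<in> tangent_space S (L P)"
  by (rule tangent_space_linear_image[OF bounded_linear(1) preserves(1)])

lemma orth_proj_equivariant:
  assumes "P \<in> S"
  shows "orth_proj (tangent_space S (L P)) (L x) = L (orth_proj (tangent_space S P) x)"
proof (rule orth_proj_unique[OF subspace_tangent[OF maps_to[OF assms]]])
  note T = subspace_tangent[OF assms]
  show "L (orth_proj (tangent_space S P) x) \<in> tangent_space S (L P)"
    by (intro tangent_maps_to orth_proj_in T)
  fix z assume "z \<in> tangent_space S (L P)"
  then have "L' z \<in> tangent_space S P"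
    using tangent_space_linear_image[OF bounded_linear(2) preserves(2)] inverse(1) by metis
  from orth_proj_residual[OF T this, of x]
  have "L (x - orth_proj (tangent_space S P) x) \<bullet> L (L' z) = 0" unfolding isometric .
  then show "(L x - L (orth_proj (tangent_space S P) x)) \<bullet> z = 0"
    by (simp add: inverse(2) linear_diff[OF bounded_linear.linear[OF bounded_linear(1)]])
qed

lemma frechet_derivative_equivariant:
  assumes P: "P \<in> S" and Y': "\<And>Q. Q \<in> S \<Longrightarrow> Y' (L Q) = L (Y Q)"
    and diff: "Y differentiable (at P within S)" and v: "v \<in> tangent_space S P"
  shows "frechet_derivative Y' (at (L P) within S) (L v) = L (frechet_derivative Y (at P within S) v)"
proof -
  define D where "D = frechet_derivative Y (at P within S)"
  have D: "(Y has_derivative D) (at (L' (L P)) within S)"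
    using diff by (simp add: D_def frechet_derivative_works inverse)
  have "((\<lambda>Q. Y (L' Q)) has_derivative (\<lambda>v. D (L' v))) (at (L P) within S)"
    using has_derivative_subset[OF D preserves(2)]
    by (rule has_derivative_in_compose[OF bounded_linear_imp_has_derivative[OF bounded_linear(2)]])
  from bounded_linear.has_derivative[OF bounded_linear(1) this]
  have lift: "((\<lambda>Q. L (Y (L' Q))) has_derivative (\<lambda>v. L (D (L' v)))) (at (L P) within S)" .
  have "Y' Q = L (Y (L' Q))" if "Q \<in> S" for Q
    using Y'[of "L' Q"] preserves(2) that inverse(2) by auto
  then have deriv: "(Y' has_derivative (\<lambda>v. L (D (L' v)))) (at (L P) within S)"
    using has_derivative_transform[OF maps_to[OF P] _ lift] by blast
  then have "(Y' has_derivative frechet_derivative Y' (at (L P) within S)) (at (L P) within S)"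
    unfolding frechet_derivative_works[symmetric] differentiable_def by blast
  from derivative_within_tangent_unique[OF this deriv tangent_maps_to[OF v]]
  show ?thesis by (simp add: D_def inverse)
qed

lemma cov_deriv_equivariant:
  assumes "P \<in> S" "X P \<in> tangent_space S P" "X' (L P) = L (X P)"
    and "\<And>Q. Q \<in> S \<Longrightarrow> Y' (L Q) = L (Y Q)" "Y differentiable (at P within S)"
  shows "cov_deriv S X' Y' (L P) = L (cov_deriv S X Y P)"
  unfolding cov_deriv_def assms(3)
  using frechet_derivative_equivariant[OF assms(1,4,5,2)] orth_proj_equivariant[OF assms(1)] by simp

text \<open>The fields in the definition of the curvature are projections of constant fields, hence
  are carried to the fields of the same kind that extend the transformed vectors. The hypotheses ensure
  that all derivatives occurring in the curvature exist and are evaluated at tangent vectors, so that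
  their values are unique and therefore equivariant.\<close>

lemma curvature_equivariant:
  assumes P: "P \<in> S"
    and diff: "\<And>Q z. Q \<in> S \<Longrightarrow> (\<lambda>Q. orth_proj (tangent_space S Q) z) differentiable (at Q within S)"
    and diff2: "\<And>y z. cov_deriv S (\<lambda>Q. orth_proj (tangent_space S Q) y)
        (\<lambda>Q. orth_proj (tangent_space S Q) z) differentiable (at P within S)"
    and bracket: "\<And>x y. lie_bracket S (\<lambda>Q. orth_proj (tangent_space S Q) x)
        (\<lambda>Q. orth_proj (tangent_space S Q) y) P \<in> tangent_space S P"
  shows "curvature S (L P) (L x) (L y) (L z) = L (curvature S P x y z)"
proof -
  define V where "V x = (\<lambda>Q. orth_proj (tangent_space S Q) x)" for x
  have V_equiv: "V (L x) (L Q) = L (V x Q)" if "Q \<in> S" for x Q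
    unfolding V_def by (rule orth_proj_equivariant[OF that])
  have V_tan: "V x Q \<in> tangent_space S Q" if "Q \<in> S" for x Q
    unfolding V_def using subspace_tangent[OF that] by (rule orth_proj_in)
  have V_diff: "V x differentiable (at Q within S)" if "Q \<in> S" for x Q
    unfolding V_def by (rule diff[OF that])
  have cov: "cov_deriv S (V (L y)) (V (L z)) (L Q) = L (cov_deriv S (V y) (V z) Q)" if "Q \<in> S" for y z Q
    by (rule cov_deriv_equivariant[where X = "V y" and X' = "V (L y)" and Y = "V z" and Y' = "V (L z)",
          OF that V_tan[OF that] V_equiv[OF that] V_equiv V_diff[OF that]])
  have cov2: "cov_deriv S (V (L x)) (cov_deriv S (V (L y)) (V (L z))) (L P)
      = L (cov_deriv S (V x) (cov_deriv S (V y) (V z)) P)" for x y z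
    by (rule cov_deriv_equivariant[where X = "V x" and X' = "V (L x)"
          and Y = "cov_deriv S (V y) (V z)" and Y' = "cov_deriv S (V (L y)) (V (L z))",
          OF P V_tan[OF P] V_equiv[OF P] cov diff2[folded V_def]])
  have frechet: "frechet_derivative (V (L y)) (at (L P) within S) (V (L x) (L P))
      = L (frechet_derivative (V y) (at P within S) (V x P))" for x y
    unfolding V_equiv[OF P]
    by (rule frechet_derivative_equivariant[where Y = "V y" and Y' = "V (L y)", OF P V_equiv V_diff[OF P] V_tan[OF P]])
  note L_diff = linear_diff[OF bounded_linear.linear[OF bounded_linear(1)]]
  have "lie_bracket S (V (L x)) (V (L y)) (L P) = L (lie_bracket S (V x) (V y) P)"
    unfolding lie_bracket_def frechet L_diff ..
  then have "cov_deriv S (lie_bracket S (V (L x)) (V (L y))) (V (L z)) (L P)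
      = L (cov_deriv S (lie_bracket S (V x) (V y)) (V z) P)"
    by (intro cov_deriv_equivariant P bracket[folded V_def] V_equiv V_diff)
  then show ?thesis
    unfolding curvature_def Let_def V_def[symmetric] cov2 L_diff by simp
qed

end

section \<open>The curvature of the Grassmannian\<close>

lemma differentiable_matrix_mult:
  fixes f g :: "'a::real_normed_vector \<Rightarrow> real^'n^'n"
  shows "f differentiable (at x within s) \<Longrightarrow> g differentiable (at x within s)
    \<Longrightarrow> (\<lambda>x. f x ** g x) differentiable (at x within s)"
  unfolding differentiable_def using bounded_bilinear.FDERIV[OF bounded_bilinear_matrix_mult] by blast

lemma differentiable_offdiag_part:
  assumes "f differentiable (at x within s)" "g differentiable (at x within s)"
  shows "(\<lambda>x. offdiag_part (f x) (g x)) differentiable (at x within s)"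
  unfolding offdiag_part_def
  by (intro differentiable_diff differentiable_add differentiable_scaleR differentiable_const
      differentiable_matrix_mult assms)

lemma differentiable_sym_part:
  fixes f :: "'a::real_normed_vector \<Rightarrow> real^'n^'n"
  assumes "f differentiable (at x within s)" shows "(\<lambda>x. sym_part (f x)) differentiable (at x within s)"
proof -
  have "(\<lambda>x. transpose (f x)) differentiable (at x within s)"
    using assms bounded_linear.has_derivative[OF bounded_linear_transpose] unfolding differentiable_def by blast
  then show ?thesis
    unfolding sym_part_def using assms by (intro differentiable_add differentiable_scaleR differentiable_const)
qed

lemma has_derivative_offdiag_part:
  fixes Z :: "real^'n^'n"
  shows "((\<lambda>Q. offdiag_part Q Z) has_derivative
     (\<lambda>v. v ** Z + Z ** v - 2 *\<^sub>R (v ** Z ** Q + Q ** Z ** v))) (at Q within S)"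
proof -
  note mult = bounded_bilinear.FDERIV[OF bounded_bilinear_matrix_mult]
  have "((\<lambda>Q. offdiag_part Q Z) has_derivative
     (\<lambda>v. (Q ** 0 + v ** Z) + (Z ** v + 0 ** Q) - 2 *\<^sub>R ((Q ** Z) ** v + (Q ** 0 + v ** Z) ** Q))) (at Q within S)"
    unfolding offdiag_part_def
    by (intro has_derivative_diff has_derivative_add has_derivative_scaleR_right mult
        has_derivative_ident has_derivative_const)
  then show ?thesis by (simp add: add.commute)
qed

text \<open>On the Grassmannian the projected constant field is the polynomial \<open>Q \<mapsto> offdiag_part Q (sym_part z)\<close>.\<close>

lemma grassmannian_tangent_derivative:
  fixes P :: "real^'n^'n" and k :: nat and z :: "real^'n^'n"
  defines "S \<equiv> grassmannian k"
  assumes P: "P \<in> S" and v: "v \<in> tangent_space S P"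
  shows "(\<lambda>Q. orth_proj (tangent_space S Q) z) differentiable (at P within S)"
    and "frechet_derivative (\<lambda>Q. orth_proj (tangent_space S Q) z) (at P within S) v
      = v ** sym_part z + sym_part z ** v - 2 *\<^sub>R (v ** sym_part z ** P + P ** sym_part z ** v)"
proof -
  have *: "((\<lambda>Q. orth_proj (tangent_space S Q) z) has_derivative
     (\<lambda>v. v ** sym_part z + sym_part z ** v - 2 *\<^sub>R (v ** sym_part z ** P + P ** sym_part z ** v))) (at P within S)"
    using P unfolding S_def
    by (intro has_derivative_transform[OF _ _ has_derivative_offdiag_part])
      (simp_all add: tangent_space_grassmannian orth_proj_grassmannian_tangent grassmannian_idem grassmannian_transpose)
  then show diff: "(\<lambda>Q. orth_proj (tangent_space S Q) z) differentiable (at P within S)"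
    using differentiable_def by blast
  show "frechet_derivative (\<lambda>Q. orth_proj (tangent_space S Q) z) (at P within S) v
      = v ** sym_part z + sym_part z ** v - 2 *\<^sub>R (v ** sym_part z ** P + P ** sym_part z ** v)"
    by (rule derivative_within_tangent_unique[OF diff[unfolded frechet_derivative_works] * v])
qed

text \<open>Differentiating \<open>Q W(Q) + W(Q) Q = W(Q)\<close> in direction \<open>v\<close> gives
  \<open>v W + W v + P (DW v) + (DW v) P = DW v\<close>. The anticommutators \<open>v W + W v\<close> for the two terms of the
  bracket are the same and cancel.\<close>

lemma grassmannian_bracket_tangent:
  fixes P :: "real^'n^'n"
  assumes P: "P \<in> grassmannian k"
    and X: "\<And>Q. Q \<in> grassmannian k \<Longrightarrow> X Q \<in> grassmannian_tangent Q" "X differentiable (at P within grassmannian k)"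
    and Y: "\<And>Q. Q \<in> grassmannian k \<Longrightarrow> Y Q \<in> grassmannian_tangent Q" "Y differentiable (at P within grassmannian k)"
  shows "lie_bracket (grassmannian k) X Y P \<in> grassmannian_tangent P"
proof -
  have *: "transpose (frechet_derivative W (at P within grassmannian k) v) = frechet_derivative W (at P within grassmannian k) v"
    "v ** W P + W P ** v + P ** frechet_derivative W (at P within grassmannian k) v
       + frechet_derivative W (at P within grassmannian k) v ** P
     = frechet_derivative W (at P within grassmannian k) v"
    if W: "\<And>Q. Q \<in> grassmannian k \<Longrightarrow> W Q \<in> grassmannian_tangent Q" "W differentiable (at P within grassmannian k)"
      and v: "v \<in> grassmannian_tangent P" for W v
  proof -
    note mult = bounded_bilinear.FDERIV[OF bounded_bilinear_matrix_mult]
    define D where "D = frechet_derivative W (at P within grassmannian k)"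
    have D: "(W has_derivative D) (at P within grassmannian k)"
      using W(2) by (simp add: D_def frechet_derivative_works)
    have v': "v \<in> tangent_space (grassmannian k) P" using v P by (simp add: tangent_space_grassmannian)
    have "(W has_derivative (\<lambda>v. transpose (D v))) (at P within grassmannian k)"
      by (rule has_derivative_transform[OF P _ bounded_linear.has_derivative[OF bounded_linear_transpose D]])
        (use W(1) in \<open>simp add: grassmannian_tangent_def\<close>)
    from derivative_within_tangent_unique[OF this D v'] show "transpose (D v) = D v" .
    have "(W has_derivative (\<lambda>v. (P ** D v + v ** W P) + (W P ** v + D v ** P))) (at P within grassmannian k)"
      by (rule has_derivative_transform[OF P _
            has_derivative_add[OF mult[OF has_derivative_ident D] mult[OF D has_derivative_ident]]])
        (use W(1) in \<open>simp add: grassmannian_tangent_def\<close>)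
    from derivative_within_tangent_unique[OF this D v']
    show "v ** W P + W P ** v + P ** D v + D v ** P = D v" by (simp add: add_ac)
  qed
  have "a + b + c + d - (b + a + c' + d') = (c - c') + (d - d')" for a b c c' d d' :: "real^'n^'n"
    by (simp add: algebra_simps)
  then have "P ** lie_bracket (grassmannian k) X Y P + lie_bracket (grassmannian k) X Y P ** P
      = lie_bracket (grassmannian k) X Y P"
    using *(2)[OF Y X(1)[OF P]] *(2)[OF X Y(1)[OF P]]
    unfolding lie_bracket_def matrix_mult_distribs by (metis add.commute)
  then show ?thesis
    using *(1)[OF Y X(1)[OF P]] *(1)[OF X Y(1)[OF P]]
    by (simp add: grassmannian_tangent_def lie_bracket_def transpose_diff)
qed

lemma linear_symmetry_conj_mat:
  fixes U :: "real^'n^'n"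
  assumes U: "transpose U ** U = mat 1" "U ** transpose U = mat 1"
  shows "linear_symmetry (grassmannian k) (conj_mat U) (conj_mat (transpose U))"
proof (rule linear_symmetry.intro)
  have U': "transpose (transpose U) ** transpose U = mat 1" using U by simp
  show "conj_mat U ` grassmannian k \<subseteq> grassmannian k"
    "conj_mat (transpose U) ` grassmannian k \<subseteq> grassmannian k"
    using grassmannian_conj_mat[OF U(1)] grassmannian_conj_mat[OF U'] by blast+
  show "conj_mat (transpose U) (conj_mat U x) = x" for x by (rule conj_mat_inverse[OF U(1)])
  show "conj_mat U (conj_mat (transpose U) x) = x" for x
    using conj_mat_inverse[OF U'] by simp
  show "subspace (tangent_space (grassmannian k) P)" if "P \<in> grassmannian k" for P :: "real^'n^'n"
    unfolding tangent_space_grassmannian[OF that] by (rule subspace_grassmannian_tangent)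
qed (simp_all only: bounded_linear_conj_mat conj_mat_inner[OF U(1)])

text \<open>The covariant derivative of one projected constant field along another is again polynomial
  on the Grassmannian, hence differentiable; this is the remaining regularity required by
  \<open>curvature_equivariant\<close>.\<close>

lemma curvature_grassmannian_conj_mat:
  fixes P U :: "real^'n^'n"
  assumes U: "transpose U ** U = mat 1" "U ** transpose U = mat 1" and P: "P \<in> grassmannian k"
  shows "curvature (grassmannian k) (conj_mat U P) (conj_mat U x) (conj_mat U y) (conj_mat U z)
    = conj_mat U (curvature (grassmannian k) P x y z)"
proof -
  define S :: "(real^'n^'n) set" where "S = grassmannian k"
  define V where "V z = (\<lambda>Q. orth_proj (tangent_space S Q) z)" for z
  have idem: "Q ** Q = Q" and sym: "transpose Q = Q" if "Q \<in> S" for Q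
    using that unfolding S_def by (rule grassmannian_idem grassmannian_transpose)+
  have T: "tangent_space S Q = grassmannian_tangent Q" if "Q \<in> S" for Q
    using that unfolding S_def by (rule tangent_space_grassmannian)
  have V_eq: "V z Q = offdiag_part Q (sym_part z)" if "Q \<in> S" for z Q
    unfolding V_def T[OF that] by (rule orth_proj_grassmannian_tangent[OF idem[OF that] sym[OF that]])
  have V_tan: "V z Q \<in> grassmannian_tangent Q" if "Q \<in> S" for z Q
    unfolding V_def T[OF that] by (rule orth_proj_in[OF subspace_grassmannian_tangent])
  have V_diff: "V z differentiable (at Q within S)" if "Q \<in> S" for z Q
    using grassmannian_tangent_derivative(1)[of Q k "V z Q" z] V_tan[OF that] T[OF that] that
    unfolding V_def S_def by simp
  interpret linear_symmetry S "conj_mat U" "conj_mat (transpose U)"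
    unfolding S_def by (rule linear_symmetry_conj_mat[OF U])
  show ?thesis
    unfolding S_def[symmetric]
  proof (rule curvature_equivariant[OF P[folded S_def], folded V_def])
    show "V z differentiable (at Q within S)" if "Q \<in> S" for z Q by (rule V_diff[OF that])
    show "cov_deriv S (V y) (V z) differentiable (at P within S)" for y z
    proof (rule differentiable_transform_within[OF _ zero_less_one])
      show "P \<in> S" using P by (simp add: S_def)
      let ?D = "\<lambda>Q. offdiag_part Q (sym_part y) ** sym_part z + sym_part z ** offdiag_part Q (sym_part y)
        - 2 *\<^sub>R (offdiag_part Q (sym_part y) ** sym_part z ** Q + Q ** sym_part z ** offdiag_part Q (sym_part y))"
      show "(\<lambda>Q. offdiag_part Q (sym_part (?D Q))) differentiable (at P within S)"
        by (intro differentiable_offdiag_part differentiable_sym_part differentiable_diff differentiable_add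
            differentiable_scaleR differentiable_matrix_mult differentiable_const differentiable_ident)
      fix Q assume Q: "Q \<in> S"
      have "offdiag_part Q (sym_part y) \<in> tangent_space S Q"
        using V_tan[OF Q, of y] unfolding V_eq[OF Q] T[OF Q] .
      then have "frechet_derivative (V z) (at Q within S) (V y Q) = ?D Q"
        unfolding V_eq[OF Q] unfolding V_def S_def
        by (rule grassmannian_tangent_derivative(2)[OF Q[unfolded S_def]])
      then show "offdiag_part Q (sym_part (?D Q)) = cov_deriv S (V y) (V z) Q"
        unfolding cov_deriv_def by (simp add: V_eq[OF Q, unfolded V_def])
    qed
    show "lie_bracket S (V x) (V y) P \<in> tangent_space S P" for x y
      unfolding T[OF P[folded S_def]]
      by (rule grassmannian_bracket_tangent[OF P, folded S_def]) (intro V_tan V_diff P[folded S_def]; assumption)+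
  qed
qed

section \<open>Calculus in a chart\<close>

text \<open>The part of an open set \<open>U\<close> covered by one chart \<open>c\<close>. Smoothness and derivatives are
  expressed chart by chart, so all calculus takes place here, on the open set \<open>coords\<close> of Euclidean
  space.\<close>

locale chart_region = smooth_manifold M A
  for M :: "'p topology" and A :: "('p, 'v::euclidean_space) chart set" +
  fixes c :: "('p, 'v) chart" and U :: "'p set"
  assumes chart: "c \<in> A" and openin_U: "openin M U"
begin

definition dom :: "'p set" where
  "dom = chart_dom c \<inter> U"

definition coords :: "'v set" where
  "coords = chart_map c ` dom"

definition chart_smooth :: "('p \<Rightarrow> 'b::real_normed_vector) \<Rightarrow> bool" where
  "chart_smooth h \<longleftrightarrow> smooth_on coords (h \<circ> chart_inv c)"

lemma inj_chart: "inj_on (chart_map c) (chart_dom c)"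
proof -
  have "topspace (subtopology M (chart_dom c)) = chart_dom c"
    using openin_subset[OF chart_open[OF chart]] by auto
  then show ?thesis using homeomorphic_imp_injective_map[OF chart_homeo[OF chart]] by simp
qed

lemma chart_inv_left [simp]: "p \<in> chart_dom c \<Longrightarrow> chart_inv c (chart_map c p) = p"
  unfolding chart_inv_def by (rule inv_into_f_f[OF inj_chart])

lemma dom_chart: "p \<in> dom \<Longrightarrow> p \<in> chart_dom c"
  by (simp add: dom_def)

lemma dom_topspace: "p \<in> dom \<Longrightarrow> p \<in> topspace M"
  using openin_subset[OF openin_U] by (auto simp: dom_def)

lemma coords_I: "p \<in> dom \<Longrightarrow> chart_map c p \<in> coords"
  by (simp add: coords_def)

lemma coords_D: "x \<in> coords \<Longrightarrow> chart_inv c x \<in> dom" "x \<in> coords \<Longrightarrow> chart_map c (chart_inv c x) = x"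
  by (auto simp: coords_def dom_def)

lemma open_coords: "open coords"
proof -
  have "openin (subtopology M (chart_dom c)) (U \<inter> chart_dom c)"
    using openin_U by (rule openin_subtopology_Int)
  then have "openin (top_of_set (chart_map c ` chart_dom c)) (chart_map c ` (U \<inter> chart_dom c))"
    using homeomorphic_imp_open_map[OF chart_homeo[OF chart]] unfolding open_map_def by blast
  then show ?thesis
    using chart_image_open[OF chart] openin_open_eq unfolding coords_def dom_def by (metis Int_commute)
qed

lemma smooth_map_on_chart: "smooth_map_on A U h \<Longrightarrow> chart_smooth h"
  using chart by (simp add: smooth_map_on_def chart_smooth_def coords_def dom_def)

lemma smooth_map_on_chart_topspace: "smooth_map_on A (topspace M) h \<Longrightarrow> chart_smooth h"
  unfolding chart_smooth_def coords_def dom_def smooth_map_on_def using chart openin_subset[OF openin_U]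
  by (auto elim!: smooth_on_subset dest!: bspec[OF _ chart])

lemma smooth_on_chart: "smooth_on (chart_map c ` chart_dom c) (h \<circ> chart_inv c) \<Longrightarrow> chart_smooth h"
  unfolding chart_smooth_def coords_def dom_def by (erule smooth_on_subset) auto

lemma chart_smooth_cong: "chart_smooth h \<Longrightarrow> (\<And>q. q \<in> dom \<Longrightarrow> h q = h' q) \<Longrightarrow> chart_smooth h'"
  unfolding chart_smooth_def by (erule smooth_on_cong[OF open_coords]) (simp add: coords_D)

lemma chart_smooth_const: "chart_smooth (\<lambda>q. a)"
  unfolding chart_smooth_def o_def by (rule smooth_on_const)

lemma chart_smooth_diff: "chart_smooth h \<Longrightarrow> chart_smooth h' \<Longrightarrow> chart_smooth (\<lambda>q. h q - h' q)"
  unfolding chart_smooth_def o_def by (rule smooth_on_diff[OF open_coords])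

lemma chart_smooth_add: "chart_smooth h \<Longrightarrow> chart_smooth h' \<Longrightarrow> chart_smooth (\<lambda>q. h q + h' q)"
  unfolding chart_smooth_def o_def by (rule smooth_on_add[OF open_coords])

lemma chart_smooth_sum: "(\<And>i. i \<in> I \<Longrightarrow> chart_smooth (h i)) \<Longrightarrow> chart_smooth (\<lambda>q. \<Sum>i\<in>I. h i q)"
  unfolding chart_smooth_def o_def by (rule smooth_on_sum[OF open_coords])

lemma chart_smooth_bilinear:
  "bounded_bilinear B \<Longrightarrow> chart_smooth h \<Longrightarrow> chart_smooth h' \<Longrightarrow> chart_smooth (\<lambda>q. B (h q) (h' q))"
  unfolding chart_smooth_def o_def by (rule bounded_bilinear.smooth_on[OF _ open_coords])

lemma chart_smooth_divide:
  fixes h h' :: "'p \<Rightarrow> real"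
  shows "chart_smooth h \<Longrightarrow> chart_smooth h' \<Longrightarrow> (\<And>q. q \<in> dom \<Longrightarrow> h' q \<noteq> 0) \<Longrightarrow> chart_smooth (\<lambda>q. h q / h' q)"
  unfolding chart_smooth_def o_def by (rule smooth_on_divide[OF open_coords]) (auto dest: coords_D)

lemmas chart_smooth_scaleR = chart_smooth_bilinear[OF bounded_bilinear_scaleR]
lemmas chart_smooth_inner = chart_smooth_bilinear[OF bounded_bilinear_inner]

lemma chart_smooth_linear_family:
  fixes L :: "'p \<Rightarrow> 'a::euclidean_space \<Rightarrow> 'b::real_normed_vector"
  shows "(\<And>q. q \<in> dom \<Longrightarrow> linear (L q)) \<Longrightarrow> (\<And>w. chart_smooth (\<lambda>q. L q w)) \<Longrightarrow> chart_smooth W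
    \<Longrightarrow> chart_smooth (\<lambda>q. L q (W q))"
  unfolding chart_smooth_def o_def by (rule smooth_on_linear_family[OF open_coords]) (auto dest: coords_D)

lemma chart_smooth_matrix:
  fixes F :: "'p \<Rightarrow> real^'n^'m"
  shows "(\<And>e. chart_smooth (\<lambda>q. F q *v e)) \<Longrightarrow> chart_smooth F"
  unfolding chart_smooth_def o_def by (rule smooth_on_matrix[OF open_coords])

lemma chart_smooth_transpose: "chart_smooth F \<Longrightarrow> chart_smooth (\<lambda>q. transpose (F q))"
  for F :: "'p \<Rightarrow> real^'n^'m"
  unfolding chart_smooth_def o_def by (rule smooth_on_transpose[OF open_coords])

lemma has_coord_deriv:
  assumes "chart_smooth h" "p \<in> dom"
  shows "((\<lambda>x. h (chart_inv c x)) has_derivative coord_deriv c h p) (at (chart_map c p))"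
  using smooth_on_has_derivative[OF assms(1)[unfolded chart_smooth_def] coords_I[OF assms(2)]]
  by (simp add: coord_deriv_def[abs_def] o_def)

lemma coord_derivI:
  assumes "((\<lambda>x. h (chart_inv c x)) has_derivative D) (at (chart_map c p))"
  shows "coord_deriv c h p v = D v"
  using frechet_derivative_at[OF assms] by (simp add: coord_deriv_def o_def)

lemma linear_coord_deriv: "chart_smooth h \<Longrightarrow> p \<in> dom \<Longrightarrow> linear (coord_deriv c h p)"
  by (rule has_derivative_linear[OF has_coord_deriv])

lemma coord_deriv_cong:
  assumes "chart_smooth h" "p \<in> dom" "\<And>q. q \<in> dom \<Longrightarrow> h q = h' q"
  shows "coord_deriv c h' p v = coord_deriv c h p v"
  by (rule coord_derivI, rule has_derivative_transform_within_open[OF has_coord_deriv[OF assms(1,2)] open_coords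
        coords_I[OF assms(2)]]) (simp add: assms(3) coords_D)

lemma coord_deriv_const: "coord_deriv c (\<lambda>q. a) p v = 0"
  by (simp add: coord_deriv_def o_def)

lemma coord_deriv_add:
  "chart_smooth h \<Longrightarrow> chart_smooth h' \<Longrightarrow> p \<in> dom \<Longrightarrow>
    coord_deriv c (\<lambda>q. h q + h' q) p v = coord_deriv c h p v + coord_deriv c h' p v"
  by (rule coord_derivI[OF has_derivative_add[OF has_coord_deriv has_coord_deriv]])

lemma coord_deriv_bilinear:
  assumes "bounded_bilinear B" "chart_smooth h" "chart_smooth h'" "p \<in> dom"
  shows "coord_deriv c (\<lambda>q. B (h q) (h' q)) p v
    = B (h p) (coord_deriv c h' p v) + B (coord_deriv c h p v) (h' p)"
  using coord_derivI[OF bounded_bilinear.FDERIV[OF assms(1) has_coord_deriv[OF assms(2,4)]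
    has_coord_deriv[OF assms(3,4)]]] assms(4) by (simp add: dom_chart)

lemma coord_deriv_bounded_linear:
  assumes "bounded_linear L" "chart_smooth h" "p \<in> dom"
  shows "coord_deriv c (\<lambda>q. L (h q)) p v = L (coord_deriv c h p v)"
  by (rule coord_derivI[OF bounded_linear.has_derivative[OF assms(1) has_coord_deriv[OF assms(2,3)]]])

text \<open>The product rule for a linear map \<open>L q\<close> applied to a vector \<open>W q\<close>, both depending on the
  point: the first term differentiates \<open>L\<close> with the vector frozen at \<open>p\<close>.\<close>

lemma coord_deriv_linear_family:
  fixes L :: "'p \<Rightarrow> 'a::euclidean_space \<Rightarrow> 'b::real_normed_vector"
  assumes L: "\<And>q. q \<in> dom \<Longrightarrow> linear (L q)" "\<And>w. chart_smooth (\<lambda>q. L q w)"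
    and W: "chart_smooth W" and p: "p \<in> dom"
  shows "coord_deriv c (\<lambda>q. L q (W q)) p v = coord_deriv c (\<lambda>q. L q (W p)) p v + L p (coord_deriv c W p v)"
proof -
  have *: "coord_deriv c (\<lambda>q. L q (W q)) p v
     = (\<Sum>b\<in>Basis. (W p \<bullet> b) *\<^sub>R coord_deriv c (\<lambda>q. L q b) p v) + L p (coord_deriv c W p v)"
    if W: "chart_smooth W" for W
  proof -
    have summand: "((\<lambda>x. (W (chart_inv c x) \<bullet> b) *\<^sub>R L (chart_inv c x) b) has_derivative
      (\<lambda>v. (W p \<bullet> b) *\<^sub>R coord_deriv c (\<lambda>q. L q b) p v + (coord_deriv c W p v \<bullet> b) *\<^sub>R L p b)) (at (chart_map c p))"
      for b
      using bounded_bilinear.FDERIV[OF bounded_bilinear_scaleR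
          has_derivative_inner_left[OF has_coord_deriv[OF W p]] has_coord_deriv[OF L(2) p], of b b] p
      by (simp add: dom_chart)
    have "((\<lambda>x. L (chart_inv c x) (W (chart_inv c x))) has_derivative
      (\<lambda>v. \<Sum>b\<in>Basis. (W p \<bullet> b) *\<^sub>R coord_deriv c (\<lambda>q. L q b) p v + (coord_deriv c W p v \<bullet> b) *\<^sub>R L p b)) (at (chart_map c p))"
      by (rule has_derivative_transform_within_open[OF has_derivative_sum[OF summand] open_coords coords_I[OF p]])
        (simp add: linear_family_expand[OF L(1), symmetric] coords_D)
    from coord_derivI[OF this, of v] show ?thesis
      by (simp add: sum.distrib linear_family_expand[OF L(1)[OF p], of "coord_deriv c W p v"])
  qed
  show ?thesis
    unfolding *[OF W] *[OF chart_smooth_const, of "W p"] coord_deriv_const using L(1)[OF p] by (simp add: linear_0)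
qed

lemma coord_deriv_eq_frechet:
  "x \<in> coords \<Longrightarrow> coord_deriv c h (chart_inv c x) v = frechet_derivative (h \<circ> chart_inv c) (at x) v"
  by (simp add: coord_deriv_def coords_D)

lemma chart_smooth_coord_deriv: "chart_smooth h \<Longrightarrow> chart_smooth (\<lambda>q. coord_deriv c h q v)"
  unfolding chart_smooth_def
  by (rule smooth_on_cong[OF open_coords smooth_on_derivative]) (auto simp: coord_deriv_eq_frechet)

lemma coord_deriv_symmetric:
  fixes h :: "'p \<Rightarrow> 'b::euclidean_space"
  assumes h: "chart_smooth h" and p: "p \<in> dom"
  shows "coord_deriv c (\<lambda>q. coord_deriv c h q w) p v = coord_deriv c (\<lambda>q. coord_deriv c h q v) p w"
proof -
  have "coord_deriv c (\<lambda>q. coord_deriv c h q w) p v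
      = frechet_derivative (\<lambda>x. frechet_derivative (h \<circ> chart_inv c) (at x) w) (at (chart_map c p)) v" for v w
  proof (rule coord_derivI, rule has_derivative_transform_within_open[OF _ open_coords coords_I[OF p]])
    show "((\<lambda>x. frechet_derivative (h \<circ> chart_inv c) (at x) w) has_derivative
        frechet_derivative (\<lambda>x. frechet_derivative (h \<circ> chart_inv c) (at x) w) (at (chart_map c p)))
        (at (chart_map c p))"
      using h coords_I[OF p] unfolding chart_smooth_def
      by (intro smooth_on_has_derivative smooth_on_derivative)
  qed (simp add: coord_deriv_eq_frechet)
  then show ?thesis
    using symmetric_second_derivative[OF open_coords h[unfolded chart_smooth_def] coords_I[OF p]] by simp
qed

end

context smooth_manifold
begin

lemma chart_regionI: "c \<in> A \<Longrightarrow> openin M U \<Longrightarrow> chart_region M A c U"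
  by (simp add: chart_region_def chart_region_axioms_def smooth_manifold_axioms)

lemma chart_dom_topspace: "c \<in> A \<Longrightarrow> p \<in> chart_dom c \<Longrightarrow> p \<in> topspace M"
  using cover by blast

lemma smooth_map_onI:
  assumes "\<And>c. c \<in> A \<Longrightarrow> chart_region.chart_smooth c U h"
    and "openin M U"
  shows "smooth_map_on A U h"
  unfolding smooth_map_on_def
proof
  fix c assume c: "c \<in> A"
  interpret chart_region M A c U by (rule chart_regionI[OF c assms(2)])
  show "smooth_on (chart_map c ` (chart_dom c \<inter> U)) (h \<circ> chart_inv c)"
    using assms(1)[OF c] unfolding chart_smooth_def coords_def dom_def .
qed

text \<open>The chain rule for a change of charts.\<close>

lemma coord_deriv_change:
  fixes h :: "'p \<Rightarrow> 'b::euclidean_space"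
  assumes "c \<in> A" "d \<in> A" "p \<in> chart_dom c" "p \<in> chart_dom d" "smooth_map_on A (topspace M) h"
  shows "coord_deriv c h p v = coord_deriv d h p (coord_deriv c (chart_map d) p v)"
proof -
  interpret d: chart_region M A d "topspace M" by (rule chart_regionI[OF assms(2) openin_topspace])
  interpret c: chart_region M A c "chart_dom d" by (rule chart_regionI[OF assms(1) chart_open[OF assms(2)]])
  have p: "p \<in> c.dom" "p \<in> d.dom"
    using assms(3,4) chart_dom_topspace[OF assms(1,3)] by (auto simp: c.dom_def d.dom_def)
  have "c.chart_smooth (chart_map d)"
    unfolding c.chart_smooth_def c.coords_def c.dom_def using transition_smooth[OF assms(1,2)] .
  note D1 = c.has_coord_deriv[OF this p(1)]
  have "d.chart_smooth h" using assms(5) by (rule d.smooth_map_on_chart)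
  from d.has_coord_deriv[OF this p(2)]
  have D2: "((\<lambda>x. h (chart_inv d x)) has_derivative coord_deriv d h p) (at (chart_map d (chart_inv c (chart_map c p))))"
    using assms(3) by simp
  have "((\<lambda>x. h (chart_inv c x)) has_derivative (\<lambda>v. coord_deriv d h p (coord_deriv c (chart_map d) p v))) (at (chart_map c p))"
    by (rule has_derivative_transform_within_open[OF has_derivative_compose[OF D1 D2] c.open_coords c.coords_I[OF p(1)]])
      (use c.coords_D c.dom_def in auto)
  from c.coord_derivI[OF this] show ?thesis .
qed

lemma tangent_image_eq_range:
  fixes f :: "'p \<Rightarrow> 'b::euclidean_space"
  assumes "smooth_map_on A (topspace M) f" "c \<in> A" "p \<in> chart_dom c"
  shows "tangent_image A f p = range (coord_deriv c f p)"
proof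
  show "range (coord_deriv c f p) \<subseteq> tangent_image A f p"
    using assms(2,3) unfolding tangent_image_def by blast
  show "tangent_image A f p \<subseteq> range (coord_deriv c f p)"
  proof
    fix x assume "x \<in> tangent_image A f p"
    then obtain d v where "d \<in> A" "p \<in> chart_dom d" "x = coord_deriv d f p v"
      unfolding tangent_image_def by blast
    then show "x \<in> range (coord_deriv c f p)"
      using coord_deriv_change[OF _ assms(2) _ assms(3,1), of d v] by blast
  qed
qed

lemma subspace_tangent_image:
  fixes f :: "'p \<Rightarrow> 'b::euclidean_space"
  assumes "smooth_map_on A (topspace M) f" "p \<in> topspace M"
  shows "subspace (tangent_image A f p)"
proof -
  obtain c where c: "c \<in> A" "p \<in> chart_dom c" using assms(2) cover by blast
  interpret chart_region M A c "topspace M" by (rule chart_regionI[OF c(1) openin_topspace])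
  have "linear (coord_deriv c f p)"
    using c assms by (intro linear_coord_deriv smooth_map_on_chart) (auto simp: dom_def)
  then show ?thesis
    unfolding tangent_image_eq_range[OF assms(1) c] by (simp add: linear_subspace_image)
qed

end

section \<open>Isometric immersions and their Gauss maps\<close>

lemma (in smooth_manifold) dom_topspace_eq:
  assumes "c \<in> A" shows "chart_region.dom c (topspace M) = chart_dom c"
proof -
  interpret chart_region M A c "topspace M" by (rule chart_regionI[OF assms openin_topspace])
  show ?thesis unfolding dom_def using chart_dom_topspace[OF assms] by blast
qed

text \<open>The frame is orthogonal for \<open>g\<close> itself, so it can be pushed forward by every isometric
  immersion of the manifold.\<close>

lemma (in riemannian_manifold) smooth_orthogonal_tangent_frame:
  assumes c: "c \<in> A"
  obtains e :: "'v \<Rightarrow> 'p \<Rightarrow> 'v" where "\<And>b. b \<in> Basis \<Longrightarrow> smooth_on (chart_map c ` chart_dom c) (e b \<circ> chart_inv c)"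
    "\<And>p b. p \<in> chart_dom c \<Longrightarrow> b \<in> Basis \<Longrightarrow> e b p \<noteq> 0"
    "\<And>p b b'. p \<in> chart_dom c \<Longrightarrow> b \<in> Basis \<Longrightarrow> b' \<in> Basis \<Longrightarrow> b \<noteq> b' \<Longrightarrow> g c p (e b p) (e b' p) = 0"
    "\<And>p. p \<in> chart_dom c \<Longrightarrow> span ((\<lambda>b. e b p) ` Basis) = UNIV"
proof -
  interpret chart_region M A c "topspace M" by (rule chart_regionI[OF c openin_topspace])
  have dom: "dom = chart_dom c" using dom_topspace_eq[OF c] .
  have inv: "chart_inv c x \<in> chart_dom c" if "x \<in> coords" for x using coords_D(1)[OF that] dom by simp
  have "\<exists>e :: 'v \<Rightarrow> 'v \<Rightarrow> 'v. (\<forall>b\<in>Basis. smooth_on coords (e b)) \<and>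
    (\<forall>x\<in>coords. (\<forall>b\<in>Basis. e b x \<noteq> 0) \<and>
       (\<forall>b\<in>Basis. \<forall>b'\<in>Basis. b \<noteq> b' \<longrightarrow> g c (chart_inv c x) (e b x) (e b' x) = 0) \<and>
       span ((\<lambda>b. e b x) ` Basis) = span Basis)"
  proof (rule smooth_orthogonal_frame[where G = "\<lambda>x. g c (chart_inv c x)", OF open_coords _ _ _ _ finite_Basis independent_Basis])
    show "bilinear (g c (chart_inv c x))" if "x \<in> coords" for x
      by (rule metric_bilinear[OF c inv[OF that]])
    show "g c (chart_inv c x) v w = g c (chart_inv c x) w v" if "x \<in> coords" for x v w
      by (rule metric_sym[OF c inv[OF that]])
    show "g c (chart_inv c x) v v > 0" if "x \<in> coords" "v \<noteq> 0" for x v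
      by (rule metric_pos[OF c inv[OF that(1)] that(2)])
    show "smooth_on coords (\<lambda>x. g c (chart_inv c x) v w)" for v w
      using metric_smooth[OF c, of v w] by (simp add: coords_def dom o_def)
  qed
  then obtain e :: "'v \<Rightarrow> 'v \<Rightarrow> 'v" where e: "\<forall>b\<in>Basis. smooth_on coords (e b)"
    "\<forall>x\<in>coords. (\<forall>b\<in>Basis. e b x \<noteq> 0) \<and>
       (\<forall>b\<in>Basis. \<forall>b'\<in>Basis. b \<noteq> b' \<longrightarrow> g c (chart_inv c x) (e b x) (e b' x) = 0) \<and>
       span ((\<lambda>b. e b x) ` Basis) = span Basis" by blast
  have x: "chart_map c p \<in> coords" "chart_inv c (chart_map c p) = p" if "p \<in> chart_dom c" for p
    using that coords_I dom by simp_all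
  show thesis
  proof (rule that[of "\<lambda>b p. e b (chart_map c p)"])
    fix b :: 'v assume b: "b \<in> Basis"
    show "smooth_on (chart_map c ` chart_dom c) ((\<lambda>p. e b (chart_map c p)) \<circ> chart_inv c)"
      using e(1) b smooth_on_cong[OF open_coords, of "e b" "(\<lambda>p. e b (chart_map c p)) \<circ> chart_inv c"]
      unfolding coords_def dom by (auto simp: coords_D(2)[unfolded coords_def dom])
  next
    fix p b assume "p \<in> chart_dom c" "b \<in> (Basis :: 'v set)"
    then show "e b (chart_map c p) \<noteq> 0" using e(2) x by blast
  next
    fix p and b b' :: 'v
    assume "p \<in> chart_dom c" "b \<in> Basis" "b' \<in> Basis" "b \<noteq> b'"
    then show "g c p (e b (chart_map c p)) (e b' (chart_map c p)) = 0" using e(2) x by metis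
  next
    fix p assume "p \<in> chart_dom c"
    then show "span ((\<lambda>b. e b (chart_map c p)) ` Basis) = UNIV" using e(2) x by (metis span_Basis)
  qed
qed

locale isometrically_immersed = riemannian_manifold M A g
  for M :: "'p topology" and A :: "('p, 'v::euclidean_space) chart set" and g +
  fixes f :: "'p \<Rightarrow> real ^ 'n"
  assumes immersion: "isometric_immersion M A g f"
begin

lemma smooth: "smooth_map_on A (topspace M) f"
  using immersion by (simp add: isometric_immersion_def)

lemma isometric:
  "c \<in> A \<Longrightarrow> p \<in> chart_dom c \<Longrightarrow> coord_deriv c f p v \<bullet> coord_deriv c f p w = g c p v w"
  using immersion by (simp add: isometric_immersion_def)

lemma linear_differential:
  assumes "c \<in> A" "p \<in> chart_dom c" shows "linear (coord_deriv c f p)"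
proof -
  interpret chart_region M A c "topspace M" by (rule chart_regionI[OF assms(1) openin_topspace])
  show ?thesis
    using assms smooth by (intro linear_coord_deriv smooth_map_on_chart) (simp_all add: dom_topspace_eq)
qed

lemma smooth_differential_apply:
  assumes "c \<in> A" "chart_region.chart_smooth c (topspace M) W"
  shows "chart_region.chart_smooth c (topspace M) (\<lambda>q. coord_deriv c f q (W q))"
proof -
  interpret chart_region M A c "topspace M" by (rule chart_regionI[OF assms(1) openin_topspace])
  show ?thesis
    by (rule chart_smooth_linear_family[OF linear_differential[OF assms(1) dom_chart]
          chart_smooth_coord_deriv[OF smooth_map_on_chart[OF smooth]] assms(2)])
qed

lemma inj_differential:
  assumes "c \<in> A" "p \<in> chart_dom c" shows "inj (coord_deriv c f p)"
proof (subst linear_injective_0[OF linear_differential[OF assms]], intro allI impI)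
  fix v assume "coord_deriv c f p v = 0"
  then have "g c p v v = 0" using isometric[OF assms, of v v] by simp
  then show "v = 0" using metric_pos[OF assms, of v] by auto
qed

lemma tangent_image_chart:
  "c \<in> A \<Longrightarrow> p \<in> chart_dom c \<Longrightarrow> tangent_image A f p = range (coord_deriv c f p)"
  by (rule tangent_image_eq_range[OF smooth])

lemma subspace_tangent: "p \<in> topspace M \<Longrightarrow> subspace (tangent_image A f p)"
  by (rule subspace_tangent_image[OF smooth])

lemma gauss_map_mult: "p \<in> topspace M \<Longrightarrow> gauss_map A f p *v y = orth_proj (tangent_image A f p) y"
  unfolding gauss_map_def by (rule proj_matrix_mult[OF subspace_tangent])

lemma gauss_map_differential:
  assumes "c \<in> A" "p \<in> chart_dom c"
  shows "gauss_map A f p *v coord_deriv c f p w = coord_deriv c f p w"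
  unfolding gauss_map_mult[OF chart_dom_topspace[OF assms]]
  by (rule orth_proj_eq_self[OF subspace_tangent[OF chart_dom_topspace[OF assms]]])
    (simp add: tangent_image_chart[OF assms])

lemma normal_proj:
  "p \<in> topspace M \<Longrightarrow> orth_proj (normal_space A f p) y = y - gauss_map A f p *v y"
  unfolding normal_space_def by (simp add: orth_proj_orthogonal_comp subspace_tangent gauss_map_mult)

lemma normal_space_iff: "p \<in> topspace M \<Longrightarrow> y \<in> normal_space A f p \<longleftrightarrow> gauss_map A f p *v y = 0"
  using orth_proj_in[OF subspace_orthogonal_comp, of "tangent_image A f p" y]
    orth_proj_eq_self[OF subspace_orthogonal_comp, of y "tangent_image A f p"] normal_proj[of p y]
  unfolding normal_space_def by auto

lemma gauss_map_grassmannian: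
  assumes p: "p \<in> topspace M" shows "gauss_map A f p \<in> grassmannian DIM('v)"
proof -
  obtain c where c: "c \<in> A" "p \<in> chart_dom c" using p cover by blast
  have "dim (tangent_image A f p) = DIM('v)"
    unfolding tangent_image_chart[OF c]
    using dim_image_eq[OF linear_differential[OF c], of UNIV] inj_differential[OF c] by simp
  then show ?thesis
    unfolding grassmannian_def gauss_map_def using subspace_tangent[OF p] by blast
qed

text \<open>The usual derivation of the Koszul formula: differentiate \<open>g(w,z) = df(w) \<bullet> df(z)\<close> and its
  permutations; by symmetry of second derivatives all terms but two cancel.\<close>

lemma koszul:
  assumes c: "c \<in> A" and p: "p \<in> chart_dom c"
  shows "2 * (coord_deriv c (\<lambda>q. coord_deriv c f q w) p v \<bullet> coord_deriv c f p z)
    = coord_deriv c (\<lambda>q. g c q w z) p v + coord_deriv c (\<lambda>q. g c q v z) p w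
     - coord_deriv c (\<lambda>q. g c q v w) p z"
proof -
  interpret chart_region M A c "topspace M" by (rule chart_regionI[OF c openin_topspace])
  have p': "p \<in> dom" using p dom_topspace_eq[OF c] by simp
  have f: "chart_smooth f" using smooth by (rule smooth_map_on_chart)
  have metric_deriv: "coord_deriv c (\<lambda>q. g c q w z) p v
    = coord_deriv c f p w \<bullet> coord_deriv c (\<lambda>q. coord_deriv c f q z) p v
      + coord_deriv c (\<lambda>q. coord_deriv c f q w) p v \<bullet> coord_deriv c f p z" for v w z
  proof -
    have "coord_deriv c (\<lambda>q. g c q w z) p v
      = coord_deriv c (\<lambda>q. coord_deriv c f q w \<bullet> coord_deriv c f q z) p v"
      by (rule coord_deriv_cong[OF chart_smooth_inner p'])
        (auto intro: chart_smooth_coord_deriv f isometric[OF c] dom_chart)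
    then show ?thesis
      by (simp add: coord_deriv_bilinear[OF bounded_bilinear_inner _ _ p'] chart_smooth_coord_deriv f)
  qed
  note sym = coord_deriv_symmetric[OF f p']
  show ?thesis
    unfolding metric_deriv sym[of w v] sym[of v z] sym[of w z]
    by (simp add: inner_commute)
qed

text \<open>The tangential part of the ambient derivative is the Levi-Civita derivative: write it as
  \<open>df(u)\<close>; the Koszul formula shows that \<open>u\<close> satisfies the equations defining \<open>christoffel\<close>, and these
  have only one solution because \<open>g\<close> is definite.\<close>

lemma christoffel_eq:
  assumes c: "c \<in> A" and p: "p \<in> chart_dom c"
  shows "coord_deriv c f p (christoffel g c p v w)
    = gauss_map A f p *v coord_deriv c (\<lambda>q. coord_deriv c f q w) p v"
proof -
  define y where "y = coord_deriv c (\<lambda>q. coord_deriv c f q w) p v"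
  note E = subspace_tangent[OF chart_dom_topspace[OF c p]]
  have range_E: "coord_deriv c f p z \<in> tangent_image A f p" for z
    unfolding tangent_image_chart[OF c p] by simp
  obtain u where u: "coord_deriv c f p u = orth_proj (tangent_image A f p) y"
    using orth_proj_in[OF E, of y] tangent_image_chart[OF c p] by force
  have u_inner: "g c p u z = y \<bullet> coord_deriv c f p z" for z
    using orth_proj_residual[OF E range_E, of y z] unfolding isometric[OF c p, symmetric] u
    by (simp add: inner_diff_left)
  interpret bl: bounded_bilinear "g c p"
    using metric_bilinear[OF c p] bilinear_conv_bounded_bilinear by blast
  have "christoffel g c p v w = u"
    unfolding christoffel_def koszul[OF c p, symmetric] y_def[symmetric] u_inner[symmetric]
  proof (rule the_equality)
    fix u' assume "\<forall>z. 2 * g c p u' z = 2 * g c p u z"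
    then have "g c p (u' - u) (u' - u) = 0" by (simp add: bl.diff_left)
    then show "u' = u" using metric_pos[OF c p, of "u' - u"] by auto
  qed simp
  then show ?thesis using u gauss_map_mult[OF chart_dom_topspace[OF c p]] y_def by simp
qed

text \<open>Linearity in the differentiated field, obtained from the immersion by cancelling the
  injective differential in \<open>christoffel_eq\<close>.\<close>

lemma linear_christoffel:
  assumes c: "c \<in> A" and p: "p \<in> chart_dom c"
  shows "linear (christoffel g c p v)"
proof -
  interpret chart_region M A c "topspace M" by (rule chart_regionI[OF c openin_topspace])
  have p': "p \<in> dom" using p dom_topspace_eq[OF c] by simp
  have f: "chart_smooth f" using smooth by (rule smooth_map_on_chart)
  note D = chart_smooth_coord_deriv[OF f]
  have lin: "linear (coord_deriv c f q)" if "q \<in> dom" for q using linear_differential[OF c dom_chart[OF that]] .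
  have second_linear: "linear (\<lambda>w. coord_deriv c (\<lambda>q. coord_deriv c f q w) p v)"
    using coord_deriv_symmetric[OF f p', of _ v] linear_coord_deriv[OF D p', of v] by simp
  note inj = injD[OF inj_differential[OF c p]]
  interpret df: linear "coord_deriv c f p" by (rule linear_differential[OF c p])
  interpret df_\<Gamma>: linear "\<lambda>w. coord_deriv c f p (christoffel g c p v w)"
    unfolding christoffel_eq[OF c p]
    using linear_compose[OF second_linear matrix_vector_mul_linear[of "gauss_map A f p"]] by (simp add: o_def)
  show ?thesis
    by (rule linearI; rule inj) (simp_all add: df.add df.scale df_\<Gamma>.add df_\<Gamma>.scale)
qed

lemma gauss_map_frame:
  fixes e :: "'v \<Rightarrow> 'v"
  assumes p: "p \<in> chart_dom c" and c: "c \<in> A"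
    and "\<And>b b'. b \<in> Basis \<Longrightarrow> b' \<in> Basis \<Longrightarrow> b \<noteq> b' \<Longrightarrow> g c p (e b) (e b') = 0"
    and "span (e ` (Basis :: 'v set)) = UNIV"
  shows "gauss_map A f p *v y = coord_deriv c f p
     (\<Sum>b\<in>Basis. ((coord_deriv c f p (e b) \<bullet> y) / g c p (e b) (e b)) *\<^sub>R e b)"
proof -
  note lin = linear_differential[OF c p]
  have "span ((\<lambda>b. coord_deriv c f p (e b)) ` Basis) = coord_deriv c f p ` span (e ` Basis)"
    using linear_span_image[OF lin, of "e ` Basis"] by (simp add: image_image)
  then have span: "span ((\<lambda>b. coord_deriv c f p (e b)) ` Basis) = tangent_image A f p"
    by (simp add: assms(4) tangent_image_chart[OF c p])
  have "gauss_map A f p *v y = (\<Sum>b\<in>Basis. ((coord_deriv c f p (e b) \<bullet> y) / (coord_deriv c f p (e b) \<bullet> coord_deriv c f p (e b)))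
      *\<^sub>R coord_deriv c f p (e b))"
    unfolding gauss_map_mult[OF chart_dom_topspace[OF c p]] span[symmetric]
    by (rule orth_proj_span_orthogonal) (simp_all add: isometric[OF c p] assms(3))
  then show ?thesis by (simp add: isometric[OF c p] linear_sum[OF lin] linear_cmul[OF lin])
qed

text \<open>Coordinates of the tangential part of a fixed ambient vector \<open>y\<close>, read off from an
  orthogonal frame. Keeping the coordinates rather than the vector makes it possible to transport the
  tangential part to another immersion.\<close>

lemma smooth_tangent_coordinates:
  assumes c: "c \<in> A"
  obtains W where "chart_region.chart_smooth c (topspace M) W"
    "\<And>p. p \<in> chart_dom c \<Longrightarrow> coord_deriv c f p (W p) = gauss_map A f p *v y"
proof -
  interpret chart_region M A c "topspace M" by (rule chart_regionI[OF c openin_topspace])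
  have dom: "dom = chart_dom c" using dom_topspace_eq[OF c] .
  obtain e :: "'v \<Rightarrow> 'p \<Rightarrow> 'v" where e: "\<And>b. b \<in> Basis \<Longrightarrow> smooth_on (chart_map c ` chart_dom c) (e b \<circ> chart_inv c)"
    "\<And>p b. p \<in> chart_dom c \<Longrightarrow> b \<in> Basis \<Longrightarrow> e b p \<noteq> 0"
    "\<And>p b b'. p \<in> chart_dom c \<Longrightarrow> b \<in> Basis \<Longrightarrow> b' \<in> Basis \<Longrightarrow> b \<noteq> b' \<Longrightarrow> g c p (e b p) (e b' p) = 0"
    "\<And>p. p \<in> chart_dom c \<Longrightarrow> span ((\<lambda>b. e b p) ` Basis) = UNIV"
    by (rule smooth_orthogonal_tangent_frame[OF c]) blast
  have f: "chart_smooth f" using smooth by (rule smooth_map_on_chart)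
  have e_smooth: "chart_smooth (e b)" if "b \<in> Basis" for b using e(1)[OF that] by (rule smooth_on_chart)
  have df_e: "chart_smooth (\<lambda>q. coord_deriv c f q (e b q))" if "b \<in> Basis" for b
    by (rule smooth_differential_apply[OF c e_smooth[OF that]])
  have g_e: "chart_smooth (\<lambda>q. g c q (e b q) (e b q))" if "b \<in> Basis" for b
    by (rule chart_smooth_cong[OF chart_smooth_inner[OF df_e[OF that] df_e[OF that]]])
      (simp add: dom isometric[OF c])
  show thesis
  proof (rule that[of "\<lambda>q. \<Sum>b\<in>Basis. ((coord_deriv c f q (e b q) \<bullet> y) / g c q (e b q) (e b q)) *\<^sub>R e b q"])
    show "chart_smooth (\<lambda>q. \<Sum>b\<in>Basis. ((coord_deriv c f q (e b q) \<bullet> y) / g c q (e b q) (e b q)) *\<^sub>R e b q)"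
    proof (intro chart_smooth_sum chart_smooth_scaleR chart_smooth_divide chart_smooth_inner
        chart_smooth_const df_e g_e e_smooth)
      fix b q assume "b \<in> (Basis :: 'v set)" "q \<in> dom"
      then show "g c q (e b q) (e b q) \<noteq> 0" using metric_pos[OF c _ e(2)] dom by fastforce
    qed
    fix p assume p: "p \<in> chart_dom c"
    show "coord_deriv c f p (\<Sum>b\<in>Basis. ((coord_deriv c f p (e b p) \<bullet> y) / g c p (e b p) (e b p)) *\<^sub>R e b p)
        = gauss_map A f p *v y"
      by (rule gauss_map_frame[OF p c e(3)[OF p] e(4)[OF p], symmetric])
  qed
qed

lemma smooth_gauss_map: "smooth_map_on A (topspace M) (gauss_map A f)"
proof (rule smooth_map_onI[OF _ openin_topspace])
  fix c assume c: "c \<in> A"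
  interpret chart_region M A c "topspace M" by (rule chart_regionI[OF c openin_topspace])
  show "chart_smooth (gauss_map A f)"
  proof (rule chart_smooth_matrix)
    fix y
    obtain W where W: "chart_smooth W"
      "\<And>p. p \<in> chart_dom c \<Longrightarrow> coord_deriv c f p (W p) = gauss_map A f p *v y"
      by (rule smooth_tangent_coordinates[OF c]) blast
    have "chart_smooth (\<lambda>q. coord_deriv c f q (W q))"
      by (rule smooth_differential_apply[OF c W(1)])
    then show "chart_smooth (\<lambda>q. gauss_map A f q *v y)"
      by (rule chart_smooth_cong) (simp add: W(2) dom_topspace_eq[OF c])
  qed
qed

text \<open>The derivative of the Gauss map is the second fundamental form: differentiate
  \<open>P df(w) = df(w)\<close>.\<close>

lemma gauss_map_deriv_mult:
  assumes c: "c \<in> A" and p: "p \<in> chart_dom c"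
  shows "coord_deriv c (gauss_map A f) p v *v coord_deriv c f p w = second_fund A f c p v w"
proof -
  interpret chart_region M A c "topspace M" by (rule chart_regionI[OF c openin_topspace])
  have p': "p \<in> dom" using p dom_topspace_eq[OF c] by simp
  have f: "chart_smooth f" using smooth by (rule smooth_map_on_chart)
  note D = chart_smooth_coord_deriv[OF f, of w]
  have P: "chart_smooth (gauss_map A f)" using smooth_gauss_map by (rule smooth_map_on_chart)
  have "coord_deriv c (\<lambda>q. gauss_map A f q *v coord_deriv c f q w) p v = coord_deriv c (\<lambda>q. coord_deriv c f q w) p v"
    by (rule coord_deriv_cong[OF D p']) (simp add: gauss_map_differential[OF c dom_chart])
  then show ?thesis
    unfolding coord_deriv_bilinear[OF bounded_bilinear_matrix_vector_mult P D p'] second_fund_def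
      normal_proj[OF dom_topspace[OF p']] by (metis add_diff_cancel_left')
qed

lemma gauss_map_deriv_tangent:
  assumes c: "c \<in> A" and p: "p \<in> chart_dom c"
  shows "coord_deriv c (gauss_map A f) p v \<in> grassmannian_tangent (gauss_map A f p)"
proof -
  interpret chart_region M A c "topspace M" by (rule chart_regionI[OF c openin_topspace])
  have p': "p \<in> dom" using p dom_topspace_eq[OF c] by simp
  have P: "chart_smooth (gauss_map A f)" using smooth_gauss_map by (rule smooth_map_on_chart)
  have gr: "gauss_map A f q \<in> grassmannian DIM('v)" if "q \<in> dom" for q
    using gauss_map_grassmannian[OF dom_topspace[OF that]] .
  have "coord_deriv c (\<lambda>q. transpose (gauss_map A f q)) p v = coord_deriv c (gauss_map A f) p v"
    by (rule coord_deriv_cong[OF P p']) (simp add: grassmannian_transpose[OF gr])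
  moreover have "coord_deriv c (\<lambda>q. gauss_map A f q ** gauss_map A f q) p v = coord_deriv c (gauss_map A f) p v"
    by (rule coord_deriv_cong[OF P p']) (simp add: grassmannian_idem[OF gr])
  ultimately show ?thesis
    unfolding coord_deriv_bilinear[OF bounded_bilinear_matrix_mult P P p']
      coord_deriv_bounded_linear[OF bounded_linear_transpose P p']
    by (simp add: grassmannian_tangent_def)
qed

end

section \<open>Rotation of tangent vectors on a Kaehler manifold\<close>

context kaehler_manifold
begin

abbreviation R :: "real \<Rightarrow> ('p, 'v) chart \<Rightarrow> 'p \<Rightarrow> 'v \<Rightarrow> 'v" where
  "R \<equiv> rotation J"

lemma linear_rotation:
  assumes "c \<in> A" "p \<in> chart_dom c" shows "linear (R \<theta> c p)"
proof -
  interpret J: linear "J c p" by (rule complex_linear[OF assms])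
  show ?thesis
    by (rule linearI) (simp_all add: rotation_def J.add J.scale algebra_simps)
qed

text \<open>The mixed terms cancel because \<open>J\<close> is skew for \<open>g\<close>.\<close>

lemma rotation_isometric:
  assumes "c \<in> A" "p \<in> chart_dom c"
  shows "g c p (R \<theta> c p v) (R \<theta> c p w) = g c p v w"
proof -
  interpret g: bounded_bilinear "g c p"
    using metric_bilinear[OF assms] bilinear_conv_bounded_bilinear by blast
  have "g c p (J c p v) w = - g c p v (J c p w)"
    using complex_orthogonal[OF assms, of "J c p v" w] by (simp add: complex_square[OF assms] g.minus_left)
  then have "g c p (R \<theta> c p v) (R \<theta> c p w) = (cos \<theta>)\<^sup>2 * g c p v w + (sin \<theta>)\<^sup>2 * g c p v w"
    by (simp add: rotation_def g.add_left g.add_right g.scaleR_left g.scaleR_right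
        complex_orthogonal[OF assms] power2_eq_square algebra_simps)
  then show ?thesis by (simp flip: distrib_right)
qed

lemma linear_transition:
  assumes "c \<in> A" "d \<in> A" "p \<in> chart_dom c" "p \<in> chart_dom d"
  shows "linear (coord_deriv c (chart_map d) p)"
proof -
  interpret chart_region M A c "chart_dom d" by (rule chart_regionI[OF assms(1) chart_open[OF assms(2)]])
  have "chart_smooth (chart_map d)"
    unfolding chart_smooth_def coords_def dom_def by (rule transition_smooth[OF assms(1,2)])
  then show ?thesis using assms(3,4) by (intro linear_coord_deriv) (simp_all add: dom_def)
qed

lemma rotation_change:
  assumes "c \<in> A" "d \<in> A" "p \<in> chart_dom c" "p \<in> chart_dom d"
  shows "R \<theta> d p (coord_deriv c (chart_map d) p v) = coord_deriv c (chart_map d) p (R \<theta> c p v)"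
proof -
  interpret linear "coord_deriv c (chart_map d) p" by (rule linear_transition[OF assms])
  show ?thesis using complex_change[of c d p v] assms by (simp add: rotation_def add scale)
qed

lemma smooth_rotation:
  assumes "c \<in> A" "chart_region.chart_smooth c (topspace M) W"
  shows "chart_region.chart_smooth c (topspace M) (\<lambda>q. R \<theta> c q (W q))"
proof -
  interpret chart_region M A c "topspace M" by (rule chart_regionI[OF assms(1) openin_topspace])
  have "chart_smooth (\<lambda>q. J c q w)" for w by (rule smooth_on_chart[OF complex_smooth[OF assms(1)]])
  from chart_smooth_linear_family[OF complex_linear[OF assms(1) dom_chart] this assms(2)]
  show ?thesis
    unfolding rotation_def by (intro chart_smooth_add chart_smooth_scaleR chart_smooth_const assms(2))
qed

text \<open>Rotations are parallel because \<open>J\<close> is; the left side is the Levi-Civita derivative of the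
  field \<open>R \<theta> w\<close> with \<open>w\<close> constant in the chart.\<close>

lemma rotation_parallel:
  assumes c: "c \<in> A" and p: "p \<in> chart_dom c" and lin: "linear (christoffel g c p v)"
  shows "coord_deriv c (\<lambda>q. R \<theta> c q w) p v + christoffel g c p v (R \<theta> c p w)
    = R \<theta> c p (christoffel g c p v w)"
proof -
  interpret chart_region M A c "topspace M" by (rule chart_regionI[OF c openin_topspace])
  interpret \<Gamma>: linear "christoffel g c p v" by (rule lin)
  have p': "p \<in> dom" using p dom_topspace_eq[OF c] by simp
  have J: "chart_smooth (\<lambda>q. J c q w)" by (rule smooth_on_chart[OF complex_smooth[OF c]])
  have "coord_deriv c (\<lambda>q. R \<theta> c q w) p v = sin \<theta> *\<^sub>R coord_deriv c (\<lambda>q. J c q w) p v"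
    unfolding rotation_def
    by (simp add: coord_deriv_add coord_deriv_bilinear[OF bounded_bilinear_scaleR] chart_smooth_const
        chart_smooth_scaleR J p' coord_deriv_const)
  moreover have "coord_deriv c (\<lambda>q. J c q w) p v + christoffel g c p v (J c p w) = J c p (christoffel g c p v w)"
    using complex_parallel[OF c p, of w v] by (simp add: levi_civita_def coord_deriv_const)
  ultimately show ?thesis
    by (simp add: rotation_def \<Gamma>.add \<Gamma>.scale flip: scaleR_add_right)
qed

end

section \<open>The orthogonal matrices relating two associated immersions\<close>

text \<open>Here \<open>h\<close> is the member of the associated family of \<open>f\<close> at the angle \<open>\<theta>\<close>.\<close>

locale rotated_immersions = kaehler_manifold M A g J
    + orig: isometrically_immersed M A g f + rot: isometrically_immersed M A g h
  for M :: "'p topology" and A :: "('p, 'v::euclidean_space) chart set" and g J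
    and f h :: "'p \<Rightarrow> real ^ 'n" +
  fixes \<theta> :: real and \<psi> :: "'p \<Rightarrow> real ^ 'n \<Rightarrow> real ^ 'n"
  assumes parallel_normal: "parallel_bundle_iso M A (normal_space A h) (normal_space A f) \<psi>"
    and norm_normal: "\<And>p y. p \<in> topspace M \<Longrightarrow> y \<in> normal_space A h p \<Longrightarrow> norm (\<psi> p y) = norm y"
    and second_fund_rotated: "\<And>c p v w. c \<in> A \<Longrightarrow> p \<in> chart_dom c \<Longrightarrow>
      \<psi> p (second_fund A h c p v w) = second_fund A f c p (R \<theta> c p v) (R \<theta> c p w)"
begin

abbreviation P :: "'p \<Rightarrow> real ^ 'n ^ 'n" where
  "P \<equiv> gauss_map A f"

abbreviation P' :: "'p \<Rightarrow> real ^ 'n ^ 'n" where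
  "P' \<equiv> gauss_map A h"

lemma normal_iso:
  assumes "p \<in> topspace M"
  shows "x \<in> normal_space A h p \<Longrightarrow> \<psi> p x \<in> normal_space A f p"
    and "x \<in> normal_space A h p \<Longrightarrow> y \<in> normal_space A h p \<Longrightarrow> \<psi> p (x + y) = \<psi> p x + \<psi> p y"
    and "x \<in> normal_space A h p \<Longrightarrow> \<psi> p (r *\<^sub>R x) = r *\<^sub>R \<psi> p x"
  using parallel_normal assms unfolding parallel_bundle_iso_def bij_betw_def by blast+

text \<open>The map \<open>dh(v) \<mapsto> df(R v)\<close>. The choice of a chart in the definition is immaterial because
  the rotation commutes with changes of charts and \<open>dh\<close> is injective, see
  \<open>tangent_iso_differential\<close>.\<close>

definition tangent_iso :: "'p \<Rightarrow> real ^ 'n \<Rightarrow> real ^ 'n" where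
  "tangent_iso p y = (SOME z. \<exists>c v. c \<in> A \<and> p \<in> chart_dom c \<and>
     y = coord_deriv c h p v \<and> z = coord_deriv c f p (R \<theta> c p v))"

lemma tangent_iso_differential:
  assumes c: "c \<in> A" "p \<in> chart_dom c"
  shows "tangent_iso p (coord_deriv c h p v) = coord_deriv c f p (R \<theta> c p v)"
  unfolding tangent_iso_def
proof (rule some_equality)
  show "\<exists>d w. d \<in> A \<and> p \<in> chart_dom d \<and> coord_deriv c h p v = coord_deriv d h p w \<and>
      coord_deriv c f p (R \<theta> c p v) = coord_deriv d f p (R \<theta> d p w)"
    using c by blast
  fix z assume "\<exists>d w. d \<in> A \<and> p \<in> chart_dom d \<and> coord_deriv c h p v = coord_deriv d h p w \<and>
      z = coord_deriv d f p (R \<theta> d p w)"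
  then obtain d w where d: "d \<in> A" "p \<in> chart_dom d" "coord_deriv c h p v = coord_deriv d h p w"
      "z = coord_deriv d f p (R \<theta> d p w)" by blast
  have "coord_deriv d h p (coord_deriv c (chart_map d) p v) = coord_deriv d h p w"
    using coord_deriv_change[OF c(1) d(1) c(2) d(2) rot.smooth] d(3) by metis
  then have "w = coord_deriv c (chart_map d) p v"
    using injD[OF rot.inj_differential[OF d(1,2)]] by metis
  then show "z = coord_deriv c f p (R \<theta> c p v)"
    using coord_deriv_change[OF c(1) d(1) c(2) d(2) orig.smooth] rotation_change[OF c(1) d(1) c(2) d(2)] d(4)
    by metis
qed

definition frame_map :: "'p \<Rightarrow> real ^ 'n \<Rightarrow> real ^ 'n" where
  "frame_map p y = tangent_iso p (P' p *v y) + \<psi> p (y - P' p *v y)"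

definition Q :: "'p \<Rightarrow> real ^ 'n ^ 'n" where
  "Q p = matrix (frame_map p)"

lemma normal_part: "p \<in> topspace M \<Longrightarrow> y - P' p *v y \<in> normal_space A h p"
  unfolding rot.normal_proj[symmetric] normal_space_def by (rule orth_proj_in[OF subspace_orthogonal_comp])

lemma linear_frame_map:
  assumes p: "p \<in> topspace M" shows "linear (frame_map p)"
proof -
  obtain c where c: "c \<in> A" "p \<in> chart_dom c" using p cover by blast
  interpret dh: linear "coord_deriv c h p" by (rule rot.linear_differential[OF c])
  interpret dfR: linear "\<lambda>v. coord_deriv c f p (R \<theta> c p v)"
    using linear_compose[OF linear_rotation[OF c] orig.linear_differential[OF c]] by (simp add: o_def)
  have tangent: "\<exists>v. P' p *v y = coord_deriv c h p v" for y
    using orth_proj_in[OF rot.subspace_tangent[OF p], of y]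
    unfolding rot.gauss_map_mult[OF p] rot.tangent_image_chart[OF c] by blast
  have T_add: "tangent_iso p (P' p *v x + P' p *v y) = tangent_iso p (P' p *v x) + tangent_iso p (P' p *v y)" for x y
    using tangent[of x] tangent[of y] by (auto simp: tangent_iso_differential[OF c] dfR.add simp flip: dh.add)
  have T_scale: "tangent_iso p (r *\<^sub>R (P' p *v y)) = r *\<^sub>R tangent_iso p (P' p *v y)" for r y
    using tangent[of y] by (auto simp: tangent_iso_differential[OF c] dfR.scale simp flip: dh.scale)
  show ?thesis
  proof (rule linearI)
    fix x y r
    have split: "x + y - P' p *v (x + y) = (x - P' p *v x) + (y - P' p *v y)"
      "r *\<^sub>R y - P' p *v (r *\<^sub>R y) = r *\<^sub>R (y - P' p *v y)"
      by (simp_all add: matrix_vector_right_distrib matrix_vector_mult_scaleR scaleR_diff_right)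
    show "frame_map p (x + y) = frame_map p x + frame_map p y"
      unfolding frame_map_def split normal_iso(2)[OF p normal_part[OF p] normal_part[OF p]]
      by (simp add: matrix_vector_right_distrib T_add)
    show "frame_map p (r *\<^sub>R y) = r *\<^sub>R frame_map p y"
      unfolding frame_map_def split normal_iso(3)[OF p normal_part[OF p]]
      by (simp add: matrix_vector_mult_scaleR T_scale scaleR_add_right)
  qed
qed

lemma Q_mult: "p \<in> topspace M \<Longrightarrow> Q p *v y = tangent_iso p (P' p *v y) + \<psi> p (y - P' p *v y)"
  unfolding Q_def frame_map_def[symmetric]
  by (rule matrix_works) (simp add: linear_frame_map linear_def[symmetric] scalar_mult_eq_scaleR)

lemma normal_iso_0: "p \<in> topspace M \<Longrightarrow> \<psi> p 0 = 0"
  using normal_iso(3)[of p 0 0] rot.normal_space_iff[of p 0] by simp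

lemma tangent_iso_0: "p \<in> topspace M \<Longrightarrow> tangent_iso p 0 = 0"
proof -
  assume p: "p \<in> topspace M"
  then obtain c where c: "c \<in> A" "p \<in> chart_dom c" using cover by blast
  then show ?thesis
    using tangent_iso_differential[OF c, of 0] rot.linear_differential[OF c] orig.linear_differential[OF c]
      linear_rotation[OF c] by (simp add: linear_0)
qed

lemma Q_differential:
  assumes "c \<in> A" "p \<in> chart_dom c"
  shows "Q p *v coord_deriv c h p v = coord_deriv c f p (R \<theta> c p v)"
  using chart_dom_topspace[OF assms]
  by (simp add: Q_mult rot.gauss_map_differential[OF assms] tangent_iso_differential[OF assms] normal_iso_0)

lemma Q_normal:
  "p \<in> topspace M \<Longrightarrow> y \<in> normal_space A h p \<Longrightarrow> Q p *v y = \<psi> p y"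
  by (simp add: Q_mult rot.normal_space_iff tangent_iso_0)

lemma P'_differential:
  assumes "c \<in> A" "p \<in> chart_dom c"
  obtains v where "P' p *v y = coord_deriv c h p v"
  using orth_proj_in[OF rot.subspace_tangent[OF chart_dom_topspace[OF assms]], of y]
  unfolding rot.gauss_map_mult[OF chart_dom_topspace[OF assms]] rot.tangent_image_chart[OF assms] by blast

text \<open>\<open>Q\<close> respects the splittings into tangent and normal parts.\<close>

lemma P_Q:
  assumes p: "p \<in> topspace M" shows "P p ** Q p = Q p ** P' p"
proof (rule matrix_eqI_vector)
  fix y
  obtain c where c: "c \<in> A" "p \<in> chart_dom c" using p cover by blast
  obtain v where v: "P' p *v y = coord_deriv c h p v" by (rule P'_differential[OF c])
  have "P p *v \<psi> p (y - P' p *v y) = 0"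
    using normal_iso(1)[OF p normal_part[OF p]] orig.normal_space_iff[OF p] by blast
  then show "(P p ** Q p) *v y = (Q p ** P' p) *v y"
    by (simp only: matrix_vector_mul_assoc[symmetric] Q_mult[OF p, of y] matrix_vector_right_distrib v
        Q_differential[OF c] tangent_iso_differential[OF c] orig.gauss_map_differential[OF c] add_0_right)
qed

text \<open>Both parts of \<open>Q\<close> are isometric and have orthogonal images, so \<open>Q\<close> preserves norms.\<close>

lemma Q_orthogonal:
  assumes p: "p \<in> topspace M"
  shows "transpose (Q p) ** Q p = mat 1" "Q p ** transpose (Q p) = mat 1"
proof -
  obtain c where c: "c \<in> A" "p \<in> chart_dom c" using p cover by blast
  have pythagoras: "norm y = norm z" if "a \<bullet> b = 0" "a' \<bullet> b' = 0" "a \<bullet> a = a' \<bullet> a'" "b \<bullet> b = b' \<bullet> b'"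
      "y = a + b" "z = a' + b'" for y z a b a' b' :: "real^'n"
    using that by (simp add: norm_eq_sqrt_inner inner_add_left inner_add_right inner_commute)
  have "norm (Q p *v y) = norm y" for y
  proof -
    define n where "n = y - P' p *v y"
    have n: "n \<in> normal_space A h p" unfolding n_def by (rule normal_part[OF p])
    obtain v where v: "P' p *v y = coord_deriv c h p v" by (rule P'_differential[OF c])
    show ?thesis
    proof (rule pythagoras)
      show "y = coord_deriv c h p v + n" by (simp add: n_def v)
      show "Q p *v y = coord_deriv c f p (R \<theta> c p v) + \<psi> p n"
        by (simp add: Q_mult[OF p] v tangent_iso_differential[OF c] n_def)
      show "coord_deriv c h p v \<bullet> n = 0"
        using n unfolding normal_space_def orthogonal_comp_def orthogonal_def rot.tangent_image_chart[OF c] by blast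
      show "coord_deriv c f p (R \<theta> c p v) \<bullet> \<psi> p n = 0"
        using normal_iso(1)[OF p n]
        unfolding normal_space_def orthogonal_comp_def orthogonal_def orig.tangent_image_chart[OF c] by blast
      show "coord_deriv c f p (R \<theta> c p v) \<bullet> coord_deriv c f p (R \<theta> c p v) = coord_deriv c h p v \<bullet> coord_deriv c h p v"
        by (simp add: orig.isometric[OF c] rot.isometric[OF c] rotation_isometric[OF c])
      show "\<psi> p n \<bullet> \<psi> p n = n \<bullet> n" using norm_normal[OF p n] by (simp add: norm_eq_sqrt_inner)
    qed
  qed
  then have "orthogonal_transformation ((*v) (Q p))" by (simp add: orthogonal_transformation)
  then have "orthogonal_matrix (Q p)" by (simp add: orthogonal_transformation_matrix)
  then show "transpose (Q p) ** Q p = mat 1" "Q p ** transpose (Q p) = mat 1"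
    by (simp_all add: orthogonal_matrix_def)
qed

lemma P_eq_conj: "p \<in> topspace M \<Longrightarrow> P p = conj_mat (Q p) (P' p)"
  unfolding conj_mat_def P_Q[symmetric] matrix_mul_assoc[symmetric] by (simp add: Q_orthogonal)

text \<open>Normal parts of constant vectors are the test sections on which parallelism of \<open>\<psi>\<close> is
  used; together they span the normal bundle.\<close>

lemma smooth_normal_section:
  "smooth_section A (normal_space A h) (topspace M) (\<lambda>p. y - P' p *v y)"
  unfolding smooth_section_def
proof
  show "smooth_map_on A (topspace M) (\<lambda>p. y - P' p *v y)"
  proof (rule smooth_map_onI[OF _ openin_topspace])
    fix c assume c: "c \<in> A"
    interpret chart_region M A c "topspace M" by (rule chart_regionI[OF c openin_topspace])
    show "chart_smooth (\<lambda>p. y - P' p *v y)"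
      by (intro chart_smooth_diff chart_smooth_const chart_smooth_bilinear[OF bounded_bilinear_matrix_vector_mult]
          smooth_map_on_chart rot.smooth_gauss_map)
  qed
qed (simp add: normal_part)

text \<open>A smooth bundle map is known to be smooth only through its action on smooth sections, so
  \<open>Q\<close> is tested on the tangential and normal parts of constant vectors.\<close>

lemma smooth_Q: "smooth_map_on A (topspace M) Q"
proof (rule smooth_map_onI[OF _ openin_topspace])
  fix c assume c: "c \<in> A"
  interpret chart_region M A c "topspace M" by (rule chart_regionI[OF c openin_topspace])
  show "chart_smooth Q"
  proof (rule chart_smooth_matrix)
    fix y
    obtain W where W: "chart_smooth W"
      "\<And>p. p \<in> chart_dom c \<Longrightarrow> coord_deriv c h p (W p) = P' p *v y"
      by (rule rot.smooth_tangent_coordinates[OF c]) blast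
    have "smooth_map_on A (topspace M) (\<lambda>p. \<psi> p (y - P' p *v y))"
      using parallel_normal smooth_normal_section openin_topspace
      unfolding parallel_bundle_iso_def smooth_section_def by blast
    then have "chart_smooth (\<lambda>q. coord_deriv c f q (R \<theta> c q (W q)) + \<psi> q (y - P' q *v y))"
      by (intro chart_smooth_add orig.smooth_differential_apply smooth_rotation c W(1) smooth_map_on_chart)
    then show "chart_smooth (\<lambda>q. Q q *v y)"
    proof (rule chart_smooth_cong)
      fix q assume q: "q \<in> dom"
      show "coord_deriv c f q (R \<theta> c q (W q)) + \<psi> q (y - P' q *v y) = Q q *v y"
        unfolding Q_mult[OF dom_topspace[OF q]] W(2)[OF dom_chart[OF q], symmetric]
          tangent_iso_differential[OF c dom_chart[OF q]] ..
    qed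
  qed
qed

text \<open>The isometry of tangent images is parallel. Indeed, for \<open>w\<close> constant in the chart and
  \<open>\<Gamma>\<close> the Levi-Civita derivative of \<open>w\<close> along \<open>v\<close>, the tangential part of the derivative of
  \<open>Q dh(w) = df(R w)\<close> is \<open>df(R \<Gamma>)\<close>, as \<open>R\<close> is parallel, and this equals \<open>Q dh(\<Gamma>)\<close>, the image of the
  tangential part of the derivative of \<open>dh(w)\<close>. By the product rule, what remains is the tangential
  part of the derivative of \<open>Q\<close> applied to \<open>dh(w)\<close>.\<close>

lemma Q_deriv_tangent:
  assumes c: "c \<in> A" and p: "p \<in> chart_dom c"
  shows "P p ** coord_deriv c Q p v ** P' p = 0"
proof (rule matrix_eqI_vector)
  fix y
  interpret chart_region M A c "topspace M" by (rule chart_regionI[OF c openin_topspace])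
  have p': "p \<in> dom" using p dom_topspace_eq[OF c] by simp
  note pM = dom_topspace[OF p']
  obtain w where w: "P' p *v y = coord_deriv c h p w" by (rule P'_differential[OF c p])
  note Q = smooth_map_on_chart[OF smooth_Q] and f = smooth_map_on_chart[OF orig.smooth]
    and h = smooth_map_on_chart[OF rot.smooth]
  note \<Gamma> = rotation_parallel[OF c p rot.linear_christoffel[OF c p], of \<theta> w v]
  interpret df: linear "coord_deriv c f p" by (rule orig.linear_differential[OF c p])
  have Rw: "chart_smooth (\<lambda>q. R \<theta> c q w)" by (rule smooth_rotation[OF c chart_smooth_const])
  have "coord_deriv c (\<lambda>q. Q q *v coord_deriv c h q w) p v = coord_deriv c (\<lambda>q. coord_deriv c f q (R \<theta> c q w)) p v"
    by (rule coord_deriv_cong[OF orig.smooth_differential_apply[OF c Rw] p'])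
      (simp add: Q_differential[OF c dom_chart])
  also have "\<dots> = coord_deriv c (\<lambda>q. coord_deriv c f q (R \<theta> c p w)) p v
      + coord_deriv c f p (coord_deriv c (\<lambda>q. R \<theta> c q w) p v)"
    by (rule coord_deriv_linear_family[OF orig.linear_differential[OF c dom_chart] chart_smooth_coord_deriv[OF f] Rw p'])
  finally have "Q p *v coord_deriv c (\<lambda>q. coord_deriv c h q w) p v + coord_deriv c Q p v *v coord_deriv c h p w
     = coord_deriv c (\<lambda>q. coord_deriv c f q (R \<theta> c p w)) p v
      + coord_deriv c f p (coord_deriv c (\<lambda>q. R \<theta> c q w) p v)"
    unfolding coord_deriv_bilinear[OF bounded_bilinear_matrix_vector_mult Q chart_smooth_coord_deriv[OF h] p'] .
  then have "P p *v (Q p *v coord_deriv c (\<lambda>q. coord_deriv c h q w) p v) + P p *v (coord_deriv c Q p v *v coord_deriv c h p w)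
     = coord_deriv c f p (christoffel g c p v (R \<theta> c p w)) + coord_deriv c f p (coord_deriv c (\<lambda>q. R \<theta> c q w) p v)"
    by (metis matrix_vector_right_distrib orig.christoffel_eq[OF c p] orig.gauss_map_differential[OF c p])
  also have "\<dots> = coord_deriv c f p (R \<theta> c p (christoffel g c p v w))"
    unfolding \<Gamma>[symmetric] df.add by (rule add.commute)
  also have "\<dots> = P p *v (Q p *v coord_deriv c (\<lambda>q. coord_deriv c h q w) p v)"
    unfolding Q_differential[OF c p, symmetric] rot.christoffel_eq[OF c p] matrix_vector_mul_assoc P_Q[OF pM] ..
  finally show "(P p ** coord_deriv c Q p v ** P' p) *v y = 0 *v y"
    by (simp add: matrix_vector_mul_assoc[symmetric] w)
qed

text \<open>The same argument for the normal bundles, where the equality of the derivatives is the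
  assumption that \<open>\<psi>\<close> is parallel.\<close>

lemma Q_deriv_normal:
  assumes c: "c \<in> A" and p: "p \<in> chart_dom c"
  shows "(mat 1 - P p) ** coord_deriv c Q p v ** (mat 1 - P' p) = 0"
proof (rule matrix_eqI_vector)
  fix y
  interpret chart_region M A c "topspace M" by (rule chart_regionI[OF c openin_topspace])
  have p': "p \<in> dom" using p dom_topspace_eq[OF c] by simp
  note pM = dom_topspace[OF p']
  define n where "n q = y - P' q *v y" for q
  have n_smooth: "smooth_section A (normal_space A h) (topspace M) n"
    using smooth_normal_section[of y] by (simp add: n_def[abs_def])
  then have n: "chart_smooth n" by (simp add: smooth_section_def smooth_map_on_chart)
  note Q = smooth_map_on_chart[OF smooth_Q]
  define n' where "n' = coord_deriv c n p v"
  have "chart_smooth (\<lambda>q. \<psi> q (n q))"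
    and deriv: "bundle_deriv (normal_space A f) c (\<lambda>q. \<psi> q (n q)) p v = \<psi> p (bundle_deriv (normal_space A h) c n p v)"
    using parallel_normal n_smooth openin_topspace p pM c
    unfolding parallel_bundle_iso_def smooth_section_def by (blast intro: smooth_map_on_chart)+
  then have "coord_deriv c (\<lambda>q. Q q *v n q) p v = coord_deriv c (\<lambda>q. \<psi> q (n q)) p v"
    by (intro coord_deriv_cong[OF _ p']) (simp_all add: Q_normal dom_topspace n_def normal_part)
  then have Qn: "coord_deriv c (\<lambda>q. \<psi> q (n q)) p v = Q p *v n' + coord_deriv c Q p v *v n p"
    unfolding coord_deriv_bilinear[OF bounded_bilinear_matrix_vector_mult Q n p'] n'_def by simp
  have "(mat 1 - P p) *v (Q p *v n' + coord_deriv c Q p v *v n p) = \<psi> p (n' - P' p *v n')"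
    using deriv unfolding bundle_deriv_def orig.normal_proj[OF pM] rot.normal_proj[OF pM] Qn n'_def[symmetric]
    by (simp add: matrix_vector_mult_diff_rdistrib)
  also have "\<dots> = Q p *v (n' - P' p *v n')" by (rule Q_normal[OF pM normal_part[OF pM], symmetric])
  also have "\<dots> = (mat 1 - P p) *v (Q p *v n')"
    unfolding matrix_vector_mult_diff_rdistrib matrix_vector_mult_diff_distrib matrix_vector_mul_lid
    unfolding matrix_vector_mul_assoc P_Q[OF pM] ..
  finally have "(mat 1 - P p) *v (coord_deriv c Q p v *v n p) = 0"
    unfolding matrix_vector_right_distrib by simp
  then show "((mat 1 - P p) ** coord_deriv c Q p v ** (mat 1 - P' p)) *v y = 0 *v y"
    by (simp add: matrix_vector_mul_assoc[symmetric] n_def matrix_vector_mult_diff_rdistrib)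
qed

section \<open>The associated family of the Gauss map\<close>

text \<open>Both sides are tangent to the Grassmannian at \<open>P p\<close>, so they need only be compared on
  the vectors \<open>df(R w) = Q dh(w)\<close>, where they are \<open>\<psi>(\<alpha>\<^sub>h(v,w))\<close> and \<open>\<alpha>(R v, R w)\<close>.\<close>

lemma gauss_map_deriv_rotated:
  assumes c: "c \<in> A" and p: "p \<in> chart_dom c"
  shows "conj_mat (Q p) (coord_deriv c P' p v) = coord_deriv c P p (R \<theta> c p v)"
proof -
  note pM = chart_dom_topspace[OF c p]
  note Po = orig.gauss_map_grassmannian[OF pM]
  show ?thesis
  proof (rule grassmannian_tangent_eqI)
    show "conj_mat (Q p) (coord_deriv c P' p v) \<in> grassmannian_tangent (P p)"
      unfolding P_eq_conj[OF pM] conj_mat_tangent_iff[OF Q_orthogonal(1)[OF pM]]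
      by (rule rot.gauss_map_deriv_tangent[OF c p])
    show "coord_deriv c P p (R \<theta> c p v) \<in> grassmannian_tangent (P p)"
      by (rule orig.gauss_map_deriv_tangent[OF c p])
    show "transpose (P p) = P p" by (rule grassmannian_transpose[OF Po])
    have "conj_mat (Q p) (coord_deriv c P' p v) ** (Q p ** P' p) = coord_deriv c P p (R \<theta> c p v) ** (Q p ** P' p)"
    proof (rule matrix_eqI_vector)
      fix y
      obtain w where w: "P' p *v y = coord_deriv c h p w" by (rule P'_differential[OF c p])
      have "conj_mat (Q p) X *v (Q p *v z) = Q p *v (X *v z)" for X z
        using Q_orthogonal(1)[OF pM] by (simp add: conj_mat_def matrix_vector_mul_assoc matrix_mul_assoc[symmetric])
      then have "conj_mat (Q p) (coord_deriv c P' p v) *v (Q p *v (P' p *v y)) = Q p *v second_fund A h c p v w"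
        by (simp add: w rot.gauss_map_deriv_mult[OF c p])
      also have "\<dots> = \<psi> p (second_fund A h c p v w)"
        unfolding second_fund_def normal_space_def
        by (intro Q_normal[OF pM, unfolded normal_space_def] orth_proj_in subspace_orthogonal_comp)
      also have "\<dots> = coord_deriv c P p (R \<theta> c p v) *v (Q p *v (P' p *v y))"
        unfolding second_fund_rotated[OF c p] orig.gauss_map_deriv_mult[OF c p, symmetric] w Q_differential[OF c p] ..
      finally show "(conj_mat (Q p) (coord_deriv c P' p v) ** (Q p ** P' p)) *v y
          = (coord_deriv c P p (R \<theta> c p v) ** (Q p ** P' p)) *v y"
        by (simp add: matrix_vector_mul_assoc[symmetric])
    qed
    then show "conj_mat (Q p) (coord_deriv c P' p v) ** P p = coord_deriv c P p (R \<theta> c p v) ** P p"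
      unfolding P_eq_conj[OF pM] conj_mat_def[of "Q p" "P' p"] by (simp only: matrix_mul_assoc)
  qed
qed

lemma tangent_grassmannian:
  assumes "p \<in> topspace M"
  shows "tangent_space (grassmannian DIM('v)) (P p) = grassmannian_tangent (P p)"
    and "tangent_space (grassmannian DIM('v)) (P' p) = grassmannian_tangent (P' p)"
  using tangent_space_grassmannian[OF orig.gauss_map_grassmannian[OF assms]]
    tangent_space_grassmannian[OF rot.gauss_map_grassmannian[OF assms]] by blast+

text \<open>The derivative of \<open>Q \<xi> Q\<^sup>T\<close> is \<open>Q \<xi>' Q\<^sup>T + Y + Y\<^sup>T\<close> with \<open>Y = Q' \<xi> Q\<^sup>T\<close>. As \<open>\<xi>\<close> exchanges the
  tangent and the normal space of \<open>h\<close> and \<open>Q\<close> respects the splittings, the mixed blocks of \<open>Y\<close> are built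
  from the unmixed blocks of \<open>Q'\<close>, which vanish. So \<open>Y + Y\<^sup>T\<close> is orthogonal to the Grassmannian.\<close>

lemma conj_Q_deriv:
  assumes c: "c \<in> A" and U: "openin M U" and p: "p \<in> chart_dom c \<inter> U"
    and \<xi>: "smooth_map_on A U \<xi>" and tangent: "\<xi> p \<in> grassmannian_tangent (P' p)"
  shows "orth_proj (tangent_space (grassmannian DIM('v)) (P p)) (coord_deriv c (\<lambda>q. conj_mat (Q q) (\<xi> q)) p v)
    = conj_mat (Q p) (orth_proj (tangent_space (grassmannian DIM('v)) (P' p)) (coord_deriv c \<xi> p v))"
proof -
  interpret chart_region M A c U by (rule chart_regionI[OF c U])
  have p': "p \<in> dom" using p by (simp add: dom_def)
  note pM = dom_topspace[OF p']
  note P'gr = rot.gauss_map_grassmannian[OF pM] and Pgr = orig.gauss_map_grassmannian[OF pM]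
  interpret S: linear_symmetry "grassmannian DIM('v)" "conj_mat (Q p)" "conj_mat (transpose (Q p))"
    by (rule linear_symmetry_conj_mat[OF Q_orthogonal[OF pM]])
  note Q = smooth_map_on_chart_topspace[OF smooth_Q] and \<xi> = smooth_map_on_chart[OF \<xi>]
  note Q\<xi> = chart_smooth_bilinear[OF bounded_bilinear_matrix_mult Q \<xi>]
  define X where "X = \<xi> p"
  define X' where "X' = coord_deriv c \<xi> p v"
  define Q' where "Q' = coord_deriv c Q p v"
  define Y where "Y = Q' ** X ** transpose (Q p)"
  have QT: "chart_smooth (\<lambda>q. transpose (Q q))"
    by (rule chart_smooth_transpose[OF Q])
  have X: "transpose X = X" "P' p ** X + X ** P' p = X"
    using tangent unfolding X_def grassmannian_tangent_def by simp_all
  have "coord_deriv c (\<lambda>q. (Q q ** \<xi> q) ** transpose (Q q)) p v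
    = (Q p ** X) ** transpose Q' + (Q p ** X' + Q' ** X) ** transpose (Q p)"
    unfolding coord_deriv_bilinear[OF bounded_bilinear_matrix_mult Q\<xi> QT p']
      coord_deriv_bilinear[OF bounded_bilinear_matrix_mult Q \<xi> p']
      coord_deriv_bounded_linear[OF bounded_linear_transpose Q p'] X_def X'_def Q'_def ..
  also have "\<dots> = conj_mat (Q p) X' + (Y + transpose Y)"
    by (simp add: conj_mat_def Y_def matrix_transpose_mul matrix_mult_distribs X(1) matrix_mul_assoc)
  finally have deriv: "coord_deriv c (\<lambda>q. conj_mat (Q q) (\<xi> q)) p v = conj_mat (Q p) X' + (Y + transpose Y)"
    unfolding conj_mat_def .
  have QP: "transpose (Q p) ** P p = P' p ** transpose (Q p)"
  proof -
    have "transpose (P p ** Q p) = transpose (Q p ** P' p)" by (simp only: P_Q[OF pM])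
    then show ?thesis
      by (simp add: matrix_transpose_mul grassmannian_transpose[OF P'gr] grassmannian_transpose[OF Pgr])
  qed
  have XP: "X ** P' p = (mat 1 - P' p) ** X" "X ** (mat 1 - P' p) = P' p ** X"
    using X(2) by (simp_all add: matrix_mult_distribs) (metis add_diff_cancel_left' add_diff_cancel_right')+
  have "P p ** Y ** (mat 1 - P p) = P p ** Q' ** (X ** (transpose (Q p) - transpose (Q p) ** P p))"
    by (simp add: Y_def matrix_mul_assoc matrix_mult_distribs)
  also have "\<dots> = P p ** Q' ** ((X ** (mat 1 - P' p)) ** transpose (Q p))"
    unfolding QP by (simp add: matrix_mul_assoc matrix_mult_distribs)
  also have "\<dots> = (P p ** Q' ** P' p) ** X ** transpose (Q p)"
    unfolding XP by (simp only: matrix_mul_assoc)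
  also have "\<dots> = 0" using Q_deriv_tangent[OF c dom_chart[OF p'], of v] by (simp add: Q'_def)
  finally have block1: "P p ** Y ** (mat 1 - P p) = 0" .
  have "(mat 1 - P p) ** Y ** P p = (mat 1 - P p) ** Q' ** (X ** (transpose (Q p) ** P p))"
    by (simp only: Y_def matrix_mul_assoc)
  also have "\<dots> = (mat 1 - P p) ** Q' ** ((X ** P' p) ** transpose (Q p))"
    unfolding QP by (simp only: matrix_mul_assoc)
  also have "\<dots> = ((mat 1 - P p) ** Q' ** (mat 1 - P' p)) ** X ** transpose (Q p)"
    unfolding XP by (simp only: matrix_mul_assoc)
  also have "\<dots> = 0" using Q_deriv_normal[OF c dom_chart[OF p'], of v] by (simp add: Q'_def)
  finally have block2: "(mat 1 - P p) ** Y ** P p = 0" .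
  have "orth_proj (grassmannian_tangent (P p)) (Y + transpose Y) = offdiag_part (P p) (Y + transpose Y)"
    by (subst orth_proj_grassmannian_tangent[OF grassmannian_idem[OF Pgr] grassmannian_transpose[OF Pgr]])
      (simp add: sym_part_symmetric transpose_add add.commute)
  also have "\<dots> = 0"
    by (rule offdiag_part_symmetrized_eq_0[OF grassmannian_transpose[OF Pgr] block1 block2])
  finally have rest: "orth_proj (tangent_space (grassmannian DIM('v)) (P p)) (Y + transpose Y) = 0"
    unfolding tangent_grassmannian[OF pM] .
  have "linear (orth_proj (tangent_space (grassmannian DIM('v)) (P p)))"
    by (rule linear_orth_proj[OF S.subspace_tangent[OF Pgr]])
  then show ?thesis
    unfolding deriv using S.orth_proj_equivariant[OF P'gr, of X'] rest
    by (simp add: linear_add X'_def P_eq_conj[OF pM, symmetric])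
qed

lemma parallel_bundle_iso_conj_Q:
  "parallel_bundle_iso M A (\<lambda>p. tangent_space (grassmannian DIM('v)) (P' p))
     (\<lambda>p. tangent_space (grassmannian DIM('v)) (P p)) (\<lambda>p. conj_mat (Q p))"
  unfolding parallel_bundle_iso_def
proof (intro conjI ballI allI impI)
  fix p assume p: "p \<in> topspace M"
  interpret S: linear_symmetry "grassmannian DIM('v)" "conj_mat (Q p)" "conj_mat (transpose (Q p))"
    by (rule linear_symmetry_conj_mat[OF Q_orthogonal[OF p]])
  interpret L: linear "conj_mat (Q p)" by (rule bounded_linear.linear[OF bounded_linear_conj_mat])
  show "conj_mat (Q p) (x + y) = conj_mat (Q p) x + conj_mat (Q p) y" for x y by (rule L.add)
  show "conj_mat (Q p) (r *\<^sub>R x) = r *\<^sub>R conj_mat (Q p) x" for r x by (rule L.scale)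
  show "bij_betw (conj_mat (Q p)) (tangent_space (grassmannian DIM('v)) (P' p))
      (tangent_space (grassmannian DIM('v)) (P p))"
  proof (rule bij_betw_byWitness[where f' = "conj_mat (transpose (Q p))"])
    show "conj_mat (Q p) ` tangent_space (grassmannian DIM('v)) (P' p) \<subseteq> tangent_space (grassmannian DIM('v)) (P p)"
      unfolding P_eq_conj[OF p] using S.tangent_maps_to by blast
    show "conj_mat (transpose (Q p)) ` tangent_space (grassmannian DIM('v)) (P p) \<subseteq> tangent_space (grassmannian DIM('v)) (P' p)"
      using tangent_space_linear_image[OF S.bounded_linear(2) S.preserves(2), of _ "P p"]
      unfolding P_eq_conj[OF p] S.inverse(1) by blast
  qed (simp_all add: S.inverse)
next
  fix U \<xi>
  assume U_\<xi>: "openin M U \<and> smooth_section A (\<lambda>p. tangent_space (grassmannian DIM('v)) (P' p)) U \<xi>"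
  then have U: "openin M U" and \<xi>: "smooth_map_on A U \<xi>"
    "\<And>p. p \<in> U \<Longrightarrow> \<xi> p \<in> tangent_space (grassmannian DIM('v)) (P' p)"
    by (simp_all add: smooth_section_def)
  have pM: "p \<in> topspace M" if "p \<in> U" for p using that openin_subset[OF U] by blast
  show "smooth_section A (\<lambda>p. tangent_space (grassmannian DIM('v)) (P p)) U (\<lambda>p. conj_mat (Q p) (\<xi> p))"
    unfolding smooth_section_def
  proof
    show "smooth_map_on A U (\<lambda>p. conj_mat (Q p) (\<xi> p))"
    proof (rule smooth_map_onI[OF _ U])
      fix c assume c: "c \<in> A"
      interpret chart_region M A c U by (rule chart_regionI[OF c U])
      note Q = smooth_map_on_chart_topspace[OF smooth_Q]
      show "chart_smooth (\<lambda>p. conj_mat (Q p) (\<xi> p))"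
        unfolding conj_mat_def
        by (intro chart_smooth_bilinear[OF bounded_bilinear_matrix_mult] Q
            chart_smooth_transpose smooth_map_on_chart \<xi>(1))
    qed
    show "\<forall>p\<in>U. conj_mat (Q p) (\<xi> p) \<in> tangent_space (grassmannian DIM('v)) (P p)"
    proof
      fix p assume "p \<in> U"
      interpret S: linear_symmetry "grassmannian DIM('v)" "conj_mat (Q p)" "conj_mat (transpose (Q p))"
        by (rule linear_symmetry_conj_mat[OF Q_orthogonal[OF pM[OF \<open>p \<in> U\<close>]]])
      show "conj_mat (Q p) (\<xi> p) \<in> tangent_space (grassmannian DIM('v)) (P p)"
        unfolding P_eq_conj[OF pM[OF \<open>p \<in> U\<close>]] by (rule S.tangent_maps_to[OF \<xi>(2)[OF \<open>p \<in> U\<close>]])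
    qed
  qed
  fix c p v assume "c \<in> A" "p \<in> chart_dom c \<inter> U"
  then show "bundle_deriv (\<lambda>p. tangent_space (grassmannian DIM('v)) (P p)) c (\<lambda>q. conj_mat (Q q) (\<xi> q)) p v
      = conj_mat (Q p) (bundle_deriv (\<lambda>p. tangent_space (grassmannian DIM('v)) (P' p)) c \<xi> p v)"
    unfolding bundle_deriv_def using \<xi>(2)[of p] pM[of p] tangent_grassmannian(2)[of p]
    by (intro conj_Q_deriv[OF _ U _ \<xi>(1)]) auto
qed

end

theorem theorem3:
  fixes M :: "'p topology"
    and A :: "('p, 'v::euclidean_space) chart set"
    and g :: "('p, 'v) chart \<Rightarrow> 'p \<Rightarrow> 'v \<Rightarrow> 'v \<Rightarrow> real"
    and J :: "('p, 'v) chart \<Rightarrow> 'p \<Rightarrow> 'v \<Rightarrow> 'v"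
    and m :: nat
    and f :: "'p \<Rightarrow> real ^ 'n"
    and F :: "real \<Rightarrow> 'p \<Rightarrow> real ^ 'n"
  assumes "kaehler_manifold M A g J"
    and "DIM('v) = 2 * m"
    and "isometric_immersion M A g f"
    and "parallel_pluri_mean_curv A g J f"
    and "associated_immersions M A g J f F"
  shows "associated_maps M A J (grassmannian (2 * m)) (gauss_map A f) (\<lambda>\<theta>. gauss_map A (F \<theta>))"
proof -
  interpret kaehler_manifold M A g J by fact
  note DIM_v = assms(2)[symmetric]
  have immersed: "isometrically_immersed M A g h" if "isometric_immersion M A g h" for h :: "'p \<Rightarrow> real ^ 'n"
    by (intro isometrically_immersed.intro riemannian_manifold_axioms isometrically_immersed_axioms.intro that)
  have F: "isometric_immersion M A g (F \<theta>)" for \<theta>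
    using assms(5) by (simp add: associated_immersions_def)
  interpret orig: isometrically_immersed M A g f by (rule immersed[OF assms(3)])
  show ?thesis
    unfolding associated_maps_def DIM_v
  proof (intro conjI allI ballI)
    fix \<theta>
    interpret rot: isometrically_immersed M A g "F \<theta>" by (rule immersed[OF F])
    show "smooth_map_on A (topspace M) (gauss_map A (F \<theta>))" by (rule rot.smooth_gauss_map)
    show "gauss_map A (F \<theta>) p \<in> grassmannian DIM('v)" if "p \<in> topspace M" for p
      using that by (rule rot.gauss_map_grassmannian)
  next
    fix p assume p: "p \<in> topspace M"
    have F0: "F 0 q = f q" if "q \<in> topspace M" for q
      using assms(5) that by (simp add: associated_immersions_def)
    have "coord_deriv c (F 0) p v = coord_deriv c f p v" if c: "c \<in> A" "p \<in> chart_dom c" for c v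
    proof -
      interpret chart_region M A c "topspace M" by (rule chart_regionI[OF c(1) openin_topspace])
      show ?thesis
        by (rule coord_deriv_cong[OF smooth_map_on_chart[OF orig.smooth]])
          (use c p F0 dom_topspace in \<open>simp_all add: dom_topspace_eq\<close>)
    qed
    then have "tangent_image A (F 0) p = tangent_image A f p" 
      unfolding tangent_image_def by (intro Collect_cong iff_exI) metis
    then show "gauss_map A (F 0) p = gauss_map A f p" by (simp add: gauss_map_def)
  next
    fix \<theta>
    have "\<exists>\<psi>. parallel_bundle_iso M A (normal_space A (F \<theta>)) (normal_space A f) \<psi> \<and>
        (\<forall>p\<in>topspace M. \<forall>x\<in>normal_space A (F \<theta>) p. norm (\<psi> p x) = norm x) \<and>
        (\<forall>c\<in>A. \<forall>p\<in>chart_dom c. \<forall>v w. \<psi> p (second_fund A (F \<theta>) c p v w)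
           = second_fund A f c p (rotation J \<theta> c p v) (rotation J \<theta> c p w))"
      using assms(5) unfolding associated_immersions_def by blast
    then obtain \<psi> where "rotated_immersions_axioms M A J f (F \<theta>) \<theta> \<psi>"
      unfolding rotated_immersions_axioms_def by blast
    then interpret rotated_immersions M A g J f "F \<theta>" \<theta> \<psi>
      by (intro rotated_immersions.intro kaehler_manifold_axioms immersed assms(3) F)
    show "\<exists>\<phi>. parallel_bundle_iso M A (\<lambda>p. tangent_space (grassmannian DIM('v)) (gauss_map A (F \<theta>) p))
          (\<lambda>p. tangent_space (grassmannian DIM('v)) (gauss_map A f p)) \<phi> \<and>
        (\<forall>p\<in>topspace M. \<forall>x\<in>tangent_space (grassmannian DIM('v)) (gauss_map A (F \<theta>) p).
           \<forall>y\<in>tangent_space (grassmannian DIM('v)) (gauss_map A (F \<theta>) p).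
           \<forall>z\<in>tangent_space (grassmannian DIM('v)) (gauss_map A (F \<theta>) p).
             \<phi> p (curvature (grassmannian DIM('v)) (gauss_map A (F \<theta>) p) x y z)
             = curvature (grassmannian DIM('v)) (gauss_map A f p) (\<phi> p x) (\<phi> p y) (\<phi> p z)) \<and>
        (\<forall>c\<in>A. \<forall>p\<in>chart_dom c. \<forall>v.
           \<phi> p (coord_deriv c (gauss_map A (F \<theta>)) p v) = coord_deriv c (gauss_map A f) p (rotation J \<theta> c p v))"
    proof (intro exI[of _ "\<lambda>p. conj_mat (Q p)"] conjI ballI allI)
      fix p x y z assume p: "p \<in> topspace M"
      show "conj_mat (Q p) (curvature (grassmannian DIM('v)) (P' p) x y z)
        = curvature (grassmannian DIM('v)) (P p) (conj_mat (Q p) x) (conj_mat (Q p) y) (conj_mat (Q p) z)"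
        unfolding P_eq_conj[OF p]
        by (rule curvature_grassmannian_conj_mat[OF Q_orthogonal[OF p] rot.gauss_map_grassmannian[OF p], symmetric])
    qed (rule parallel_bundle_iso_conj_Q gauss_map_deriv_rotated; assumption?)+
  qed
qed

end
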